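(* Let $\Gamma$ be a (straight) polygon. There exist functions $u\in L^2(\mathbb R^2)$, harmonic in $\mathbb R^2\setminus\Gamma$, that cannot be achieved as the sum of a single and a double layer potential, i.e. such that there is no pair $(q,p)\in\mathcal H^{-3/2}(\Gamma)\times\mathcal H^{-1/2}(\Gamma)$ with $u=\mathscr S^\dagger_\Gamma q+\mathscr D^\dagger_\Gamma p$.
   Context: $\Gamma\subset\mathbb R^2$ is the boundary (a Jordan curve) of a polygon, with logarithmic capacity lower than $1$ (standing assumption). $\Omega^-$ is the bounded open set enclosed by $\Gamma$ and $n$ is the unit normal on $\Gamma$ directed towards the exterior of $\Omega^-$. For $u\in H^2_{loc}(\mathbb R^2)$, $\gamma_d u=u|_\Gamma$ and $\gamma_n u=\nabla u\cdot n|_\Gamma$ (both in $L^2(\Gamma)$). With $\rho(x)=\sqrt{1+|x|^2}$ and $\mathrm{lg}(x)=\ln(2+|x|^2)$, $W^2(\mathbb R^2)$ is the Hilbert space (natural norm) of distributions $u$ such that $\frac{u}{\rho^2\mathrm{lg}}$, $\frac{1}{\rho\,\mathrm{lg}}\partial_{x_j}u$ and $\partial_{x_j}\partial_{x_k}u$ are in $L^2(\mathbb R^2)$ for all $j,k$. Define $\mathcal H^{3/2}(\Gamma)=\gamma_dW^2(\mathbb R^2)$ and $\mathcal H^{1/2}(\Gamma)=\gamma_nW^2(\mathbb R^2)$, endowed (up to equivalence of norms) with the quotient norms. Both are continuously and densely embedded in $L^2(\Gamma)$; $\mathcal H^{-3/2}(\Gamma)$ and $\mathcal H^{-1/2}(\Gamma)$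 are their dual spaces with $L^2(\Gamma)$ as pivot space, with pairings $\langle\!\langle\cdot,\cdot\rangle\!\rangle_{-\frac32,\frac32}$ and $\langle\!\langle\cdot,\cdot\rangle\!\rangle_{-\frac12,\frac12}$ extending the $L^2(\Gamma)$ inner product. Let $G(x)=-\frac1{2\pi}\ln|x|$. The classical single layer potential $\mathscr S_\Gamma$ on $H^{-1/2}(\Gamma)$ is the extension by density of $\mathscr S_\Gamma q(x)=\int_\Gamma G(x-y)q(y)\,dy$, $q\in L^2(\Gamma)$; the classical double layer potential is $\mathscr D_\Gamma p(x)=\int_\Gamma\nabla_yG(x-y)\cdot n(y)\,p(y)\,dy$, $p\in H^{1/2}(\Gamma)$. $\mathscr S^\dagger_\Gamma:\mathcal H^{-3/2}(\Gamma)\to L^2_{loc}(\mathbb R^2)$ and $\mathscr D^\dagger_\Gamma:\mathcal H^{-1/2}(\Gamma)\to L^2_{loc}(\mathbb R^2)$ are their continuous extensions by density. Equivalently, $u=\mathscr S^\dagger_\Gamma q$ is the unique distribution such that $\langle u,-\Delta\theta\rangle=\langle\!\langle q,\gamma_d\theta\rangle\!\rangle_{-\frac32,\frac32}$ for all $\theta\in\mathscr D(\mathbb R^2)$ and $u(x)=\langle\!\langle q,\mathbf 1_\Gamma\rangle\!\rangle_{-\frac32,\frac32}G(x)+o(1)$ as $|x|\to\infty$; and $v=\mathscr D^\dagger_\Gamma p$ is the unique distribution such that $\langle v,-\Delta\theta\rangle=\langle\!\langle p,\gamma_n\theta\rangle\!\rangle_{-\frac12,\frac12}$ for all $\theta\in\mathscr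 D(\mathbb R^2)$ and $v(x)=o(1)$ as $|x|\to\infty$. *)

theory Defs
  imports "HOL-Analysis.Analysis" "HOL-Probability.Probability_Measure"
begin

text \<open>
  The Euclidean plane is the type \<open>complex\<close>, used only as a real inner product space with
  orthonormal basis \<open>Basis = {1, \<i>}\<close>.  Functions are real-valued.  Elements of \<open>L\<^sup>2\<close> spaces are
  represented by Borel functions, equality being equality almost everywhere.
\<close>

section \<open>Derivatives, smooth functions, harmonic functions\<close>

definition pderiv_dir :: "complex \<Rightarrow> (complex \<Rightarrow> real) \<Rightarrow> complex \<Rightarrow> real" where
  "pderiv_dir v f x = frechet_derivative f (at x) v"

definition laplacian :: "(complex \<Rightarrow> real) \<Rightarrow> complex \<Rightarrow> real" where
  "laplacian f x = (\<Sum>b\<in>Basis. pderiv_dir b (pderiv_dir b f) x)"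

definition smooth :: "(complex \<Rightarrow> real) \<Rightarrow> bool" where
  "smooth f \<longleftrightarrow> (\<forall>bs x. set bs \<subseteq> Basis \<longrightarrow> fold pderiv_dir bs f differentiable at x)"

definition test_function :: "(complex \<Rightarrow> real) \<Rightarrow> bool" where
  "test_function \<theta> \<longleftrightarrow> smooth \<theta> \<and> compact (closure {x. \<theta> x \<noteq> 0})"

definition harmonic_on :: "complex set \<Rightarrow> (complex \<Rightarrow> real) \<Rightarrow> bool" where
  "harmonic_on S u \<longleftrightarrow> open S \<and>
     (\<forall>x\<in>S. u differentiable at x) \<and>
     (\<forall>b\<in>Basis. \<forall>x\<in>S. pderiv_dir b u differentiable at x) \<and>
     (\<forall>b\<in>Basis. \<forall>c\<in>Basis. continuous_on S (pderiv_dir c (pderiv_dir b u))) \<and>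
     (\<forall>x\<in>S. laplacian u x = 0)"


section \<open>Square integrable functions and weak derivatives\<close>

definition L2 :: "complex measure \<Rightarrow> (complex \<Rightarrow> real) set" where
  "L2 M = {f. f \<in> borel_measurable M \<and> integrable M (\<lambda>x. (f x)\<^sup>2)}"

text \<open>Convergence is stated with the nonnegative integral, since the Bochner integral of a
  non-integrable function is \<open>0\<close>.\<close>

definition L2_tendsto ::
    "complex measure \<Rightarrow> (nat \<Rightarrow> complex \<Rightarrow> real) \<Rightarrow> (complex \<Rightarrow> real) \<Rightarrow> bool" where
  "L2_tendsto M fs f \<longleftrightarrow>
     (\<lambda>k. \<integral>\<^sup>+ x. ennreal ((fs k x - f x)\<^sup>2) \<partial>M) \<longlonglongrightarrow> 0"

definition L2loc :: "(complex \<Rightarrow> real) set" where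
  "L2loc = {f. \<forall>R. f \<in> L2 (restrict_space lborel (cball 0 R))}"

definition L2loc_tendsto :: "(nat \<Rightarrow> complex \<Rightarrow> real) \<Rightarrow> (complex \<Rightarrow> real) \<Rightarrow> bool" where
  "L2loc_tendsto fs f \<longleftrightarrow> (\<forall>R. L2_tendsto (restrict_space lborel (cball 0 R)) fs f)"

definition L1loc :: "(complex \<Rightarrow> real) set" where
  "L1loc = {f. \<forall>R. integrable (restrict_space lborel (cball 0 R)) f}"

definition weak_pderiv :: "complex \<Rightarrow> (complex \<Rightarrow> real) \<Rightarrow> (complex \<Rightarrow> real) \<Rightarrow> bool" where
  "weak_pderiv b u d \<longleftrightarrow> u \<in> L1loc \<and> d \<in> L1loc \<and>
     (\<forall>\<theta>. test_function \<theta> \<longrightarrow>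
        (LINT x|lborel. u x * pderiv_dir b \<theta> x) = - (LINT x|lborel. d x * \<theta> x))"


section \<open>The spaces \<open>H\<^sup>2\<^sub>l\<^sub>o\<^sub>c\<close> and \<open>W\<^sup>2\<close>\<close>

text \<open>A function is carried together with its weak derivatives, which are unique almost everywhere:
  \<open>D b\<close> is the derivative of \<open>u\<close> in the direction \<open>b\<close>, and \<open>H b c\<close> that of \<open>D b\<close> in the
  direction \<open>c\<close>.\<close>

definition weak_jet2 ::
    "(complex \<Rightarrow> real) \<Rightarrow> (complex \<Rightarrow> complex \<Rightarrow> real) \<Rightarrow> (complex \<Rightarrow> complex \<Rightarrow> complex \<Rightarrow> real) \<Rightarrow> bool"
  where
  "weak_jet2 u D H \<longleftrightarrow>
     (\<forall>b\<in>Basis. weak_pderiv b u (D b)) \<and>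
     (\<forall>b\<in>Basis. \<forall>c\<in>Basis. weak_pderiv c (D b) (H b c))"

definition H2loc_jet ::
    "(complex \<Rightarrow> real) \<Rightarrow> (complex \<Rightarrow> complex \<Rightarrow> real) \<Rightarrow> (complex \<Rightarrow> complex \<Rightarrow> complex \<Rightarrow> real) \<Rightarrow> bool"
  where
  "H2loc_jet u D H \<longleftrightarrow> weak_jet2 u D H \<and> u \<in> L2loc \<and>
     (\<forall>b\<in>Basis. D b \<in> L2loc) \<and> (\<forall>b\<in>Basis. \<forall>c\<in>Basis. H b c \<in> L2loc)"

definition rho :: "complex \<Rightarrow> real" where
  "rho x = sqrt (1 + (norm x)\<^sup>2)"

definition lg :: "complex \<Rightarrow> real" where
  "lg x = ln (2 + (norm x)\<^sup>2)"

definition W2_jet ::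
    "(complex \<Rightarrow> real) \<Rightarrow> (complex \<Rightarrow> complex \<Rightarrow> real) \<Rightarrow> (complex \<Rightarrow> complex \<Rightarrow> complex \<Rightarrow> real) \<Rightarrow> bool"
  where
  "W2_jet u D H \<longleftrightarrow> weak_jet2 u D H \<and>
     (\<lambda>x. u x / ((rho x)\<^sup>2 * lg x)) \<in> L2 lborel \<and>
     (\<forall>b\<in>Basis. (\<lambda>x. D b x / (rho x * lg x)) \<in> L2 lborel) \<and>
     (\<forall>b\<in>Basis. \<forall>c\<in>Basis. H b c \<in> L2 lborel)"

definition W2_norm ::
    "(complex \<Rightarrow> real) \<Rightarrow> (complex \<Rightarrow> complex \<Rightarrow> real) \<Rightarrow> (complex \<Rightarrow> complex \<Rightarrow> complex \<Rightarrow> real) \<Rightarrow> real"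
  where
  "W2_norm u D H = sqrt (
     (LINT x|lborel. (u x / ((rho x)\<^sup>2 * lg x))\<^sup>2) +
     (\<Sum>b\<in>Basis. LINT x|lborel. (D b x / (rho x * lg x))\<^sup>2) +
     (\<Sum>b\<in>Basis. \<Sum>c\<in>Basis. LINT x|lborel. (H b c x)\<^sup>2))"

definition H2loc_approx ::
    "(nat \<Rightarrow> complex \<Rightarrow> real) \<Rightarrow>
     (complex \<Rightarrow> real) \<Rightarrow> (complex \<Rightarrow> complex \<Rightarrow> real) \<Rightarrow> (complex \<Rightarrow> complex \<Rightarrow> complex \<Rightarrow> real) \<Rightarrow> bool"
  where
  "H2loc_approx \<phi> u D H \<longleftrightarrow> (\<forall>k. smooth (\<phi> k)) \<and>
     L2loc_tendsto \<phi> u \<and>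
     (\<forall>b\<in>Basis. L2loc_tendsto (\<lambda>k. pderiv_dir b (\<phi> k)) (D b)) \<and>
     (\<forall>b\<in>Basis. \<forall>c\<in>Basis. L2loc_tendsto (\<lambda>k. pderiv_dir c (pderiv_dir b (\<phi> k))) (H b c))"


section \<open>Polygons\<close>

fun polygonal_path :: "complex list \<Rightarrow> real \<Rightarrow> complex" where
  "polygonal_path [] = linepath 0 0"
| "polygonal_path [a] = linepath a a"
| "polygonal_path [a, b] = linepath a b"
| "polygonal_path (a # b # c # xs) = linepath a b +++ polygonal_path (b # c # xs)"

definition polygon_loop :: "complex list \<Rightarrow> real \<Rightarrow> complex" where
  "polygon_loop vs = polygonal_path (vs @ [hd vs])"

definition simple_polygon :: "complex list \<Rightarrow> bool" where
  "simple_polygon vs \<longleftrightarrow> 3 \<le> length vs \<and> simple_path (polygon_loop vs)"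

text \<open>Below, \<open>g\<close> is the loop of a simple polygon and \<open>\<Gamma> = path_image g\<close>; the bounded domain
  enclosed by \<open>\<Gamma>\<close> is \<open>inside \<Gamma>\<close>.  As \<open>g\<close> is injective up to its endpoints, the following image
  measure is the arclength measure on \<open>\<Gamma>\<close>, extended by zero to the plane.\<close>

definition arclength :: "(real \<Rightarrow> complex) \<Rightarrow> complex measure" where
  "arclength g = distr
     (density (restrict_space lborel {0..1}) (\<lambda>t. ennreal (norm (vector_derivative g (at t)))))
     borel g"

text \<open>The unit normal directed towards the exterior, uniquely determined at every point that is not a
  corner; its (unspecified) value at the finitely many corners is irrelevant.\<close>

definition is_outer_normal :: "complex set \<Rightarrow> complex \<Rightarrow> complex \<Rightarrow> bool" where
  "is_outer_normal \<Gamma> x \<nu> \<longleftrightarrow> norm \<nu> = 1 \<and>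
     (\<exists>\<epsilon>>0. (\<forall>y\<in>\<Gamma> \<inter> ball x \<epsilon>. (y - x) \<bullet> \<nu> = 0) \<and>
        (\<forall>t\<in>{0<..<\<epsilon>}. x + t *\<^sub>R \<nu> \<in> outside \<Gamma> \<and> x - t *\<^sub>R \<nu> \<in> inside \<Gamma>))"

definition outer_normal :: "complex set \<Rightarrow> complex \<Rightarrow> complex" where
  "outer_normal \<Gamma> x = (THE \<nu>. is_outer_normal \<Gamma> x \<nu>)"


section \<open>Logarithmic capacity\<close>

text \<open>The energy is \<open>\<integral>\<integral> ln (1 / \<bar>x - y\<bar>) d\<mu> d\<mu>\<close>.  The integrand is \<open>\<infinity>\<close> on the diagonal, which has
  to be spelled out because \<open>ln 0 = 0\<close>.  For compactly supported \<open>\<mu>\<close> the integral of the negative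
  part is finite.\<close>

definition log_energy :: "complex measure \<Rightarrow> ereal" where
  "log_energy \<mu> =
     enn2ereal (\<integral>\<^sup>+ x. \<integral>\<^sup>+ y. (if x = y then \<infinity> else ennreal (- ln (norm (x - y)))) \<partial>\<mu> \<partial>\<mu>) -
     enn2ereal (\<integral>\<^sup>+ x. \<integral>\<^sup>+ y. (if x = y then 0 else ennreal (ln (norm (x - y)))) \<partial>\<mu> \<partial>\<mu>)"

definition robin_constant :: "complex set \<Rightarrow> ereal" where
  "robin_constant E =
     (INF \<mu> \<in> {\<mu>. prob_space \<mu> \<and> sets \<mu> = sets borel \<and> emeasure \<mu> E = 1}. log_energy \<mu>)"

definition log_capacity :: "complex set \<Rightarrow> real" where
  "log_capacity E =
     (if robin_constant E = \<infinity> then 0 else exp (- real_of_ereal (robin_constant E)))"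


section \<open>Traces, trace spaces and their duals\<close>

text \<open>The traces of \<open>u \<in> H\<^sup>2\<^sub>l\<^sub>o\<^sub>c\<close> are the \<open>L\<^sup>2(\<Gamma>)\<close>-limits of the pointwise traces of smooth functions
  converging to \<open>u\<close>.\<close>

definition dirichlet_trace ::
    "(real \<Rightarrow> complex) \<Rightarrow> (complex \<Rightarrow> real) \<Rightarrow> (complex \<Rightarrow> real) \<Rightarrow> bool" where
  "dirichlet_trace g u f \<longleftrightarrow> f \<in> L2 (arclength g) \<and>
     (\<exists>D H \<phi>. H2loc_jet u D H \<and> H2loc_approx \<phi> u D H \<and> L2_tendsto (arclength g) \<phi> f)"

definition neumann_trace ::
    "(real \<Rightarrow> complex) \<Rightarrow> (complex \<Rightarrow> real) \<Rightarrow> (complex \<Rightarrow> real) \<Rightarrow> bool" where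
  "neumann_trace g u f \<longleftrightarrow> f \<in> L2 (arclength g) \<and>
     (\<exists>D H \<phi>. H2loc_jet u D H \<and> H2loc_approx \<phi> u D H \<and>
        L2_tendsto (arclength g)
          (\<lambda>k x. pderiv_dir (outer_normal (path_image g) x) (\<phi> k) x) f)"

definition trace_space ::
    "((complex \<Rightarrow> real) \<Rightarrow> (complex \<Rightarrow> real) \<Rightarrow> bool) \<Rightarrow> (complex \<Rightarrow> real) set" where
  "trace_space T = {f. \<exists>u D H. W2_jet u D H \<and> T u f}"

definition trace_norm ::
    "((complex \<Rightarrow> real) \<Rightarrow> (complex \<Rightarrow> real) \<Rightarrow> bool) \<Rightarrow> (complex \<Rightarrow> real) \<Rightarrow> real" where
  "trace_norm T f = Inf {W2_norm u D H | u D H. W2_jet u D H \<and> T u f}"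

definition linear_functional_on ::
    "(complex \<Rightarrow> real) set \<Rightarrow> ((complex \<Rightarrow> real) \<Rightarrow> real) \<Rightarrow> bool" where
  "linear_functional_on V q \<longleftrightarrow>
     (\<forall>f\<in>V. \<forall>h\<in>V. q (\<lambda>x. f x + h x) = q f + q h) \<and>
     (\<forall>f\<in>V. \<forall>c. q (\<lambda>x. c * f x) = c * q f)"

definition dual_norm ::
    "((complex \<Rightarrow> real) \<Rightarrow> (complex \<Rightarrow> real) \<Rightarrow> bool) \<Rightarrow> ((complex \<Rightarrow> real) \<Rightarrow> real) \<Rightarrow> ennreal"
  where
  "dual_norm T q = (SUP f \<in> {f \<in> trace_space T. trace_norm T f \<le> 1}. ennreal \<bar>q f\<bar>)"

definition trace_dual ::
    "((complex \<Rightarrow> real) \<Rightarrow> (complex \<Rightarrow> real) \<Rightarrow> bool) \<Rightarrow> ((complex \<Rightarrow> real) \<Rightarrow> real) set" where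
  "trace_dual T = {q. linear_functional_on (trace_space T) q \<and> dual_norm T q < \<infinity>}"

text \<open>\<open>\<H>\<^sup>-\<^sup>3\<^sup>/\<^sup>2(\<Gamma>)\<close> and \<open>\<H>\<^sup>-\<^sup>1\<^sup>/\<^sup>2(\<Gamma>)\<close>; the duality pairings are the evaluations \<open>q f\<close>.\<close>

definition H_minus_3_2 :: "(real \<Rightarrow> complex) \<Rightarrow> ((complex \<Rightarrow> real) \<Rightarrow> real) set" where
  "H_minus_3_2 g = trace_dual (dirichlet_trace g)"

definition H_minus_1_2 :: "(real \<Rightarrow> complex) \<Rightarrow> ((complex \<Rightarrow> real) \<Rightarrow> real) set" where
  "H_minus_1_2 g = trace_dual (neumann_trace g)"

text \<open>The embedding of the pivot space \<open>L\<^sup>2(\<Gamma>)\<close> into the dual spaces.\<close>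

definition pivot :: "(real \<Rightarrow> complex) \<Rightarrow> (complex \<Rightarrow> real) \<Rightarrow> (complex \<Rightarrow> real) \<Rightarrow> real" where
  "pivot g q f = (LINT y|arclength g. q y * f y)"

definition dual_tendsto ::
    "((complex \<Rightarrow> real) \<Rightarrow> (complex \<Rightarrow> real) \<Rightarrow> bool) \<Rightarrow>
     (nat \<Rightarrow> (complex \<Rightarrow> real) \<Rightarrow> real) \<Rightarrow> ((complex \<Rightarrow> real) \<Rightarrow> real) \<Rightarrow> bool" where
  "dual_tendsto T qs q \<longleftrightarrow> (\<lambda>k. dual_norm T (\<lambda>f. qs k f - q f)) \<longlonglongrightarrow> 0"


section \<open>Layer potentials\<close>

definition G :: "complex \<Rightarrow> real" where
  "G x = - (1 / (2 * pi)) * ln (norm x)"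

definition single_layer :: "(real \<Rightarrow> complex) \<Rightarrow> (complex \<Rightarrow> real) \<Rightarrow> complex \<Rightarrow> real" where
  "single_layer g q x = (LINT y|arclength g. G (x - y) * q y)"

definition double_layer :: "(real \<Rightarrow> complex) \<Rightarrow> (complex \<Rightarrow> real) \<Rightarrow> complex \<Rightarrow> real" where
  "double_layer g p x =
     (LINT y|arclength g. pderiv_dir (outer_normal (path_image g) y) (\<lambda>z. G (x - z)) y * p y)"

text \<open>The classical space \<open>H\<^sup>1\<^sup>/\<^sup>2(\<Gamma>)\<close>, with the Sobolev-Slobodeckij seminorm.\<close>

definition H_1_2 :: "(real \<Rightarrow> complex) \<Rightarrow> (complex \<Rightarrow> real) set" where
  "H_1_2 g = {p \<in> L2 (arclength g).
     (\<integral>\<^sup>+ x. \<integral>\<^sup>+ y. ennreal ((p x - p y)\<^sup>2 / (norm (x - y))\<^sup>2) \<partial>arclength g \<partial>arclength g) < \<infinity>}"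

text \<open>\<open>single_layer_ext g q u\<close> and \<open>double_layer_ext g p u\<close> say that \<open>u\<close> represents the extended
  single layer potential of \<open>q\<close>, resp. the extended double layer potential of \<open>p\<close>.  These are the
  graphs of the continuous extensions by density, with values in \<open>L\<^sup>2\<^sub>l\<^sub>o\<^sub>c\<close>, of the classical
  potentials on \<open>L\<^sup>2(\<Gamma>)\<close> (dense in \<open>H\<^sup>-\<^sup>1\<^sup>/\<^sup>2(\<Gamma>)\<close>, where the classical single layer potential is itself
  defined by density) and on \<open>H\<^sup>1\<^sup>/\<^sup>2(\<Gamma>)\<close>.\<close>

definition single_layer_ext ::
    "(real \<Rightarrow> complex) \<Rightarrow> ((complex \<Rightarrow> real) \<Rightarrow> real) \<Rightarrow> (complex \<Rightarrow> real) \<Rightarrow> bool" where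
  "single_layer_ext g q u \<longleftrightarrow> u \<in> L2loc \<and>
     (\<exists>qs. (\<forall>k. qs k \<in> L2 (arclength g)) \<and>
        dual_tendsto (dirichlet_trace g) (\<lambda>k. pivot g (qs k)) q \<and>
        L2loc_tendsto (\<lambda>k. single_layer g (qs k)) u)"

definition double_layer_ext ::
    "(real \<Rightarrow> complex) \<Rightarrow> ((complex \<Rightarrow> real) \<Rightarrow> real) \<Rightarrow> (complex \<Rightarrow> real) \<Rightarrow> bool" where
  "double_layer_ext g p u \<longleftrightarrow> u \<in> L2loc \<and>
     (\<exists>ps. (\<forall>k. ps k \<in> H_1_2 g) \<and>
        dual_tendsto (neumann_trace g) (\<lambda>k. pivot g (ps k)) p \<and>
        L2loc_tendsto (\<lambda>k. double_layer g (ps k)) u)"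

end

theory Submission
  imports Defs "HOL-Complex_Analysis.Complex_Analysis"
begin

text \<open>A sum of extended layer potentials satisfies an a priori bound that square integrable functions,
  harmonic off the polygon, can violate at a corner.

  If \<open>u\<close> is the single layer potential of \<open>q\<close> plus the double layer potential of \<open>p\<close>, then for a
  test function \<open>\<theta>\<close> the integral \<open>\<integral> u \<Delta>\<theta>\<close> is, up to a constant factor, the sum of the pairings of
  \<open>q\<close> with the Dirichlet trace and of \<open>p\<close> with the Neumann trace of \<open>\<theta>\<close>. The two traces enter
  separately: if the Dirichlet trace vanishes, then \<open>\<integral> u \<Delta>\<theta>\<close> is bounded by a constant times the
  norm in \<open>W\<^sup>2\<close> of any function \<open>\<psi>\<close> with the same Neumann trace as \<open>\<theta>\<close>. This is
  \<open>representable_pairing_bounded\<close>.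

  At a corner \<open>v\<close>, the two traces of a single function in \<open>W\<^sup>2\<close> are linked, because together they
  determine the gradient on both edges. Let \<open>\<theta>\<close> have Dirichlet trace zero, Neumann trace zero on
  the first edge, and as Neumann trace on the second edge a cutoff of the annulus of radii \<open>\<epsilon>\<close> and
  \<open>\<delta>\<close> around the corner. Its Neumann trace alone is shared by a function \<open>\<psi>\<close> that is linear in
  \<open>x - v\<close>, with gradient along the first edge, times a radial cutoff (\<open>normal_traces_agree\<close>). Second
  derivatives of functions of degree one are scale invariant in \<open>L\<^sup>2\<close> of the plane, so the norm of
  \<open>\<psi>\<close> is bounded independently of \<open>\<epsilon>\<close> (\<open>W2_norm_rescaled_difference\<close>).

  Now let \<open>u\<close> be the real part of \<open>1 / (z Ln (z / R))\<close> inside the polygon and zero outside, where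
  \<open>z\<close> is the coordinate with origin at the corner and the second edge as positive real axis. It is
  harmonic off the polygon, and square integrable because \<open>1 / (r ln r)\<^sup>2\<close> is integrable near the
  origin of the plane (\<open>singular_fun_L2\<close>). By Green's formula in a half-plane
  (\<open>half_plane_green\<close>), \<open>\<integral> u \<Delta>\<theta>\<close> is up to sign the integral of \<open>1 / (t ln (R / t))\<close> over \<open>\<epsilon> \<le> t \<le>
  \<delta>\<close>, which grows like \<open>ln ln (1 / \<epsilon>)\<close> (\<open>pairing\<close>). So \<open>u\<close> violates the bound.

  The corner is chosen as a point of the polygon of maximal norm (\<open>convex_corner\<close>). There the two
  edges are not collinear, and the inside lies in a half-plane, so the principal branch of the
  logarithm can be used. The identity for \<open>\<integral> u \<Delta>\<theta>\<close> follows from the fundamental solution of the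
  Laplacian (\<open>fundamental_solution\<close>, \<open>fundamental_solution_dipole\<close>) and Fubini's theorem; the
  latter requires that the outer normal is a Borel map, which holds because it is locally constant
  along the edges.\<close>


section \<open>Smooth expressions and cutoff functions\<close>

lemma pderiv_dir_eqI: "(f has_derivative f') (at x) \<Longrightarrow> pderiv_dir v f x = f' v"
  by (metis pderiv_dir_def frechet_derivative_at)

lemma pderiv_dir_has_derivative:
  "f differentiable at x \<Longrightarrow> (f has_derivative (\<lambda>v. pderiv_dir v f x)) (at x)"
  unfolding pderiv_dir_def by (simp add: frechet_derivative_works[symmetric])

lemma pderiv_dir_decompose:
  assumes "f differentiable at x"
  shows "pderiv_dir v f x = Re v * pderiv_dir 1 f x + Im v * pderiv_dir \<i> f x"
proof -
  interpret linear "\<lambda>v. pderiv_dir v f x"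
    using pderiv_dir_has_derivative[OF assms] has_derivative_linear by blast
  have "v = Re v *\<^sub>R 1 + Im v *\<^sub>R \<i>" by (simp add: complex_eq_iff)
  then show ?thesis by (metis add scaleR real_scaleR_def)
qed

lemma pderiv_dir_const [simp]: "pderiv_dir v (\<lambda>x. c) = (\<lambda>x. 0)"
  by (rule ext, rule pderiv_dir_eqI) (rule has_derivative_const)

lemma pderiv_dir_add:
  assumes "f differentiable at x" "g differentiable at x"
  shows "pderiv_dir v (\<lambda>x. f x + g x) x = pderiv_dir v f x + pderiv_dir v g x"
  by (rule pderiv_dir_eqI)
     (intro has_derivative_add pderiv_dir_has_derivative assms)

lemma pderiv_dir_mult:
  assumes "f differentiable at x" "g differentiable at x"
  shows "pderiv_dir v (\<lambda>x. f x * g x) x = f x * pderiv_dir v g x + pderiv_dir v f x * g x"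
  by (rule pderiv_dir_eqI)
     (intro has_derivative_mult pderiv_dir_has_derivative assms)

lemma pderiv_dir_chain:
  assumes "f differentiable at x" "(h has_real_derivative d) (at (f x))"
  shows "pderiv_dir v (\<lambda>x. h (f x)) x = d * pderiv_dir v f x"
proof (rule pderiv_dir_eqI)
  have "(h has_derivative (*) d) (at (f x))"
    using assms(2) by (simp add: has_field_derivative_def)
  from has_derivative_compose[OF pderiv_dir_has_derivative[OF assms(1)] this]
  show "((\<lambda>x. h (f x)) has_derivative (\<lambda>v. d * pderiv_dir v f x)) (at x)" .
qed

lemma differentiable_chain_real:
  fixes f :: "complex \<Rightarrow> real"
  assumes "f differentiable at x" "(h has_real_derivative d) (at (f x))"
  shows "(\<lambda>x. h (f x)) differentiable at x"
proof -
  have "(h has_derivative (*) d) (at (f x))"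
    using assms(2) by (simp add: has_field_derivative_def)
  from has_derivative_compose[OF pderiv_dir_has_derivative[OF assms(1)] this]
  show ?thesis by (auto simp: differentiable_def)
qed

text \<open>The function \<open>exp (- 1 / t)\<close>, extended by zero, multiplied by a polynomial in \<open>1 / t\<close>: the
  polynomial factor makes the family closed under differentiation.\<close>

definition flat :: "real poly \<Rightarrow> real \<Rightarrow> real" where
  "flat P t = (if t > 0 then poly P (1 / t) * exp (- (1 / t)) else 0)"

lemma poly_exp_tendsto_0: "((\<lambda>x::real. poly P x * exp (- x)) \<longlongrightarrow> 0) at_top"
proof -
  have 1: "((\<lambda>x. coeff P i * (x ^ i / exp x)) \<longlongrightarrow> coeff P i * 0) at_top" for i
    by (intro tendsto_intros tendsto_power_div_exp_0)
  have "((\<lambda>x. \<Sum>i\<le>degree P. coeff P i * (x ^ i / exp x)) \<longlongrightarrow> (\<Sum>i\<le>degree P. coeff P i * 0)) at_top"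
    by (intro tendsto_sum 1)
  then show ?thesis
    by (simp add: poly_altdef sum_distrib_right exp_minus divide_inverse mult.assoc)
qed

lemma flat_has_derivative:
  "(flat P has_real_derivative flat ([:0, 0, 1:] * (P - pderiv P)) t) (at t)"
proof -
  consider "t > 0" | "t < 0" | "t = 0" by linarith
  then show ?thesis
  proof cases
    case 1
    have "((\<lambda>t. poly P (1 / t) * exp (- (1 / t))) has_real_derivative
        flat ([:0, 0, 1:] * (P - pderiv P)) t) (at t)"
      using 1 by (auto intro!: derivative_eq_intros DERIV_chain2[OF poly_DERIV]
          simp: flat_def algebra_simps power2_eq_square)
    moreover have "eventually (\<lambda>s. flat P s = poly P (1 / s) * exp (- (1 / s))) (nhds t)"
      using eventually_nhds_in_open[of "{0<..}" t] 1 by (auto simp: flat_def elim: eventually_mono)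
    ultimately show ?thesis by (subst DERIV_cong_ev[OF refl _ refl])
  next
    case 2
    have "eventually (\<lambda>s. flat P s = 0) (nhds t)"
      using eventually_nhds_in_open[of "{..<0}" t] 2 by (auto simp: flat_def elim: eventually_mono)
    moreover have "((\<lambda>s. 0) has_real_derivative flat ([:0, 0, 1:] * (P - pderiv P)) t) (at t)"
      using 2 by (simp add: flat_def)
    ultimately show ?thesis by (subst DERIV_cong_ev[OF refl _ refl])
  next
    case 3
    have "((\<lambda>h. flat P h / h) \<longlongrightarrow> 0) (at_right 0)"
    proof -
      have "((\<lambda>h. poly (pCons 0 P) (1 / h) * exp (- (1 / h))) \<longlongrightarrow> 0) (at_right (0::real))"
        using filterlim_compose[OF poly_exp_tendsto_0[of "pCons 0 P"] filterlim_inverse_at_top_right]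
        by (simp add: divide_inverse)
      then show ?thesis
        by (rule Lim_transform_eventually)
          (auto simp: eventually_at_right_field flat_def intro!: exI[of _ 1])
    qed
    moreover have "((\<lambda>h. flat P h / h) \<longlongrightarrow> 0) (at_left 0)"
      by (rule tendsto_eventually) (auto simp: eventually_at_left_field flat_def intro!: exI[of _ "-1"])
    ultimately have "((\<lambda>h. flat P h / h) \<longlongrightarrow> 0) (at 0)"
      by (simp add: filterlim_split_at)
    then show ?thesis using 3 by (simp add: DERIV_def flat_def)
  qed
qed

text \<open>The predicate \<open>smooth\<close> quantifies over all iterated derivatives. It is verified here by
  exhibiting a class of functions that are differentiable and whose derivatives belong to the
  class again. The class contains every test function and every regularized kernel used below.\<close>

inductive smooth_expr :: "(complex \<Rightarrow> real) \<Rightarrow> bool" where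
  const: "smooth_expr (\<lambda>z. c)"
| re: "smooth_expr Re"
| im: "smooth_expr Im"
| add: "smooth_expr f \<Longrightarrow> smooth_expr g \<Longrightarrow> smooth_expr (\<lambda>z. f z + g z)"
| mult: "smooth_expr f \<Longrightarrow> smooth_expr g \<Longrightarrow> smooth_expr (\<lambda>z. f z * g z)"
| flat: "smooth_expr f \<Longrightarrow> smooth_expr (\<lambda>z. flat P (f z))"
| inverse: "smooth_expr f \<Longrightarrow> (\<And>z. f z \<noteq> 0) \<Longrightarrow> smooth_expr (\<lambda>z. inverse (f z))"
| ln: "smooth_expr f \<Longrightarrow> (\<And>z. f z > 0) \<Longrightarrow> smooth_expr (\<lambda>z. ln (f z))"

lemma smooth_expr_minus: "smooth_expr f \<Longrightarrow> smooth_expr (\<lambda>z. - f z)"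
  using smooth_expr.mult[OF smooth_expr.const[of "-1"], of f] by simp

lemma smooth_expr_diff: "smooth_expr f \<Longrightarrow> smooth_expr g \<Longrightarrow> smooth_expr (\<lambda>z. f z - g z)"
  using smooth_expr.add[OF _ smooth_expr_minus, of f g] by simp

lemma smooth_expr_divide:
  "smooth_expr f \<Longrightarrow> smooth_expr g \<Longrightarrow> (\<And>z. g z \<noteq> 0) \<Longrightarrow> smooth_expr (\<lambda>z. f z / g z)"
  using smooth_expr.mult[OF _ smooth_expr.inverse, of f g] by (simp add: divide_inverse)

lemma smooth_expr_norm2: "smooth_expr (\<lambda>z. (norm z)\<^sup>2)"
proof -
  have "(\<lambda>z. (norm z)\<^sup>2) = (\<lambda>z. Re z * Re z + Im z * Im z)"
    by (rule ext) (simp only: cmod_power2, simp add: power2_eq_square)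
  then show ?thesis by (simp only:) (intro smooth_expr.intros)
qed

lemma smooth_expr_pderiv:
  assumes "smooth_expr f"
  shows "(\<forall>x. f differentiable at x) \<and> (\<forall>b. smooth_expr (pderiv_dir b f))"
  using assms
proof (induction rule: smooth_expr.induct)
  case (const c)
  then show ?case by (auto intro: smooth_expr.const)
next
  case re
  have "(Re has_derivative Re) (at x)" for x
    by (rule bounded_linear.has_derivative[OF bounded_linear_Re has_derivative_ident])
  then have "pderiv_dir b Re = (\<lambda>x. Re b)" for b by (auto intro!: pderiv_dir_eqI)
  then show ?case using \<open>\<And>x. (Re has_derivative Re) (at x)\<close>
    by (auto intro: smooth_expr.const simp: differentiable_def)
next
  case im
  have "(Im has_derivative Im) (at x)" for x
    by (rule bounded_linear.has_derivative[OF bounded_linear_Im has_derivative_ident])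
  then have "pderiv_dir b Im = (\<lambda>x. Im b)" for b by (auto intro!: pderiv_dir_eqI)
  then show ?case using \<open>\<And>x. (Im has_derivative Im) (at x)\<close>
    by (auto intro: smooth_expr.const simp: differentiable_def)
next
  case (add f g)
  then have "pderiv_dir b (\<lambda>z. f z + g z) = (\<lambda>x. pderiv_dir b f x + pderiv_dir b g x)" for b
    by (auto intro!: pderiv_dir_add)
  then show ?case using add by (auto intro!: smooth_expr.add)
next
  case (mult f g)
  then have "pderiv_dir b (\<lambda>z. f z * g z)
      = (\<lambda>x. f x * pderiv_dir b g x + pderiv_dir b f x * g x)" for b
    by (auto intro!: pderiv_dir_mult)
  then show ?case using mult by (auto intro!: smooth_expr.add smooth_expr.mult)
next
  case (flat f P)
  then have "pderiv_dir b (\<lambda>z. flat P (f z))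
      = (\<lambda>x. flat ([:0, 0, 1:] * (P - pderiv P)) (f x) * pderiv_dir b f x)" for b
    by (intro ext pderiv_dir_chain flat_has_derivative) auto
  then show ?case using flat
    by (auto intro!: smooth_expr.mult smooth_expr.flat differentiable_chain_real[OF _ flat_has_derivative] simp del: mult_pCons_left)
next
  case (inverse f)
  have D: "(inverse has_real_derivative - (inverse (f x) * inverse (f x))) (at (f x))" for x
    using DERIV_inverse'[OF DERIV_ident, of "f x" UNIV] inverse by simp
  with inverse have "pderiv_dir b (\<lambda>z. inverse (f z))
      = (\<lambda>x. - (inverse (f x) * inverse (f x)) * pderiv_dir b f x)" for b
    by (intro ext pderiv_dir_chain) auto
  then show ?case using inverse
    by (auto intro!: smooth_expr.mult smooth_expr_minus smooth_expr.inverse differentiable_chain_real[OF _ D])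
next
  case (ln f)
  have D: "(ln has_real_derivative inverse (f x)) (at (f x))" for x
    using DERIV_ln[of "f x"] ln by simp
  with ln have "pderiv_dir b (\<lambda>z. ln (f z)) = (\<lambda>x. inverse (f x) * pderiv_dir b f x)" for b
    by (intro ext pderiv_dir_chain) auto
  moreover have "f z \<noteq> 0" for z using ln(2)[of z] by simp
  ultimately show ?case using ln
    by (auto intro!: smooth_expr.mult smooth_expr.inverse differentiable_chain_real[OF _ D])
qed

lemma smooth_expr_differentiable: "smooth_expr f \<Longrightarrow> f differentiable at x"
  using smooth_expr_pderiv by blast

lemma smooth_expr_pderiv_dir: "smooth_expr f \<Longrightarrow> smooth_expr (pderiv_dir b f)"
  using smooth_expr_pderiv by blast

lemma smooth_expr_smooth:
  assumes "smooth_expr f" shows "smooth f"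
proof -
  have "smooth_expr (fold pderiv_dir bs f)" for bs
    using assms by (induction bs arbitrary: f) (auto intro: smooth_expr_pderiv_dir)
  then show ?thesis by (auto simp: smooth_def intro: smooth_expr_differentiable)
qed

lemma smooth_expr_continuous: "smooth_expr f \<Longrightarrow> continuous_on A f"
  by (meson continuous_at_imp_continuous_on differentiable_imp_continuous_within smooth_expr_differentiable)

lemma smooth_expr_affine:
  assumes "smooth_expr f" shows "smooth_expr (\<lambda>x. f (a * (x - v)))"
  using assms
proof (induction rule: smooth_expr.induct)
  case re
  have "smooth_expr (\<lambda>x. Re a * (Re x - Re v) - Im a * (Im x - Im v))"
    by (intro smooth_expr_diff smooth_expr.intros)
  then show ?case by (simp add: algebra_simps)
next
  case im
  have "smooth_expr (\<lambda>x. Re a * (Im x - Im v) + Im a * (Re x - Re v))"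
    by (intro smooth_expr_diff smooth_expr.intros)
  then show ?case by (simp add: algebra_simps)
qed (auto intro: smooth_expr.intros)

lemma pderiv_dir_affine:
  assumes "f differentiable at (a * (x - v))"
  shows "pderiv_dir b (\<lambda>x. f (a * (x - v))) x = pderiv_dir (a * b) f (a * (x - v))"
proof (rule pderiv_dir_eqI)
  have "((\<lambda>x. a * (x - v)) has_derivative (\<lambda>h. a * h)) (at x)"
    by (auto intro!: derivative_eq_intros)
  from has_derivative_compose[OF this pderiv_dir_has_derivative[OF assms]]
  show "((\<lambda>x. f (a * (x - v))) has_derivative (\<lambda>b. pderiv_dir (a * b) f (a * (x - v)))) (at x)" .
qed

text \<open>Equal to one for \<open>t \<le> 1 / 4\<close> and to zero for \<open>t \<ge> 1\<close>. It is applied to squared norms, so that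
  the radial cutoff is smooth at the centre as well; hence the radii there are \<open>1 / 2\<close> and \<open>1\<close>.\<close>

definition cutoff :: "real \<Rightarrow> real" where
  "cutoff t = flat 1 (1 - t) / (flat 1 (1 - t) + flat 1 (t - 1 / 4))"

lemma flat_1_nonneg: "flat 1 t \<ge> 0" and flat_1_pos: "t > 0 \<Longrightarrow> flat 1 t > 0"
  and flat_1_zero: "t \<le> 0 \<Longrightarrow> flat 1 t = 0"
  by (auto simp: flat_def)

lemma cutoff_denominator_pos: "flat 1 (1 - t) + flat 1 (t - 1 / 4) > 0"
proof (cases "t < 1")
  case True
  then show ?thesis using flat_1_pos[of "1 - t"] flat_1_nonneg[of "t - 1/4"] by linarith
next
  case False
  then show ?thesis using flat_1_pos[of "t - 1/4"] flat_1_nonneg[of "1 - t"] by linarith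
qed

lemma cutoff_bounds: "0 \<le> cutoff t" "cutoff t \<le> 1"
  using cutoff_denominator_pos[of t] flat_1_nonneg[of "1 - t"] flat_1_nonneg[of "t - 1/4"]
  by (auto simp: cutoff_def)

lemma cutoff_eq_1: "t \<le> 1 / 4 \<Longrightarrow> cutoff t = 1"
  using cutoff_denominator_pos[of t] flat_1_zero[of "t - 1/4"] by (simp add: cutoff_def)

lemma cutoff_eq_0: "t \<ge> 1 \<Longrightarrow> cutoff t = 0"
  by (simp add: cutoff_def flat_1_zero)

lemma smooth_expr_cutoff: "smooth_expr f \<Longrightarrow> smooth_expr (\<lambda>z. cutoff (f z))"
  unfolding cutoff_def
  by (intro smooth_expr_divide smooth_expr_diff smooth_expr.intros)
     (auto intro!: less_imp_neq[THEN not_sym] cutoff_denominator_pos)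


section \<open>Integration over the plane\<close>

lemma integrable_continuous_compact_support:
  fixes f :: "complex \<Rightarrow> real"
  assumes "continuous_on UNIV f" "\<And>x. R < norm x \<Longrightarrow> f x = 0"
  shows "integrable lborel f"
proof -
  have "integrable lborel (\<lambda>x. indicator (cball 0 R) x *\<^sub>R f x)"
    by (rule borel_integrable_compact[OF compact_cball continuous_on_subset[OF assms(1)]]) simp
  also have "(\<lambda>x. indicator (cball 0 R) x *\<^sub>R f x) = f"
    using assms(2) by (force simp: indicator_def)
  finally show ?thesis .
qed

lemma bounded_continuous_compact_support:
  fixes f :: "complex \<Rightarrow> real"
  assumes "continuous_on UNIV f" "\<And>x. R < norm x \<Longrightarrow> f x = 0"
  obtains C where "C > 0" "\<And>x. \<bar>f x\<bar> \<le> C"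
proof -
  have "bounded (f ` cball 0 R)"
    by (intro compact_imp_bounded compact_continuous_image compact_cball continuous_on_subset[OF assms(1)]) auto
  then obtain C where C: "C > 0" "\<And>x. x \<in> cball 0 R \<Longrightarrow> \<bar>f x\<bar> \<le> C"
    by (auto simp: bounded_pos)
  show ?thesis
  proof (rule that[OF C(1)])
    fix x show "\<bar>f x\<bar> \<le> C"
      using C assms(2)[of x] by (cases "norm x \<le> R") auto
  qed
qed

lemma pderiv_dir_eq_0_off_support:
  assumes "\<And>x. R < norm x \<Longrightarrow> f x = (0::real)" "R < norm x"
  shows "pderiv_dir b f x = 0"
proof -
  have "((\<lambda>x. 0) has_derivative (\<lambda>h. 0::real)) (at x)" by simp
  then have "(f has_derivative (\<lambda>h. 0)) (at x)"
    by (rule has_derivative_transform_within_open[of _ _ _ _ "- cball 0 R"])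
       (use assms in auto)
  then show ?thesis by (rule pderiv_dir_eqI)
qed

lemma lborel_integral_translate:
  fixes f :: "complex \<Rightarrow> real"
  assumes "f \<in> borel_measurable borel"
  shows "(\<integral>x. f (c + x) \<partial>lborel) = (\<integral>x. f x \<partial>lborel)"
  by (subst (2) lborel_distr_plus[symmetric, of c]) (simp add: integral_distr assms)

lemma pderiv_dir_line:
  assumes "F differentiable at (x + t *\<^sub>R b)"
  shows "((\<lambda>t. F (x + t *\<^sub>R b)) has_real_derivative pderiv_dir b F (x + t *\<^sub>R b)) (at t)"
proof -
  have "((\<lambda>t. x + t *\<^sub>R b) has_derivative (\<lambda>h. h *\<^sub>R b)) (at t)"
    by (auto intro!: derivative_eq_intros)
  from has_derivative_compose[OF this pderiv_dir_has_derivative[OF assms]]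
  have "((\<lambda>t. F (x + t *\<^sub>R b)) has_derivative (\<lambda>h. pderiv_dir (h *\<^sub>R b) F (x + t *\<^sub>R b))) (at t)" .
  moreover have "pderiv_dir (h *\<^sub>R b) F (x + t *\<^sub>R b) = pderiv_dir b F (x + t *\<^sub>R b) * h" for h
    using pderiv_dir_decompose[OF assms, of "h *\<^sub>R b"] pderiv_dir_decompose[OF assms, of b]
    by (simp add: algebra_simps)
  ultimately show ?thesis by (simp add: has_field_derivative_def mult_commute_abs)
qed

text \<open>By translation invariance the difference quotients of \<open>F\<close> in the direction \<open>b\<close> have integral
  zero, and they are dominated by the supremum of the derivative on a fixed ball. This gives the
  divergence theorem on the plane for every direction at once, without coordinates.\<close>

lemma integral_pderiv_dir_eq_0:
  fixes F :: "complex \<Rightarrow> real"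
  assumes diff: "\<And>x. F differentiable at x" and cont: "continuous_on UNIV (pderiv_dir b F)"
    and supp: "\<And>x. R < norm x \<Longrightarrow> F x = 0"
  shows "(\<integral>x. pderiv_dir b F x \<partial>lborel) = 0"
proof -
  have contF: "continuous_on UNIV F"
    by (simp add: diff continuous_at_imp_continuous_on differentiable_imp_continuous_within)
  have [measurable]: "F \<in> borel_measurable borel" "pderiv_dir b F \<in> borel_measurable borel"
    using contF cont by (auto intro: borel_measurable_continuous_onI)
  have supp': "R < norm x \<Longrightarrow> pderiv_dir b F x = 0" for x
    using pderiv_dir_eq_0_off_support[of R F x b] supp by auto
  obtain C where C: "C > 0" "\<And>x. \<bar>pderiv_dir b F x\<bar> \<le> C"
    using bounded_continuous_compact_support[OF cont supp'] by blast
  define h where "h n = 1 / real (Suc n)" for n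
  define D where "D n x = (F (x + h n *\<^sub>R b) - F x) / h n" for n x
  have h: "0 < h n" "h n \<le> 1" for n by (auto simp: h_def divide_simps)
  have "h \<longlonglongrightarrow> 0" unfolding h_def by (rule LIMSEQ_Suc[OF lim_1_over_n])
  then have h0: "filterlim h (at 0) sequentially"
    using h(1) by (simp add: filterlim_at eventually_sequentially) (metis less_irrefl)
  have "(\<lambda>n. \<integral>x. D n x \<partial>lborel) \<longlonglongrightarrow> (\<integral>x. pderiv_dir b F x \<partial>lborel)"
  proof (rule integral_dominated_convergence)
    show "integrable lborel (\<lambda>x. C * indicator (cball 0 (R + norm b)) x :: real)"
      by (intro integrable_mult_right integrable_real_indicator emeasure_bounded_finite) auto
    show "AE x in lborel. (\<lambda>n. D n x) \<longlonglongrightarrow> pderiv_dir b F x"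
    proof (rule AE_I2)
      fix x
      have "((\<lambda>t. F (x + t *\<^sub>R b)) has_real_derivative pderiv_dir b F x) (at 0)"
        using pderiv_dir_line[of F x 0 b] diff by simp
      then have "((\<lambda>t. (F (x + t *\<^sub>R b) - F x) / t) \<longlongrightarrow> pderiv_dir b F x) (at 0)"
        by (simp add: DERIV_def)
      from filterlim_compose[OF this h0] show "(\<lambda>n. D n x) \<longlonglongrightarrow> pderiv_dir b F x"
        by (simp add: D_def)
    qed
    fix n
    show "AE x in lborel. norm (D n x) \<le> C * indicator (cball 0 (R + norm b)) x"
    proof (rule AE_I2)
      fix x
      show "norm (D n x) \<le> C * indicator (cball 0 (R + norm b)) x"
      proof (cases "norm x \<le> R + norm b")
        case True
        have "\<exists>z>0. z < h n \<and> F (x + h n *\<^sub>R b) - F (x + 0 *\<^sub>R b)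
            = (h n - 0) * pderiv_dir b F (x + z *\<^sub>R b)"
          using MVT2[of 0 "h n" "\<lambda>t. F (x + t *\<^sub>R b)" "\<lambda>t. pderiv_dir b F (x + t *\<^sub>R b)"] h pderiv_dir_line[OF diff]
          by blast
        then obtain z where "D n x = pderiv_dir b F (x + z *\<^sub>R b)"
          using h(1)[of n] by (auto simp: D_def field_simps)
        then show ?thesis using C(2) True by (simp add: indicator_def)
      next
        case False
        have "norm (h n *\<^sub>R b) \<le> norm b"
          using h[of n] by (simp add: mult_left_le_one_le)
        moreover have "norm x \<le> norm (x + h n *\<^sub>R b) + norm (h n *\<^sub>R b)"
          using norm_triangle_ineq4[of "x + h n *\<^sub>R b" "h n *\<^sub>R b"] by simp
        ultimately have "R < norm (x + h n *\<^sub>R b)" "R < norm x" using False norm_ge_zero[of b] by linarith+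
        then show ?thesis using supp C(1) by (simp add: D_def)
      qed
    qed
  qed (auto simp: D_def)
  moreover have "(\<integral>x. D n x \<partial>lborel) = 0" for n
  proof -
    have iF: "integrable lborel F"
      by (rule integrable_continuous_compact_support[OF contF supp])
    have "integrable lborel (\<lambda>x::complex. F (x + h n *\<^sub>R b))"
    proof (rule integrable_continuous_compact_support[where R = "R + norm (h n *\<^sub>R b)"])
      fix x :: complex assume "R + norm (h n *\<^sub>R b) < norm x"
      moreover have "norm x \<le> norm (x + h n *\<^sub>R b) + norm (h n *\<^sub>R b)"
        using norm_triangle_ineq4[of "x + h n *\<^sub>R b" "h n *\<^sub>R b"] by simp
      ultimately show "F (x + h n *\<^sub>R b) = 0" by (intro supp) simp
    qed (intro continuous_on_compose2[OF contF] continuous_intros; simp)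
    then show ?thesis
      using iF lborel_integral_translate[of F "h n *\<^sub>R b"] by (simp add: D_def add.commute)
  qed
  ultimately show ?thesis by (simp add: LIMSEQ_const_iff)
qed

lemma integral_by_parts:
  fixes f g :: "complex \<Rightarrow> real"
  assumes f: "\<And>x. f differentiable at x" "continuous_on UNIV (pderiv_dir b f)"
    and g: "\<And>x. g differentiable at x" "continuous_on UNIV (pderiv_dir b g)"
    and supp: "\<And>x. R < norm x \<Longrightarrow> g x = 0"
  shows "(\<integral>x. f x * pderiv_dir b g x \<partial>lborel) = - (\<integral>x. pderiv_dir b f x * g x \<partial>lborel)"
proof -
  have c: "continuous_on UNIV f" "continuous_on UNIV g"
    using f g by (auto simp: continuous_at_imp_continuous_on differentiable_imp_continuous_within)
  have eq: "pderiv_dir b (\<lambda>x. f x * g x) = (\<lambda>x. f x * pderiv_dir b g x + pderiv_dir b f x * g x)"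
    by (intro ext pderiv_dir_mult f g)
  have supp': "R < norm x \<Longrightarrow> pderiv_dir b g x = 0" for x
    using pderiv_dir_eq_0_off_support[of R g x b] supp by auto
  have "(\<integral>x. pderiv_dir b (\<lambda>x. f x * g x) x \<partial>lborel) = 0"
    by (rule integral_pderiv_dir_eq_0[where R = R])
       (use f g c supp in \<open>auto simp: eq intro!: continuous_intros differentiable_mult\<close>)
  moreover have "integrable lborel (\<lambda>x. f x * pderiv_dir b g x)" "integrable lborel (\<lambda>x. pderiv_dir b f x * g x)"
    by (rule integrable_continuous_compact_support[where R = R];
        use f g c supp supp' in \<open>auto intro!: continuous_intros\<close>)+
  ultimately show ?thesis by (simp add: eq)
qed

lemma Complex_measurable [measurable]: "(\<lambda>p. Complex (fst p) (snd p)) \<in> borel_measurable borel"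
  unfolding Complex_eq by (intro borel_measurable_continuous_onI continuous_intros)

lemma Complex_measurable_pair [measurable]:
  "(\<lambda>(x, y). Complex x y) \<in> lborel \<Otimes>\<^sub>M lborel \<rightarrow>\<^sub>M borel"
  using Complex_measurable by (simp add: lborel_prod split_beta')

lemma lborel_complex_eq:
  "lborel = distr (lborel \<Otimes>\<^sub>M lborel) borel (\<lambda>(x, y). Complex x y)"
proof (rule lborel_eqI)
  fix l u :: complex assume le: "\<And>b. b \<in> Basis \<Longrightarrow> l \<bullet> b \<le> u \<bullet> b"
  have "(\<lambda>(x, y). Complex x y) -` box l u \<inter> space (lborel \<Otimes>\<^sub>M lborel)
      = {Re l<..<Re u} \<times> {Im l<..<Im u}"
    by (auto simp: box_def Basis_complex_def space_pair_measure)
  then show "emeasure (distr (lborel \<Otimes>\<^sub>M lborel) borel (\<lambda>(x, y). Complex x y)) (box l u)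
      = ennreal (\<Prod>b\<in>Basis. (u - l) \<bullet> b)"
    using le[of 1] le[of \<i>]
    by (simp add: emeasure_distr lborel.emeasure_pair_measure_Times Basis_complex_def
        ennreal_mult inner_diff_left)
qed simp

lemma nn_integral_complex:
  assumes [measurable]: "f \<in> borel_measurable borel"
  shows "(\<integral>\<^sup>+z. f z \<partial>lborel) = (\<integral>\<^sup>+y. \<integral>\<^sup>+x. f (Complex x y) \<partial>lborel \<partial>lborel)"
    and "(\<integral>\<^sup>+z. f z \<partial>lborel) = (\<integral>\<^sup>+x. \<integral>\<^sup>+y. f (Complex x y) \<partial>lborel \<partial>lborel)"
proof -
  have 1: "(\<integral>\<^sup>+z. f z \<partial>lborel) = (\<integral>\<^sup>+p. f (Complex (fst p) (snd p)) \<partial>(lborel \<Otimes>\<^sub>M lborel))"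
    by (subst lborel_complex_eq) (simp add: nn_integral_distr split_beta)
  then show "(\<integral>\<^sup>+z. f z \<partial>lborel) = (\<integral>\<^sup>+x. \<integral>\<^sup>+y. f (Complex x y) \<partial>lborel \<partial>lborel)"
    by (simp add: lborel.nn_integral_fst[symmetric] split_beta')
  show "(\<integral>\<^sup>+z. f z \<partial>lborel) = (\<integral>\<^sup>+y. \<integral>\<^sup>+x. f (Complex x y) \<partial>lborel \<partial>lborel)"
    unfolding 1 by (simp add: lborel_pair.nn_integral_snd[symmetric] split_beta')
qed

definition lborel_invariant :: "(complex \<Rightarrow> complex) \<Rightarrow> bool" where
  "lborel_invariant T \<longleftrightarrow> T \<in> borel_measurable borel \<and> distr lborel borel T = lborel"

lemma lborel_invariantI:
  assumes [measurable]: "T \<in> borel_measurable borel"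
    and "\<And>f :: complex \<Rightarrow> ennreal. f \<in> borel_measurable borel \<Longrightarrow>
       (\<integral>\<^sup>+z. f (T z) \<partial>lborel) = (\<integral>\<^sup>+z. f z \<partial>lborel)"
  shows "lborel_invariant T"
  unfolding lborel_invariant_def
proof (intro conjI measure_eqI)
  fix A assume "A \<in> sets (distr lborel borel T)"
  then have [measurable]: "A \<in> sets borel" by simp
  have "emeasure (distr lborel borel T) A = (\<integral>\<^sup>+z. indicator A (T z) \<partial>lborel)"
    by (subst nn_integral_indicator[symmetric]) (simp_all add: nn_integral_distr del: nn_integral_indicator)
  also have "\<dots> = emeasure lborel A" by (subst assms(2)) auto
  finally show "emeasure (distr lborel borel T) A = emeasure lborel A" .
qed auto

lemma lborel_invariant_compose:
  assumes "lborel_invariant S" "lborel_invariant T"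
  shows "lborel_invariant (\<lambda>z. S (T z))"
proof -
  have [measurable]: "S \<in> borel_measurable borel" "T \<in> borel_measurable borel"
    and eq: "distr lborel borel S = lborel" "distr lborel borel T = lborel"
    using assms by (auto simp: lborel_invariant_def)
  have "distr (distr lborel borel T) borel S = distr lborel borel (\<lambda>z. S (T z))"
    by (subst distr_distr) (auto simp: comp_def)
  then show ?thesis by (simp add: eq lborel_invariant_def)
qed

lemma lborel_invariant_shear:
  shows "lborel_invariant (\<lambda>z. Complex (Re z + s * Im z) (Im z))"
    and "lborel_invariant (\<lambda>z. Complex (Re z) (Im z + s * Re z))"
proof -
  have m: "(\<lambda>z. Complex (Re z + s * Im z) (Im z)) \<in> borel_measurable borel"
    "(\<lambda>z. Complex (Re z) (Im z + s * Re z)) \<in> borel_measurable borel"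
    unfolding Complex_eq by (intro borel_measurable_continuous_onI continuous_intros)+
  show "lborel_invariant (\<lambda>z. Complex (Re z + s * Im z) (Im z))"
  proof (rule lborel_invariantI[OF m(1)])
    fix f :: "complex \<Rightarrow> ennreal" assume [measurable]: "f \<in> borel_measurable borel"
    have "(\<integral>\<^sup>+x. f (Complex (x + s * y) y) \<partial>lborel) = (\<integral>\<^sup>+x. f (Complex x y) \<partial>lborel)" for y
    proof -
      have [measurable]: "(\<lambda>x. f (Complex x y)) \<in> borel_measurable borel"
        unfolding Complex_eq by measurable
      show ?thesis using nn_integral_real_affine[of "\<lambda>x. f (Complex x y)" 1 "s * y"] by (simp add: add.commute)
    qed
    then show "(\<integral>\<^sup>+z. f (Complex (Re z + s * Im z) (Im z)) \<partial>lborel) = (\<integral>\<^sup>+z. f z \<partial>lborel)"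
      using m(1) by (simp add: nn_integral_complex(1))
  qed
  show "lborel_invariant (\<lambda>z. Complex (Re z) (Im z + s * Re z))"
  proof (rule lborel_invariantI[OF m(2)])
    fix f :: "complex \<Rightarrow> ennreal" assume [measurable]: "f \<in> borel_measurable borel"
    have "(\<integral>\<^sup>+y. f (Complex x (y + s * x)) \<partial>lborel) = (\<integral>\<^sup>+y. f (Complex x y) \<partial>lborel)" for x
    proof -
      have [measurable]: "(\<lambda>y. f (Complex x y)) \<in> borel_measurable borel"
        unfolding Complex_eq by measurable
      show ?thesis using nn_integral_real_affine[of "\<lambda>y. f (Complex x y)" 1 "s * x"] by (simp add: add.commute)
    qed
    then show "(\<integral>\<^sup>+z. f (Complex (Re z) (Im z + s * Re z)) \<partial>lborel) = (\<integral>\<^sup>+z. f z \<partial>lborel)"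
      using m(2) by (simp add: nn_integral_complex(2))
  qed
qed

text \<open>Shears preserve Lebesgue measure by Fubini's theorem, and a rotation by an angle \<open>\<phi> \<noteq> \<pi>\<close> is a
  product of three shears, the outer ones with parameter \<open>- tan (\<phi> / 2)\<close>. The half-turn is the
  square of a quarter-turn.\<close>

lemma lborel_invariant_rotation:
  assumes "norm d = 1" shows "lborel_invariant (\<lambda>z. d * z)"
proof -
  have *: "lborel_invariant (\<lambda>z. d * z)" if d: "norm d = 1" "Re d \<noteq> -1" for d
  proof -
    \<comment> \<open>the tangent of half the angle of rotation\<close>
    define t where "t = Im d / (1 + Re d)"
    have n: "(Re d)\<^sup>2 + (Im d)\<^sup>2 = 1" using d(1) by (metis cmod_power2 one_power2)
    have 1: "1 + Re d \<noteq> 0" using d(2) by linarith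
    have 2: "t * Im d = 1 - Re d"
      using n 1 by (simp add: t_def divide_simps power2_eq_square algebra_simps)
    have 3: "t * (1 + Re d) = Im d" using 1 by (simp add: t_def)
    let ?X = "\<lambda>z. Complex (Re z + (- t) * Im z) (Im z)" and ?Y = "\<lambda>z. Complex (Re z) (Im z + Im d * Re z)"
    have "lborel_invariant (\<lambda>z. ?X (?Y (?X z)))"
      by (rule lborel_invariant_compose[OF lborel_invariant_shear(1)
            lborel_invariant_compose[OF lborel_invariant_shear(2) lborel_invariant_shear(1)]])
    also have "(\<lambda>z. ?X (?Y (?X z))) = (\<lambda>z. d * z)"
    proof
      fix z
      have "Im (?X (?Y (?X z))) = Im d * Re z + (1 - t * Im d) * Im z" by (simp add: algebra_simps)
      also have "\<dots> = Im (d * z)" by (simp add: 2)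
      finally have i: "Im (?X (?Y (?X z))) = Im (d * z)" .
      have "Re (?X (?Y (?X z))) = (1 - t * Im d) * Re z - (t * (1 + (1 - t * Im d))) * Im z"
        by (simp add: algebra_simps)
      also have "\<dots> = Re (d * z)" using 3 by (simp add: 2)
      finally show "?X (?Y (?X z)) = d * z" using i by (simp add: complex_eq_iff)
    qed
    finally show ?thesis .
  qed
  show ?thesis
  proof (cases "Re d = -1")
    case True
    have "(Re d)\<^sup>2 + (Im d)\<^sup>2 = 1" using assms by (metis cmod_power2 one_power2)
    then have "d = -1" using True by (simp add: complex_eq_iff)
    then have "(\<lambda>z. d * z) = (\<lambda>z. \<i> * (\<i> * z))" by (simp add: fun_eq_iff mult.assoc[symmetric])
    then show ?thesis using lborel_invariant_compose[OF *[of \<i>] *[of \<i>]] by simp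
  qed (use * assms in auto)
qed

lemma lborel_integral_isometry:
  fixes f :: "complex \<Rightarrow> real"
  assumes [measurable]: "f \<in> borel_measurable borel" and d: "norm d = 1"
  shows "(\<integral>z. f (v + d * z) \<partial>lborel) = (\<integral>x. f x \<partial>lborel)"
proof -
  have "distr lborel borel (\<lambda>z. d * z) = lborel"
    using lborel_invariant_rotation[OF d] by (simp add: lborel_invariant_def)
  then have "(\<integral>z. f (v + z) \<partial>lborel) = (\<integral>z. f (v + z) \<partial>distr lborel borel (\<lambda>z. d * z))" by simp
  also have "\<dots> = (\<integral>z. f (v + d * z) \<partial>lborel)" by (subst integral_distr) auto
  finally show ?thesis using lborel_integral_translate[of f v] by simp
qed

lemma emeasure_cball_complex: "r \<ge> 0 \<Longrightarrow> emeasure lborel (cball (c::complex) r) = ennreal (pi * r\<^sup>2)"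
  by (simp add: emeasure_cball unit_ball_vol_2 power2_eq_square)

text \<open>The annulus of radii \<open>R / 2 ^ Suc k\<close> and \<open>R / 2 ^ k\<close> has area of order \<open>4 ^ - k\<close>, so a radial
  majorant is integrable as soon as the series of its values weighted by these areas converges.
  Both critical singularities of this development, \<open>1 / \<bar>x\<bar>\<close> and \<open>1 / (\<bar>x\<bar> ln \<bar>x\<bar>)\<^sup>2\<close>, are treated
  in this way.\<close>

lemma nn_integral_dyadic_annuli:
  fixes f :: "complex \<Rightarrow> real"
  assumes [measurable]: "f \<in> borel_measurable borel" and R: "R > 0"
    and bound: "\<And>k x. R / 2 ^ Suc k < norm x \<Longrightarrow> norm x \<le> R / 2 ^ k \<Longrightarrow> f x \<le> a k"
    and outer: "\<And>x. R < norm x \<Longrightarrow> f x \<le> 0"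
    and a: "\<And>k. a k \<ge> 0" and s: "summable (\<lambda>k. a k / 4 ^ k)"
  shows "(\<integral>\<^sup>+x. ennreal (f x) \<partial>lborel) < \<infinity>"
proof -
  have ae: "AE x::complex in lborel. x \<noteq> 0"
    by (rule AE_lborel_singleton)
  have le: "ennreal (f x) \<le> (\<Sum>k. ennreal (a k) * indicator (cball 0 (R / 2 ^ k)) x)" if "x \<noteq> 0" for x
  proof (cases "norm x \<le> R")
    case True
    have "\<exists>k. R / 2 ^ Suc k < norm x"
    proof -
      obtain n where "R / norm x < 2 ^ n" using real_arch_pow[of 2 "R / norm x"] by auto
      also have "(2::real) ^ n \<le> 2 ^ Suc n" by simp
      finally show ?thesis using that by (intro exI[of _ n]) (simp add: field_simps)
    qed
    \<comment> \<open>the index of the annulus that contains \<open>x\<close>\<close>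
    define k where "k = (LEAST k. R / 2 ^ Suc k < norm x)"
    have k: "R / 2 ^ Suc k < norm x" unfolding k_def using \<open>\<exists>k. _ k\<close> by (rule LeastI_ex)
    have k2: "norm x \<le> R / 2 ^ k"
    proof (cases k)
      case (Suc j)
      then have "\<not> R / 2 ^ Suc j < norm x" unfolding k_def by (metis not_less_Least lessI)
      then show ?thesis using Suc by simp
    qed (use True in simp)
    have "ennreal (f x) \<le> ennreal (a k) * indicator (cball 0 (R / 2 ^ k)) x"
      using bound[OF k k2] k2 by (simp add: indicator_def ennreal_leI)
    also have "\<dots> \<le> (\<Sum>k. ennreal (a k) * indicator (cball 0 (R / 2 ^ k)) x)"
    proof -
      define t where "t j = ennreal (a j) * indicator (cball 0 (R / 2 ^ j)) x" for j
      show ?thesis using sum_le_suminf[of t "{k}"] by (simp add: t_def[symmetric])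
    qed
    finally show ?thesis .
  next
    case False
    then have "f x \<le> 0" using outer by simp
    then show ?thesis by (simp add: ennreal_neg)
  qed
  have "(\<integral>\<^sup>+x. ennreal (f x) \<partial>lborel) \<le> (\<integral>\<^sup>+x. (\<Sum>k. ennreal (a k) * indicator (cball 0 (R / 2 ^ k)) (x::complex)) \<partial>lborel)"
    using ae by (intro nn_integral_mono_AE) (auto elim!: eventually_mono intro: le)
  also have "\<dots> = (\<Sum>k. \<integral>\<^sup>+x. ennreal (a k) * indicator (cball 0 (R / 2 ^ k)) (x::complex) \<partial>lborel)"
    by (rule nn_integral_suminf) (auto intro!: borel_measurable_times_ennreal borel_measurable_indicator borel_closed)
  also have "\<dots> = (\<Sum>k. ennreal (pi * R\<^sup>2 * (a k / 4 ^ k)))"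
  proof (rule suminf_cong)
    fix k
    have "(2::real) ^ k * 2 ^ k = 4 ^ k" by (simp flip: power_mult_distrib)
    then have eq: "a k * (pi * (R / 2 ^ k)\<^sup>2) = pi * R\<^sup>2 * (a k / 4 ^ k)"
      by (simp add: power_divide power2_eq_square mult_ac)
    have "(\<integral>\<^sup>+x. ennreal (a k) * indicator (cball 0 (R / 2 ^ k)) (x::complex) \<partial>lborel)
        = ennreal (a k) * emeasure lborel (cball (0::complex) (R / 2 ^ k))"
      by (rule nn_integral_cmult_indicator) simp
    also have "\<dots> = ennreal (a k * (pi * (R / 2 ^ k)\<^sup>2))"
      using R a[of k] by (simp add: emeasure_cball_complex ennreal_mult)
    finally show "(\<integral>\<^sup>+x. ennreal (a k) * indicator (cball 0 (R / 2 ^ k)) (x::complex) \<partial>lborel)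
        = ennreal (pi * R\<^sup>2 * (a k / 4 ^ k))" unfolding eq .
  qed
  also have "\<dots> < \<infinity>"
    using summable_mult[OF s, of "pi * R\<^sup>2"] a by (subst suminf_ennreal2) auto
  finally show ?thesis .
qed


section \<open>The fundamental solution of the Laplacian\<close>

lemma laplacian_eq: "laplacian f x = pderiv_dir 1 (pderiv_dir 1 f) x + pderiv_dir \<i> (pderiv_dir \<i> f) x"
  by (simp add: laplacian_def Basis_complex_def)

lemma smooth_expr_laplacian: "smooth_expr f \<Longrightarrow> smooth_expr (laplacian f)"
  unfolding laplacian_eq[abs_def] by (intro smooth_expr.add smooth_expr_pderiv_dir)

lemma pderiv_dir_translate:
  assumes "smooth_expr f"
  shows "pderiv_dir b (\<lambda>x. f (x - y)) = (\<lambda>x. pderiv_dir b f (x - y))"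
  using pderiv_dir_affine[of f 1] smooth_expr_differentiable[OF assms] by auto

lemma smooth_expr_translate: "smooth_expr f \<Longrightarrow> smooth_expr (\<lambda>x. f (x - y))"
  using smooth_expr_affine[of f 1 y] by simp

lemma laplacian_translate:
  assumes "smooth_expr f"
  shows "laplacian (\<lambda>x. f (x - y)) = (\<lambda>x. laplacian f (x - y))"
  by (simp add: laplacian_eq[abs_def] pderiv_dir_translate assms smooth_expr_pderiv_dir)

lemma laplacian_eq_0_off_support:
  assumes "\<And>x. R < norm x \<Longrightarrow> f x = (0::real)" "R < norm x"
  shows "laplacian f x = 0"
  using pderiv_dir_eq_0_off_support[OF pderiv_dir_eq_0_off_support[OF assms(1)] assms(2)]
  by (simp add: laplacian_eq)

lemma integral_laplacian_swap:
  assumes k: "smooth_expr k" and t: "smooth_expr \<theta>" and supp: "\<And>x. R < norm x \<Longrightarrow> \<theta> x = 0"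
  shows "(\<integral>x. k x * laplacian \<theta> x \<partial>lborel) = (\<integral>x. laplacian k x * \<theta> x \<partial>lborel)"
proof -
  have supp': "R < norm x \<Longrightarrow> pderiv_dir b \<theta> x = 0" "R < norm x \<Longrightarrow> pderiv_dir b (pderiv_dir b \<theta>) x = 0" for b x
    using pderiv_dir_eq_0_off_support[of R \<theta>] pderiv_dir_eq_0_off_support[of R "pderiv_dir b \<theta>" _ b] supp by auto
  have 1: "(\<integral>x. k x * pderiv_dir b (pderiv_dir b \<theta>) x \<partial>lborel)
      = (\<integral>x. pderiv_dir b (pderiv_dir b k) x * \<theta> x \<partial>lborel)" for b
    using integral_by_parts[of k b "pderiv_dir b \<theta>" R] integral_by_parts[of "pderiv_dir b k" b \<theta> R]
      k t supp supp' by (simp add: smooth_expr_differentiable smooth_expr_continuous smooth_expr_pderiv_dir)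
  have 2: "integrable lborel (\<lambda>x. k x * pderiv_dir b (pderiv_dir b \<theta>) x)"
    "integrable lborel (\<lambda>x. pderiv_dir b (pderiv_dir b k) x * \<theta> x)" for b
    using supp supp' k t
    by (auto intro!: integrable_continuous_compact_support[where R = R] smooth_expr_continuous
        smooth_expr.mult smooth_expr_pderiv_dir)
  show ?thesis by (simp add: laplacian_eq distrib_left distrib_right 2 1)
qed

text \<open>A common majorant of the logarithm, of the components of its gradient, and of their
  regularizations.\<close>

definition kernel_bound :: "complex \<Rightarrow> real" where
  "kernel_bound z = 1 / norm z + norm z + (norm z)\<^sup>2"

lemma kernel_bound_nonneg: "kernel_bound z \<ge> 0" by (simp add: kernel_bound_def)

lemma kernel_bound_measurable [measurable]: "kernel_bound \<in> borel_measurable borel"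
  unfolding kernel_bound_def[abs_def] by measurable

lemma cball_complex_measurable [measurable, simp]: "cball (c::complex) R \<in> sets borel"
  by (rule borel_closed[OF closed_cball])

lemma integrable_inverse_norm: "integrable lborel (\<lambda>x::complex. indicator (cball 0 R) x / norm x)"
proof (cases "R > 0")
  case True
  have m: "(\<lambda>x::complex. indicator (cball 0 R) x / norm x) \<in> borel_measurable borel" by measurable
  have "(\<integral>\<^sup>+x. ennreal (indicator (cball 0 R) x / norm (x::complex)) \<partial>lborel) < \<infinity>"
  proof (rule nn_integral_dyadic_annuli[OF m True, where a = "\<lambda>k. 2 ^ Suc k / R"])
    fix k and x :: complex assume *: "R / 2 ^ Suc k < norm x" "norm x \<le> R / 2 ^ k"
    then have "norm x > 0" using True by (smt (verit) divide_pos_pos zero_less_power)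
    then show "indicator (cball 0 R) x / norm x \<le> 2 ^ Suc k / R"
      using * True by (auto simp: indicator_def field_simps)
  next
    have "(\<lambda>k. 2 ^ Suc k / R / 4 ^ k) = (\<lambda>k. 2 / R * (1 / 2) ^ k)"
    proof
      fix k
      have "(4::real) ^ k = 2 ^ k * 2 ^ k" by (simp flip: power_mult_distrib)
      then show "2 ^ Suc k / R / 4 ^ k = 2 / R * (1 / 2) ^ k" by (simp add: power_one_over field_simps)
    qed
    then show "summable (\<lambda>k. 2 ^ Suc k / R / 4 ^ k)" by (simp add: summable_geometric)
  qed (use True in auto)
  then show ?thesis using m by (intro integrableI_nonneg) auto
next
  case False
  then have "(\<lambda>x::complex. indicator (cball 0 R) x / norm x) = (\<lambda>x. 0::real)"
    by (auto simp: indicator_def fun_eq_iff dest: order_trans[OF _ leI])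
  then show ?thesis by simp
qed

lemma integrable_kernel_bound: "integrable lborel (\<lambda>x. indicator (cball 0 R) x * kernel_bound x)"
proof -
  have "integrable lborel (\<lambda>x::complex. indicator (cball 0 R) x *\<^sub>R (norm x + (norm x)\<^sup>2))"
    by (intro borel_integrable_compact compact_cball continuous_intros)
  from Bochner_Integration.integrable_add[OF integrable_inverse_norm[of R] this]
  show ?thesis by (simp add: kernel_bound_def algebra_simps)
qed

text \<open>The second bound is uniform in \<open>y\<close>; this is what makes Fubini's theorem applicable when \<open>y\<close> runs
  through a bounded curve.\<close>

lemma kernel_bound_translate:
  fixes y :: complex
  assumes "norm y \<le> \<rho>"
  shows "integrable lborel (\<lambda>x. indicator (cball 0 R) x * kernel_bound (x - y))"
    and "(\<integral>x. indicator (cball 0 R) x * kernel_bound (x - y) \<partial>lborel)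
      \<le> (\<integral>x. indicator (cball 0 (R + \<rho>)) x * kernel_bound x \<partial>lborel)"
proof -
  let ?k = "\<lambda>z. indicator (cball 0 (R + \<rho>)) z * kernel_bound z"
  have m [measurable]: "?k \<in> borel_measurable borel" by measurable
  have "integrable (distr lborel borel ((+) (-y))) ?k"
    by (subst lborel_distr_plus) (rule integrable_kernel_bound)
  then have 1: "integrable lborel (\<lambda>x. ?k (x - y))"
    by (subst (asm) integrable_distr_eq)
       (auto intro!: borel_measurable_times borel_measurable_indicator borel_closed)
  have le: "indicator (cball 0 R) x * kernel_bound (x - y) \<le> ?k (x - y)" for x
    using assms kernel_bound_nonneg[of "x - y"] norm_triangle_ineq4[of x y]
    by (auto simp: indicator_def)
  show 2: "integrable lborel (\<lambda>x. indicator (cball 0 R) x * kernel_bound (x - y))"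
    by (rule Bochner_Integration.integrable_bound[OF 1])
       (use le kernel_bound_nonneg in \<open>auto intro!: AE_I2 borel_measurable_times borel_measurable_indicator borel_closed simp: abs_mult\<close>)
  have "(\<integral>x. indicator (cball 0 R) x * kernel_bound (x - y) \<partial>lborel) \<le> (\<integral>x. ?k (x - y) \<partial>lborel)"
    by (intro integral_mono 1 2 le)
  also have "\<dots> = (\<integral>x. ?k x \<partial>lborel)"
    using lborel_integral_translate[OF m, of "- y"] by simp
  finally show "(\<integral>x. indicator (cball 0 R) x * kernel_bound (x - y) \<partial>lborel)
      \<le> (\<integral>x. indicator (cball 0 (R + \<rho>)) x * kernel_bound x \<partial>lborel)" .
qed

lemma kernel_tendsto:
  fixes y :: complex
  assumes [measurable]: "\<And>n::nat. K n \<in> borel_measurable borel" "L \<in> borel_measurable borel"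
    and lim: "\<And>z. z \<noteq> 0 \<Longrightarrow> (\<lambda>n. K n z) \<longlonglongrightarrow> L z"
    and bound: "\<And>n z. z \<noteq> 0 \<Longrightarrow> \<bar>K n z\<bar> \<le> A * kernel_bound z" and A: "A \<ge> 0"
    and cont: "continuous_on UNIV \<phi>" and supp: "\<And>x. R < norm x \<Longrightarrow> \<phi> x = 0"
  shows "(\<lambda>n. \<integral>x. K n (x - y) * \<phi> x \<partial>lborel) \<longlonglongrightarrow> (\<integral>x. L (x - y) * \<phi> x \<partial>lborel)"
proof -
  have [measurable]: "\<phi> \<in> borel_measurable borel" by (rule borel_measurable_continuous_onI[OF cont])
  obtain C where C: "C > 0" "\<And>x. \<bar>\<phi> x\<bar> \<le> C"
    using bounded_continuous_compact_support[OF cont supp] by blast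
  have ae: "AE x in lborel. x \<noteq> y" by (rule AE_lborel_singleton)
  show ?thesis
  proof (rule integral_dominated_convergence)
    show "integrable lborel (\<lambda>x. A * C * (indicator (cball 0 R) x * kernel_bound (x - y)))"
      by (intro integrable_mult_right kernel_bound_translate(1)[OF order_refl])
    show "AE x in lborel. (\<lambda>n. K n (x - y) * \<phi> x) \<longlonglongrightarrow> L (x - y) * \<phi> x"
      using ae by eventually_elim (auto intro!: tendsto_intros lim)
    fix n
    show "AE x in lborel. norm (K n (x - y) * \<phi> x) \<le> A * C * (indicator (cball 0 R) x * kernel_bound (x - y))"
      using ae
    proof eventually_elim
      case (elim x)
      show ?case
      proof (cases "norm x \<le> R")
        case True
        have "\<bar>K n (x - y)\<bar> * \<bar>\<phi> x\<bar> \<le> (A * kernel_bound (x - y)) * C"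
          using bound[of "x - y" n] elim C A kernel_bound_nonneg by (intro mult_mono) auto
        then show ?thesis using True by (simp add: abs_mult mult_ac)
      qed (use supp A C kernel_bound_nonneg in auto)
    qed
  qed measurable
qed

lemma abs_ln_norm_le:
  assumes "z \<noteq> 0" shows "\<bar>ln (norm z)\<bar> \<le> 1 / norm z + norm z"
proof -
  have n: "norm z > 0" using assms by simp
  have "ln (norm z) \<le> norm z - 1" "ln (1 / norm z) \<le> 1 / norm z - 1"
    using n by (intro ln_le_minus_one; simp)+
  moreover have "ln (1 / norm z) = - ln (norm z)" using n by (simp add: ln_div)
  moreover have "1 / norm z > 0" using n by simp
  ultimately show ?thesis using n by linarith
qed

text \<open>A smooth regularization of \<open>ln \<bar>z\<bar>\<close>, decreasing to it as \<open>e\<close> tends to zero. Its Laplacian is the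
  kernel \<open>bump_kernel e\<close>, a rescaled copy of a fixed integrable function, hence an approximate
  identity up to a constant factor.\<close>

definition reg_ln :: "real \<Rightarrow> complex \<Rightarrow> real" where
  "reg_ln e z = 1 / 2 * ln ((norm z)\<^sup>2 + e\<^sup>2)"

definition bump_kernel :: "real \<Rightarrow> complex \<Rightarrow> real" where
  "bump_kernel e z = 2 * e\<^sup>2 / ((norm z)\<^sup>2 + e\<^sup>2)\<^sup>2"

lemma reg_ln_cart: "reg_ln e = (\<lambda>z. 1 / 2 * ln ((Re z)\<^sup>2 + (Im z)\<^sup>2 + e\<^sup>2))"
  and bump_kernel_cart: "bump_kernel e = (\<lambda>z. 2 * e\<^sup>2 / ((Re z)\<^sup>2 + (Im z)\<^sup>2 + e\<^sup>2)\<^sup>2)"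
  by (auto simp: reg_ln_def bump_kernel_def cmod_power2)

lemma smooth_expr_reg_ln: "e > 0 \<Longrightarrow> smooth_expr (reg_ln e)"
  unfolding reg_ln_def[abs_def]
  by (intro smooth_expr.mult smooth_expr.const smooth_expr.ln smooth_expr.add smooth_expr_norm2)
     (auto intro: add_nonneg_pos)

lemma smooth_expr_bump_kernel: "e > 0 \<Longrightarrow> smooth_expr (bump_kernel e)"
  unfolding bump_kernel_def[abs_def] power2_eq_square[of "_ + _"]
  by (intro smooth_expr_divide smooth_expr.mult smooth_expr.const smooth_expr.add smooth_expr_norm2)
     (simp add: add_nonneg_eq_0_iff)

text \<open>The derivatives of \<open>reg_ln\<close> are polynomials in the coordinates and in this function, whose own
  derivative is again such a polynomial; no division occurs in the computation of higher
  derivatives.\<close>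

definition reg_inverse :: "real \<Rightarrow> complex \<Rightarrow> real" where
  "reg_inverse e z = inverse ((Re z)\<^sup>2 + (Im z)\<^sup>2 + e\<^sup>2)"

lemma reg_inverse_cancel: "e > 0 \<Longrightarrow> reg_inverse e z * ((Re z)\<^sup>2 + (Im z)\<^sup>2 + e\<^sup>2) = 1"
  by (simp add: reg_inverse_def sum_power2_eq_zero_iff add_nonneg_eq_0_iff)

lemma reg_inverse_derivative:
  assumes "e > 0"
  shows "(reg_inverse e has_derivative
    (\<lambda>c. - 2 * (Re z * Re c + Im z * Im c) * (reg_inverse e z)\<^sup>2)) (at z)"
proof -
  have "(Re z)\<^sup>2 + (Im z)\<^sup>2 + e\<^sup>2 \<noteq> 0" using assms by (simp add: add_nonneg_eq_0_iff)
  then show ?thesis unfolding reg_inverse_def[abs_def]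
    by (auto intro!: derivative_eq_intros simp: fun_eq_iff power2_eq_square algebra_simps)
qed

lemma pderiv_reg_ln:
  assumes "e > 0"
  shows "pderiv_dir b (reg_ln e) = (\<lambda>z. (Re z * Re b + Im z * Im b) * reg_inverse e z)"
proof
  fix z
  have "(Re z)\<^sup>2 + (Im z)\<^sup>2 + e\<^sup>2 > 0" using assms by (simp add: add_nonneg_pos)
  then have "((\<lambda>z. 1 / 2 * ln ((Re z)\<^sup>2 + (Im z)\<^sup>2 + e\<^sup>2)) has_derivative
      (\<lambda>b. (Re z * Re b + Im z * Im b) * reg_inverse e z)) (at z)"
    by (auto intro!: derivative_eq_intros simp: fun_eq_iff field_simps reg_inverse_def)
  then show "pderiv_dir b (reg_ln e) z = (Re z * Re b + Im z * Im b) * reg_inverse e z"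
    unfolding reg_ln_cart by (rule pderiv_dir_eqI)
qed

lemma pderiv_reg_ln2:
  assumes "e > 0"
  shows "pderiv_dir b (pderiv_dir v (reg_ln e)) = (\<lambda>z. (Re b * Re v + Im b * Im v) * reg_inverse e z
    - 2 * (Re z * Re v + Im z * Im v) * (Re z * Re b + Im z * Im b) * (reg_inverse e z)\<^sup>2)"
proof
  fix z
  have "((\<lambda>z. (Re z * Re v + Im z * Im v) * reg_inverse e z) has_derivative
      (\<lambda>b. (Re b * Re v + Im b * Im v) * reg_inverse e z
    - 2 * (Re z * Re v + Im z * Im v) * (Re z * Re b + Im z * Im b) * (reg_inverse e z)\<^sup>2)) (at z)"
    by (auto intro!: derivative_eq_intros reg_inverse_derivative[OF assms] simp: fun_eq_iff algebra_simps)
  then show "pderiv_dir b (pderiv_dir v (reg_ln e)) z = (Re b * Re v + Im b * Im v) * reg_inverse e z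
    - 2 * (Re z * Re v + Im z * Im v) * (Re z * Re b + Im z * Im b) * (reg_inverse e z)\<^sup>2"
    unfolding pderiv_reg_ln[OF assms] by (rule pderiv_dir_eqI)
qed

lemma pderiv_reg_ln3:
  assumes "e > 0"
  shows "pderiv_dir c (pderiv_dir b (pderiv_dir v (reg_ln e))) z =
    - 2 * ((Re b * Re v + Im b * Im v) * (Re z * Re c + Im z * Im c)
      + (Re c * Re v + Im c * Im v) * (Re z * Re b + Im z * Im b)
      + (Re z * Re v + Im z * Im v) * (Re c * Re b + Im c * Im b)) * (reg_inverse e z)\<^sup>2
    + 8 * (Re z * Re v + Im z * Im v) * (Re z * Re b + Im z * Im b) * (Re z * Re c + Im z * Im c) * (reg_inverse e z) ^ 3"
proof -
  have "((\<lambda>z. (Re b * Re v + Im b * Im v) * reg_inverse e z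
    - 2 * (Re z * Re v + Im z * Im v) * (Re z * Re b + Im z * Im b) * (reg_inverse e z)\<^sup>2) has_derivative (\<lambda>c.
    - 2 * ((Re b * Re v + Im b * Im v) * (Re z * Re c + Im z * Im c)
      + (Re c * Re v + Im c * Im v) * (Re z * Re b + Im z * Im b)
      + (Re z * Re v + Im z * Im v) * (Re c * Re b + Im c * Im b)) * (reg_inverse e z)\<^sup>2
    + 8 * (Re z * Re v + Im z * Im v) * (Re z * Re b + Im z * Im b) * (Re z * Re c + Im z * Im c) * (reg_inverse e z) ^ 3)) (at z)"
    by (auto intro!: derivative_eq_intros reg_inverse_derivative[OF assms]
        simp: fun_eq_iff power2_eq_square power3_eq_cube algebra_simps)
  then show ?thesis
    unfolding pderiv_reg_ln2[OF assms(1)] by (rule pderiv_dir_eqI)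
qed

lemma bump_kernel_eq: "bump_kernel e = (\<lambda>z. 2 * e\<^sup>2 * (reg_inverse e z)\<^sup>2)"
  by (simp add: fun_eq_iff bump_kernel_cart reg_inverse_def divide_inverse power_inverse)

lemma laplacian_reg_ln:
  assumes "e > 0" shows "laplacian (reg_ln e) = bump_kernel e"
proof
  fix z
  let ?i = "reg_inverse e z" and ?s = "(Re z)\<^sup>2 + (Im z)\<^sup>2"
  have "laplacian (reg_ln e) z = 2 * ?i - 2 * ?s * ?i\<^sup>2"
    by (simp add: laplacian_eq pderiv_reg_ln2[OF assms] algebra_simps power2_eq_square)
  also have "\<dots> = 2 * (?i * (?s + e\<^sup>2)) * ?i - 2 * ?s * ?i\<^sup>2"
    by (simp only: reg_inverse_cancel[OF assms] mult_1_right)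
  also have "\<dots> = bump_kernel e z" by (simp add: bump_kernel_eq power2_eq_square algebra_simps)
  finally show "laplacian (reg_ln e) z = bump_kernel e z" .
qed

lemma pderiv_bump_kernel:
  assumes "e > 0"
  shows "pderiv_dir v (bump_kernel e) z = - 8 * e\<^sup>2 * (Re z * Re v + Im z * Im v) * (reg_inverse e z) ^ 3"
proof -
  have "((\<lambda>z. 2 * e\<^sup>2 * (reg_inverse e z)\<^sup>2) has_derivative
      (\<lambda>v. - 8 * e\<^sup>2 * (Re z * Re v + Im z * Im v) * (reg_inverse e z) ^ 3)) (at z)"
    by (auto intro!: derivative_eq_intros reg_inverse_derivative[OF assms]
        simp: fun_eq_iff power2_eq_square power3_eq_cube algebra_simps)
  then show ?thesis unfolding bump_kernel_eq by (rule pderiv_dir_eqI)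
qed

lemma laplacian_pderiv_reg_ln:
  assumes "e > 0" shows "laplacian (pderiv_dir v (reg_ln e)) = pderiv_dir v (bump_kernel e)"
proof
  fix z
  let ?i = "reg_inverse e z" and ?s = "(Re z)\<^sup>2 + (Im z)\<^sup>2"
  define p where "p = Re z * Re v + Im z * Im v"
  have "laplacian (pderiv_dir v (reg_ln e)) z = - 8 * p * ?i\<^sup>2 + 8 * p * ?s * ?i ^ 3"
    unfolding laplacian_eq pderiv_reg_ln3[OF assms] p_def
    by (simp add: power2_eq_square power3_eq_cube algebra_simps)
  also have "\<dots> = - 8 * p * (?i * (?s + e\<^sup>2)) * ?i\<^sup>2 + 8 * p * ?s * ?i ^ 3"
    by (simp only: reg_inverse_cancel[OF assms] mult_1_right)
  also have "\<dots> = - 8 * e\<^sup>2 * p * ?i ^ 3" by (simp add: power2_eq_square power3_eq_cube algebra_simps)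
  also have "\<dots> = pderiv_dir v (bump_kernel e) z"
    unfolding pderiv_bump_kernel[OF assms] p_def ..
  finally show "laplacian (pderiv_dir v (reg_ln e)) z = pderiv_dir v (bump_kernel e) z" .
qed

text \<open>The kernel is dominated by a product of two Cauchy densities.\<close>

lemma integrable_bump_kernel: "integrable lborel (bump_kernel 1)"
proof -
  have [measurable]: "bump_kernel 1 \<in> borel_measurable borel"
    by (intro borel_measurable_continuous_onI smooth_expr_continuous smooth_expr_bump_kernel) simp
  define I where "I = (\<integral>\<^sup>+x. ennreal (1 / (1 + x\<^sup>2)) \<partial>lborel)"
  have half: "(\<integral>\<^sup>+x. ennreal (1 / (1 + x\<^sup>2)) * indicator {0..} x \<partial>lborel) = ennreal (pi / 2 - arctan 0)"
  proof (rule nn_integral_FTC_atLeast)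
    show "(arctan has_real_derivative 1 / (1 + x\<^sup>2)) (at x)" for x
      using DERIV_arctan[of x] by (simp add: divide_inverse)
  qed (auto simp: tendsto_arctan_at_top)
  have "I \<le> (\<integral>\<^sup>+x. ennreal (1 / (1 + x\<^sup>2)) * indicator {0..} x
      + ennreal (1 / (1 + (- x)\<^sup>2)) * indicator {0..} (- x) \<partial>lborel)"
    unfolding I_def by (rule nn_integral_mono) (auto simp: indicator_def)
  also have "\<dots> = (\<integral>\<^sup>+x. ennreal (1 / (1 + x\<^sup>2)) * indicator {0..} x \<partial>lborel)
      + (\<integral>\<^sup>+x. ennreal (1 / (1 + (- x)\<^sup>2)) * indicator {0..} (- x) \<partial>lborel)"
    by (rule nn_integral_add) auto
  also have "(\<integral>\<^sup>+x. ennreal (1 / (1 + (- x)\<^sup>2)) * indicator {0..} (- x) \<partial>lborel)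
      = (\<integral>\<^sup>+x. ennreal (1 / (1 + x\<^sup>2)) * indicator {0..} x \<partial>lborel)"
    using nn_integral_real_affine[of "\<lambda>x. ennreal (1 / (1 + x\<^sup>2)) * indicator {0..} x" "-1" 0] by simp
  finally have "I \<le> ennreal (pi / 2 - arctan 0) + ennreal (pi / 2 - arctan 0)" unfolding half .
  then have I: "I < \<infinity>" by (rule le_less_trans) (simp add: ennreal_add_less_top)
  have "(\<integral>\<^sup>+z. ennreal (norm (bump_kernel 1 z)) \<partial>lborel)
      \<le> (\<integral>\<^sup>+z. ennreal (2 * (1 / (1 + (Re z)\<^sup>2)) * (1 / (1 + (Im z)\<^sup>2))) \<partial>lborel)"
  proof (intro nn_integral_mono ennreal_leI)
    fix z
    have "(1 + (Re z)\<^sup>2) * (1 + (Im z)\<^sup>2) \<le> ((Re z)\<^sup>2 + (Im z)\<^sup>2 + 1)\<^sup>2"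
      unfolding power2_eq_square[of "_ + _"] by (intro mult_mono) auto
    then show "norm (bump_kernel 1 z) \<le> 2 * (1 / (1 + (Re z)\<^sup>2)) * (1 / (1 + (Im z)\<^sup>2))"
      by (simp add: bump_kernel_cart frac_le add_pos_nonneg)
  qed
  also have "\<dots> = (\<integral>\<^sup>+y. \<integral>\<^sup>+x. ennreal (2 * (1 / (1 + x\<^sup>2)) * (1 / (1 + y\<^sup>2))) \<partial>lborel \<partial>lborel)"
    by (subst nn_integral_complex(1)) simp_all
  also have "\<dots> = (\<integral>\<^sup>+y. \<integral>\<^sup>+x. ennreal 2 * ennreal (1 / (1 + y\<^sup>2)) * ennreal (1 / (1 + x\<^sup>2)) \<partial>lborel \<partial>lborel)"
    by (intro nn_integral_cong) (simp add: ennreal_mult[symmetric] mult_ac del: ennreal_numeral)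
  also have "\<dots> = ennreal 2 * I * I"
    unfolding I_def by (simp add: nn_integral_cmult nn_integral_multc del: ennreal_numeral)
  also have "\<dots> < \<infinity>" using I by (simp add: ennreal_mult_less_top)
  finally show ?thesis by (intro integrableI_bounded) auto
qed

lemma lborel_integral_scale:
  fixes f :: "complex \<Rightarrow> real"
  assumes [measurable]: "f \<in> borel_measurable borel" and e: "e > 0"
  shows "(\<integral>x. f x \<partial>lborel) = (\<integral>w. e\<^sup>2 * f (y + e *\<^sub>R w) \<partial>lborel)"
proof -
  have "(\<integral>x. f x \<partial>lborel) = (\<integral>x. f x \<partial>density (distr lborel borel (\<lambda>x. y + e *\<^sub>R x)) (\<lambda>_. ennreal (e\<^sup>2)))"
    using lborel_affine[of e y] e by (simp add: ennreal_power)
  also have "\<dots> = (\<integral>x. e\<^sup>2 * f x \<partial>distr lborel borel (\<lambda>x. y + e *\<^sub>R x))"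
    by (subst integral_density) auto
  also have "\<dots> = (\<integral>w. e\<^sup>2 * f (y + e *\<^sub>R w) \<partial>lborel)"
    by (rule integral_distr) auto
  finally show ?thesis .
qed

text \<open>The constant that is classically \<open>2\<pi>\<close>. All estimates below hold up to a constant factor, so it
  stays symbolic.\<close>

definition bump_mass :: real where
  "bump_mass = (\<integral>w. bump_kernel 1 w \<partial>lborel)"

lemma bump_kernel_tendsto:
  fixes y :: complex
  assumes cont: "continuous_on UNIV \<phi>" and supp: "\<And>x. R < norm x \<Longrightarrow> \<phi> x = 0"
  shows "(\<lambda>n. \<integral>x. bump_kernel (1 / real (Suc n)) (x - y) * \<phi> x \<partial>lborel) \<longlonglongrightarrow> bump_mass * \<phi> y"
proof -
  have [measurable]: "\<phi> \<in> borel_measurable borel" by (rule borel_measurable_continuous_onI[OF cont])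
  have bm: "bump_kernel e \<in> borel_measurable borel" if "e > 0" for e
    by (intro borel_measurable_continuous_onI smooth_expr_continuous smooth_expr_bump_kernel that)
  note [measurable] = bm[OF zero_less_one]
  obtain C where C: "C > 0" "\<And>x. \<bar>\<phi> x\<bar> \<le> C"
    using bounded_continuous_compact_support[OF cont supp] by blast
  have eq: "(\<integral>x. bump_kernel e (x - y) * \<phi> x \<partial>lborel) = (\<integral>w. bump_kernel 1 w * \<phi> (y + e *\<^sub>R w) \<partial>lborel)"
    if e: "e > 0" for e
  proof -
    note [measurable] = bm[OF e]
    have "e\<^sup>2 * bump_kernel e (e *\<^sub>R w) = bump_kernel 1 w" for w
    proof -
      have "(norm w)\<^sup>2 + 1 > 0" by (simp add: add_nonneg_pos)
      moreover have "e\<^sup>2 * bump_kernel e (e *\<^sub>R w) = e\<^sup>2 * (2 * e\<^sup>2) / (e\<^sup>2 * ((norm w)\<^sup>2 + 1))\<^sup>2"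
        using e by (simp add: bump_kernel_def power_mult_distrib algebra_simps)
      moreover have "E * (2 * E) / (E * q)\<^sup>2 = 2 / q\<^sup>2" if "E \<noteq> 0" for E q :: real
        using that by (cases "q = 0") (auto simp: power2_eq_square field_simps)
      ultimately show ?thesis using e by (simp add: bump_kernel_def)
    qed
    then show ?thesis
      by (subst lborel_integral_scale[OF _ e, where y = y]) (auto simp: mult.assoc[symmetric])
  qed
  have "(\<lambda>n. \<integral>w. bump_kernel 1 w * \<phi> (y + (1 / real (Suc n)) *\<^sub>R w) \<partial>lborel)
      \<longlonglongrightarrow> (\<integral>w. bump_kernel 1 w * \<phi> y \<partial>lborel)"
  proof (rule integral_dominated_convergence)
    show "integrable lborel (\<lambda>w. bump_kernel 1 w * C)" using integrable_bump_kernel by simp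
    show "AE w in lborel. (\<lambda>n. bump_kernel 1 w * \<phi> (y + (1 / real (Suc n)) *\<^sub>R w)) \<longlonglongrightarrow> bump_kernel 1 w * \<phi> y"
    proof (intro AE_I2 tendsto_mult tendsto_const)
      fix w :: complex
      have "(\<lambda>n. y + (1 / real (Suc n)) *\<^sub>R w) \<longlonglongrightarrow> y + 0 *\<^sub>R w"
        by (intro tendsto_intros LIMSEQ_Suc[OF lim_1_over_n])
      then show "(\<lambda>n. \<phi> (y + (1 / real (Suc n)) *\<^sub>R w)) \<longlonglongrightarrow> \<phi> y"
        by (intro continuous_on_tendsto_compose[OF cont]) auto
    qed
    show "AE w in lborel. norm (bump_kernel 1 w * \<phi> (y + (1 / real (Suc n)) *\<^sub>R w)) \<le> bump_kernel 1 w * C" for n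
      using C by (intro AE_I2) (auto simp: abs_mult bump_kernel_def intro!: divide_right_mono)
  qed measurable
  then show ?thesis by (simp add: eq bump_mass_def del: of_nat_Suc)
qed

lemma reg_ln_bound:
  assumes "0 < e" "e \<le> 1" "z \<noteq> 0"
  shows "\<bar>reg_ln e z\<bar> \<le> 1 * kernel_bound z"
proof -
  have n: "norm z > 0" using assms by simp
  have "ln ((norm z)\<^sup>2) \<le> ln ((norm z)\<^sup>2 + e\<^sup>2)"
    using n by (intro ln_le_cancel_iff[THEN iffD2]) (auto intro: add_pos_nonneg)
  then have lower: "ln (norm z) \<le> reg_ln e z" using n by (simp add: reg_ln_def ln_realpow)
  have "ln ((norm z)\<^sup>2 + e\<^sup>2) \<le> ((norm z)\<^sup>2 + e\<^sup>2) - 1"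
    using assms by (intro ln_le_minus_one) (simp add: add_nonneg_pos)
  moreover have "e\<^sup>2 \<le> 1" using assms by (simp add: power_le_one)
  ultimately have upper: "reg_ln e z \<le> (norm z)\<^sup>2" by (simp add: reg_ln_def) (smt (verit) zero_le_power2)
  have "1 / norm z \<ge> 0" "norm z \<ge> 0" "(norm z)\<^sup>2 \<ge> 0" by auto
  with lower upper abs_ln_norm_le[OF assms(3), unfolded abs_le_iff] show ?thesis
    unfolding kernel_bound_def abs_le_iff mult_1 by (elim conjE) (intro conjI; linarith)
qed

lemma dipole_bound:
  assumes "e > 0"
  shows "\<bar>(Re z * Re v + Im z * Im v) * reg_inverse e z\<bar> \<le> norm v * kernel_bound z"
proof (cases "z = 0")
  case True
  then show ?thesis by (simp add: kernel_bound_def)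
next
  case False
  then have n: "norm z > 0" by simp
  have "\<bar>z \<bullet> v\<bar> \<le> norm z * norm v" by (rule Cauchy_Schwarz_ineq2)
  then have 1: "\<bar>Re z * Re v + Im z * Im v\<bar> \<le> norm z * norm v" by (simp add: inner_complex_def)
  have "reg_inverse e z \<le> inverse ((norm z)\<^sup>2)"
    unfolding reg_inverse_def cmod_power2[symmetric] using n by (intro le_imp_inverse_le) auto
  moreover have "reg_inverse e z \<ge> 0" by (simp add: reg_inverse_def)
  ultimately have "\<bar>(Re z * Re v + Im z * Im v) * reg_inverse e z\<bar> \<le> (norm z * norm v) * inverse ((norm z)\<^sup>2)"
    unfolding abs_mult using 1 n by (intro mult_mono) auto
  also have "\<dots> = norm v * (1 / norm z)" using n by (simp add: power2_eq_square field_simps)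
  also have "\<dots> \<le> norm v * kernel_bound z" by (intro mult_left_mono) (auto simp: kernel_bound_def)
  finally show ?thesis .
qed

text \<open>For the regularized kernel both derivatives can be moved away from \<open>\<theta>\<close>, and the resulting
  approximate identity evaluates \<open>\<theta>\<close> at \<open>y\<close> in the limit. On the other side the logarithm appears
  by dominated convergence.\<close>

lemma fundamental_solution:
  assumes t: "smooth_expr \<theta>" and supp: "\<And>x. R < norm x \<Longrightarrow> \<theta> x = 0"
  shows "(\<integral>x. ln (norm (x - y)) * laplacian \<theta> x \<partial>lborel) = bump_mass * \<theta> y"
proof -
  let ?e = "\<lambda>n. 1 / real (Suc n)"
  have e: "?e n > 0" "?e n \<le> 1" for n by auto
  have e0: "?e \<longlonglongrightarrow> 0" by (rule LIMSEQ_Suc[OF lim_1_over_n])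
  have m: "reg_ln (?e n) \<in> borel_measurable borel" for n
    by (intro borel_measurable_continuous_onI smooth_expr_continuous smooth_expr_reg_ln e)
  have "(\<lambda>n. \<integral>x. reg_ln (?e n) (x - y) * laplacian \<theta> x \<partial>lborel) \<longlonglongrightarrow> (\<integral>x. ln (norm (x - y)) * laplacian \<theta> x \<partial>lborel)"
  proof (rule kernel_tendsto[where A = 1 and R = R and K = "\<lambda>n. reg_ln (?e n)" and L = "\<lambda>z. ln (norm z)"])
    fix z :: complex assume "z \<noteq> 0"
    then have "(\<lambda>n. 1 / 2 * ln ((norm z)\<^sup>2 + (?e n)\<^sup>2)) \<longlonglongrightarrow> 1 / 2 * ln ((norm z)\<^sup>2 + 0\<^sup>2)"
      by (intro tendsto_intros e0) auto
    then show "(\<lambda>n. reg_ln (?e n) z) \<longlonglongrightarrow> ln (norm z)"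
      using \<open>z \<noteq> 0\<close> by (simp add: reg_ln_def ln_realpow)
  next
    fix n and z :: complex assume "z \<noteq> 0"
    then show "\<bar>reg_ln (?e n) z\<bar> \<le> 1 * kernel_bound z" by (rule reg_ln_bound[OF e])
  qed (use t supp in \<open>auto intro!: m smooth_expr_continuous smooth_expr_laplacian laplacian_eq_0_off_support simp del: of_nat_Suc\<close>)
  moreover have "(\<integral>x. reg_ln (?e n) (x - y) * laplacian \<theta> x \<partial>lborel) = (\<integral>x. bump_kernel (?e n) (x - y) * \<theta> x \<partial>lborel)" for n
    using integral_laplacian_swap[OF smooth_expr_translate[OF smooth_expr_reg_ln[OF e(1)]] t supp]
    unfolding laplacian_translate[OF smooth_expr_reg_ln[OF e(1)]] laplacian_reg_ln[OF e(1)] by simp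
  ultimately show ?thesis
    using bump_kernel_tendsto[OF smooth_expr_continuous[OF t] supp, of R y]
    by (auto intro: LIMSEQ_unique simp del: of_nat_Suc)
qed

text \<open>Differentiating the previous identity in \<open>y\<close> would require a differentiation under a singular
  integral. Instead, the regularization is repeated: the Laplacian of a derivative of \<open>reg_ln\<close> is
  the derivative of \<open>bump_kernel\<close>, and this derivative is then moved to \<open>\<theta>\<close>.\<close>

lemma fundamental_solution_dipole:
  assumes t: "smooth_expr \<theta>" and supp: "\<And>x. R < norm x \<Longrightarrow> \<theta> x = 0"
  shows "(\<integral>x. (x - y) \<bullet> v / (norm (x - y))\<^sup>2 * laplacian \<theta> x \<partial>lborel) = - bump_mass * pderiv_dir v \<theta> y"
proof -
  let ?e = "\<lambda>n. 1 / real (Suc n)"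
  have e: "?e n > 0" "?e n \<le> 1" for n by auto
  have e0: "?e \<longlonglongrightarrow> 0" by (rule LIMSEQ_Suc[OF lim_1_over_n])
  have s: "smooth_expr (pderiv_dir v (reg_ln (?e n)))" for n
    by (intro smooth_expr_pderiv_dir smooth_expr_reg_ln e)
  then have m: "pderiv_dir v (reg_ln (?e n)) \<in> borel_measurable borel" for n
    by (intro borel_measurable_continuous_onI smooth_expr_continuous)
  have "(\<lambda>n. \<integral>x. pderiv_dir v (reg_ln (?e n)) (x - y) * laplacian \<theta> x \<partial>lborel)
      \<longlonglongrightarrow> (\<integral>x. (x - y) \<bullet> v / (norm (x - y))\<^sup>2 * laplacian \<theta> x \<partial>lborel)"
  proof (rule kernel_tendsto[where A = "norm v" and R = R and K = "\<lambda>n. pderiv_dir v (reg_ln (?e n))" and L = "\<lambda>z. z \<bullet> v / (norm z)\<^sup>2"])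
    fix z :: complex assume "z \<noteq> 0"
    then have "(\<lambda>n. (Re z * Re v + Im z * Im v) * inverse ((norm z)\<^sup>2 + (?e n)\<^sup>2))
        \<longlonglongrightarrow> (Re z * Re v + Im z * Im v) * inverse ((norm z)\<^sup>2 + 0\<^sup>2)"
      by (intro tendsto_intros e0) auto
    then show "(\<lambda>n. pderiv_dir v (reg_ln (?e n)) z) \<longlonglongrightarrow> z \<bullet> v / (norm z)\<^sup>2"
      unfolding pderiv_reg_ln[OF e(1)] reg_inverse_def cmod_power2[symmetric]
      by (simp add: inner_complex_def divide_inverse del: of_nat_Suc)
  next
    fix n and z :: complex
    show "\<bar>pderiv_dir v (reg_ln (?e n)) z\<bar> \<le> norm v * kernel_bound z"
      unfolding pderiv_reg_ln[OF e(1)] by (rule dipole_bound[OF e(1)])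
  qed (use t supp in \<open>auto intro!: m smooth_expr_continuous smooth_expr_laplacian laplacian_eq_0_off_support simp del: of_nat_Suc\<close>)
  moreover have "(\<integral>x. pderiv_dir v (reg_ln (?e n)) (x - y) * laplacian \<theta> x \<partial>lborel)
      = - (\<integral>x. bump_kernel (?e n) (x - y) * pderiv_dir v \<theta> x \<partial>lborel)" for n
  proof -
    have b: "smooth_expr (\<lambda>x. bump_kernel (?e n) (x - y))"
      by (intro smooth_expr_translate smooth_expr_bump_kernel e)
    have "(\<integral>x. pderiv_dir v (reg_ln (?e n)) (x - y) * laplacian \<theta> x \<partial>lborel)
        = (\<integral>x. pderiv_dir v (bump_kernel (?e n)) (x - y) * \<theta> x \<partial>lborel)"
      using integral_laplacian_swap[OF smooth_expr_translate[OF s] t supp]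
      unfolding laplacian_translate[OF s] laplacian_pderiv_reg_ln[OF e(1)] by simp
    also have "\<dots> = (\<integral>x. pderiv_dir v (\<lambda>x. bump_kernel (?e n) (x - y)) x * \<theta> x \<partial>lborel)"
      by (subst pderiv_dir_translate[OF smooth_expr_bump_kernel[OF e(1)]]) simp
    also have "\<dots> = - (\<integral>x. bump_kernel (?e n) (x - y) * pderiv_dir v \<theta> x \<partial>lborel)"
      using integral_by_parts[where f = "\<lambda>x. bump_kernel (?e n) (x - y)" and g = \<theta> and b = v and R = R] b t supp
      by (simp add: smooth_expr_differentiable smooth_expr_continuous smooth_expr_pderiv_dir del: of_nat_Suc)
    finally show ?thesis .
  qed
  moreover have "(\<lambda>n. - (\<integral>x. bump_kernel (?e n) (x - y) * pderiv_dir v \<theta> x \<partial>lborel)) \<longlonglongrightarrow> - (bump_mass * pderiv_dir v \<theta> y)"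
    using t supp pderiv_dir_eq_0_off_support[of R \<theta>]
    by (intro tendsto_minus bump_kernel_tendsto[where R = R] smooth_expr_continuous smooth_expr_pderiv_dir) auto
  ultimately show ?thesis
    by (auto intro: LIMSEQ_unique simp del: of_nat_Suc)
qed


section \<open>Layer potentials tested against smooth functions\<close>

lemma integrable_restrict_cball_continuous:
  fixes f :: "complex \<Rightarrow> real"
  assumes "continuous_on UNIV f"
  shows "integrable (restrict_space lborel (cball 0 R)) f"
  using borel_integrable_compact[of "cball 0 R" f] continuous_on_subset[OF assms]
  by (simp add: integrable_restrict_space)

lemma continuous_in_L1loc: "continuous_on UNIV f \<Longrightarrow> f \<in> L1loc"
  by (simp add: L1loc_def integrable_restrict_cball_continuous)

lemma continuous_in_L2loc: "continuous_on UNIV f \<Longrightarrow> f \<in> L2loc"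
  by (auto simp: L2loc_def L2_def intro!: integrable_restrict_cball_continuous continuous_intros
      measurable_restrict_space1 borel_measurable_continuous_onI)

lemma continuous_compact_support_in_L2:
  assumes "continuous_on UNIV f" "\<And>x. R < norm x \<Longrightarrow> f x = 0"
  shows "f \<in> L2 lborel"
  using assms
  by (auto simp: L2_def intro!: integrable_continuous_compact_support[where R = R] continuous_intros
      borel_measurable_continuous_onI)

lemma smooth_imp_C1:
  assumes "smooth f" "b \<in> Basis"
  shows "f differentiable at x" "continuous_on UNIV (pderiv_dir b f)"
proof -
  show "f differentiable at x" using assms(1)[unfolded smooth_def, rule_format, of "[]"] by simp
  have "pderiv_dir b f differentiable at x" for x
    using assms(1)[unfolded smooth_def, rule_format, of "[b]"] assms(2) by simp
  then show "continuous_on UNIV (pderiv_dir b f)"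
    by (simp add: continuous_at_imp_continuous_on differentiable_imp_continuous_within)
qed

lemma test_function_support:
  assumes "test_function \<theta>" obtains R where "\<And>x. R < norm x \<Longrightarrow> \<theta> x = 0"
proof -
  have "bounded {x. \<theta> x \<noteq> 0}"
    using assms by (auto simp: test_function_def dest!: compact_imp_bounded intro: bounded_subset closure_subset)
  then show ?thesis using that by (auto simp: bounded_iff) (metis not_le)
qed

lemma smooth_expr_weak_pderiv:
  assumes "smooth_expr w" "b \<in> Basis" shows "weak_pderiv b w (pderiv_dir b w)"
  unfolding weak_pderiv_def
proof (intro conjI allI impI)
  show "w \<in> L1loc" "pderiv_dir b w \<in> L1loc"
    using assms by (auto intro!: continuous_in_L1loc smooth_expr_continuous smooth_expr_pderiv_dir)
  fix \<theta> assume t: "test_function \<theta>"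
  then obtain R where "\<And>x. R < norm x \<Longrightarrow> \<theta> x = 0" by (rule test_function_support) blast
  moreover have "smooth \<theta>" using t by (simp add: test_function_def)
  ultimately show "(LINT x|lborel. w x * pderiv_dir b \<theta> x) = - (LINT x|lborel. pderiv_dir b w x * \<theta> x)"
    using assms smooth_imp_C1[of \<theta> b]
    by (intro integral_by_parts) (auto intro: smooth_expr_differentiable smooth_expr_continuous smooth_expr_pderiv_dir)
qed

abbreviation "grad w \<equiv> (\<lambda>b. pderiv_dir b w)"
abbreviation "hess w \<equiv> (\<lambda>b c. pderiv_dir c (pderiv_dir b w))"

lemma smooth_expr_weak_jet2: "smooth_expr w \<Longrightarrow> weak_jet2 w (grad w) (hess w)"
  by (simp add: weak_jet2_def smooth_expr_weak_pderiv smooth_expr_pderiv_dir)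

lemma smooth_expr_H2loc_jet: "smooth_expr w \<Longrightarrow> H2loc_jet w (grad w) (hess w)"
  by (auto simp: H2loc_jet_def smooth_expr_weak_jet2
      intro!: continuous_in_L2loc smooth_expr_continuous smooth_expr_pderiv_dir)

lemma smooth_expr_H2loc_approx: "smooth_expr w \<Longrightarrow> H2loc_approx (\<lambda>_. w) w (grad w) (hess w)"
  by (auto simp: H2loc_approx_def L2loc_tendsto_def L2_tendsto_def smooth_expr_smooth)

lemma lg_pos: "lg x > 0" and rho_pos: "rho x > 0"
  by (auto simp: lg_def rho_def add_pos_nonneg intro!: ln_gt_zero add_less_le_mono[of 1 2 0, simplified])

lemma continuous_lg: "continuous_on UNIV lg" and continuous_rho: "continuous_on UNIV rho"
  unfolding lg_def[abs_def] rho_def[abs_def]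
  by (intro continuous_intros; simp add: add_pos_nonneg less_imp_neq[THEN not_sym])+

lemma smooth_expr_W2_jet:
  assumes w: "smooth_expr w" and supp: "\<And>x. R < norm x \<Longrightarrow> w x = 0"
  shows "W2_jet w (grad w) (hess w)"
proof -
  have supp': "R < norm x \<Longrightarrow> pderiv_dir b w x = 0" "R < norm x \<Longrightarrow> pderiv_dir c (pderiv_dir b w) x = 0" for b c x
    using pderiv_dir_eq_0_off_support[of R w] pderiv_dir_eq_0_off_support[of R "pderiv_dir b w" _ c] supp by auto
  note c = smooth_expr_continuous[OF w] smooth_expr_continuous[OF smooth_expr_pderiv_dir[OF w]]
    smooth_expr_continuous[OF smooth_expr_pderiv_dir[OF smooth_expr_pderiv_dir[OF w]]]
  show ?thesis
    unfolding W2_jet_def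
    using supp supp' lg_pos rho_pos
    by (intro conjI ballI smooth_expr_weak_jet2 w continuous_compact_support_in_L2[where R = R] continuous_intros
        c continuous_lg continuous_rho)
       (auto simp: less_imp_neq[THEN not_sym])
qed

text \<open>By the Cauchy-Schwarz inequality on a ball containing the support of \<open>\<phi>\<close>.\<close>

lemma L2loc_tendsto_integral:
  assumes [measurable]: "\<And>k. S k \<in> borel_measurable borel" and v: "v \<in> L2loc" and lim: "L2loc_tendsto S v"
    and cont: "continuous_on UNIV \<phi>" and supp: "\<And>x. R < norm x \<Longrightarrow> \<phi> x = 0"
  shows "(\<lambda>k. \<integral>x. S k x * \<phi> x \<partial>lborel) \<longlonglongrightarrow> (\<integral>x. v x * \<phi> x \<partial>lborel)"
    and "integrable lborel (\<lambda>x. v x * \<phi> x)"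
proof -
  let ?B = "cball (0::complex) R"
  let ?I = "indicator ?B :: complex \<Rightarrow> real"
  have [measurable]: "\<phi> \<in> borel_measurable borel" by (rule borel_measurable_continuous_onI[OF cont])
  define v' where "v' x = ?I x * v x" for x
  have vL: "v \<in> borel_measurable (restrict_space lborel ?B)" "integrable (restrict_space lborel ?B) (\<lambda>x. (v x)\<^sup>2)"
    using v by (auto simp: L2loc_def L2_def)
  have [measurable]: "v' \<in> borel_measurable borel"
    using vL(1) by (subst (asm) borel_measurable_restrict_space_iff) (auto simp: v'_def[abs_def] mult.commute)
  have vp: "v x * \<phi> x = v' x * \<phi> x" for x using supp[of x] by (cases "norm x \<le> R") (auto simp: v'_def)
  have int2: "integrable lborel (\<lambda>x. (\<phi> x)\<^sup>2)"
    using cont supp by (intro integrable_continuous_compact_support[where R = R] continuous_intros) auto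
  have "integrable lborel (\<lambda>x. (v' x)\<^sup>2)"
  proof -
    have "integrable lborel (\<lambda>x. ?I x *\<^sub>R (v x)\<^sup>2)"
      using vL(2) by (subst (asm) integrable_restrict_space) auto
    then show ?thesis by (rule Bochner_Integration.integrable_cong[THEN iffD1, rotated 2])
        (auto simp: v'_def power_mult_distrib indicator_def)
  qed
  with int2 have i: "integrable lborel (\<lambda>x. (v' x)\<^sup>2 + (\<phi> x)\<^sup>2)" by simp
  have "integrable lborel (\<lambda>x. v' x * \<phi> x)"
  proof (rule Bochner_Integration.integrable_bound[OF i])
    have "\<bar>a * b\<bar> \<le> a\<^sup>2 + b\<^sup>2" for a b :: real
      using sum_squares_bound[of "\<bar>a\<bar>" "\<bar>b\<bar>", unfolded power2_abs] abs_ge_zero[of "a * b"]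
      unfolding abs_mult by linarith
    then show "AE x in lborel. norm (v' x * \<phi> x) \<le> norm ((v' x)\<^sup>2 + (\<phi> x)\<^sup>2)" by simp
  qed measurable
  then show iv: "integrable lborel (\<lambda>x. v x * \<phi> x)" by (simp add: vp)
  define A where "A k = (\<integral>\<^sup>+x. ennreal ((?I x * S k x - v' x)\<^sup>2) \<partial>lborel)" for k
  have "A k = (\<integral>\<^sup>+x. ennreal ((S k x - v x)\<^sup>2) \<partial>restrict_space lborel ?B)" for k
    unfolding A_def
    by (subst nn_integral_restrict_space) (auto intro!: nn_integral_cong simp: v'_def indicator_def)
  then have "A = (\<lambda>k. \<integral>\<^sup>+x. ennreal ((S k x - v x)\<^sup>2) \<partial>restrict_space lborel ?B)" by (rule ext)
  then have A0: "A \<longlonglongrightarrow> 0" using lim by (simp add: L2loc_tendsto_def L2_tendsto_def)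
  define P where "P = (\<integral>\<^sup>+x. ennreal ((\<phi> x)\<^sup>2) \<partial>lborel)"
  have Pfin: "P < \<infinity>" unfolding P_def using int2 by (simp add: integrable_iff_bounded)
  define C where "C k = (\<integral>\<^sup>+x. ennreal (norm (S k x * \<phi> x - v x * \<phi> x)) \<partial>lborel)" for k
  have CA: "(C k)\<^sup>2 \<le> A k * P" for k
  proof -
    have "C k = (\<integral>\<^sup>+x. ennreal \<bar>?I x * S k x - v' x\<bar> * ennreal \<bar>\<phi> x\<bar> \<partial>lborel)"
      unfolding C_def
    proof (intro nn_integral_cong)
      fix x show "ennreal (norm (S k x * \<phi> x - v x * \<phi> x)) = ennreal \<bar>?I x * S k x - v' x\<bar> * ennreal \<bar>\<phi> x\<bar>"
        using supp[of x] by (cases "norm x \<le> R") (auto simp: v'_def ennreal_mult[symmetric] abs_mult[symmetric] left_diff_distrib)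
    qed
    also have "\<dots>\<^sup>2 \<le> (\<integral>\<^sup>+x. ennreal \<bar>?I x * S k x - v' x\<bar> ^ 2 \<partial>lborel) * (\<integral>\<^sup>+x. ennreal \<bar>\<phi> x\<bar> ^ 2 \<partial>lborel)"
      by (rule Cauchy_Schwarz_nn_integral) measurable
    also have "\<dots> = A k * P" by (simp add: A_def P_def ennreal_power)
    finally show ?thesis .
  qed
  have "(\<lambda>k. (C k)\<^sup>2) \<longlonglongrightarrow> 0"
  proof (rule tendsto_sandwich[OF _ _ tendsto_const])
    show "(\<lambda>k. A k * P) \<longlonglongrightarrow> 0"
      using tendsto_mult_ennreal[OF A0 tendsto_const[of P]] Pfin by auto
  qed (use CA in auto)
  have C0: "C \<longlonglongrightarrow> 0"
  proof (rule order_tendstoI)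
    fix a :: ennreal assume "0 < a"
    then have "eventually (\<lambda>k. (C k)\<^sup>2 < a\<^sup>2) sequentially"
      using order_tendstoD(2)[OF \<open>(\<lambda>k. (C k)\<^sup>2) \<longlonglongrightarrow> 0\<close>, of "a\<^sup>2"] by (simp add: zero_less_iff_neq_zero)
    then show "eventually (\<lambda>k. C k < a) sequentially"
    proof eventually_elim
      case (elim k)
      show "C k < a"
      proof (rule ccontr)
        assume "\<not> C k < a"
        then have "a\<^sup>2 \<le> (C k)\<^sup>2" by (intro power_mono) auto
        with elim show False by (simp add: not_le[symmetric])
      qed
    qed
  qed simp
  have ev: "eventually (\<lambda>k. C k < top) sequentially"
    using order_tendstoD(2)[OF C0, of top] by simp
  have C0': "(\<lambda>k. enn2real (C k)) \<longlonglongrightarrow> 0"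
    by (rule tendsto_enn2real) (simp_all add: C0)
  have vm: "(\<lambda>x. v x * \<phi> x) \<in> borel_measurable borel" using borel_measurable_integrable[OF iv] by simp
  have "eventually (\<lambda>k. norm ((\<integral>x. S k x * \<phi> x \<partial>lborel) - (\<integral>x. v x * \<phi> x \<partial>lborel)) \<le> enn2real (C k)) sequentially"
    using ev
  proof eventually_elim
    case (elim k)
    have id: "integrable lborel (\<lambda>x. S k x * \<phi> x - v x * \<phi> x)"
      using elim vm by (intro integrableI_bounded) (auto simp: C_def)
    then have ig: "integrable lborel (\<lambda>x. S k x * \<phi> x)"
      using Bochner_Integration.integrable_add[OF id iv] by simp
    have "norm ((\<integral>x. S k x * \<phi> x \<partial>lborel) - (\<integral>x. v x * \<phi> x \<partial>lborel))
        = norm (\<integral>x. S k x * \<phi> x - v x * \<phi> x \<partial>lborel)"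
      using ig iv by simp
    also have "\<dots> \<le> (\<integral>x. norm (S k x * \<phi> x - v x * \<phi> x) \<partial>lborel)" by (rule integral_norm_bound)
    also have "\<dots> = enn2real (C k)"
      unfolding C_def using id by (intro integral_eq_nn_integral) (auto simp del: real_norm_def)
    finally show ?case .
  qed
  from Lim_null_comparison[OF this C0'] show "(\<lambda>k. \<integral>x. S k x * \<phi> x \<partial>lborel) \<longlonglongrightarrow> (\<integral>x. v x * \<phi> x \<partial>lborel)"
    by (rule LIM_zero_cancel)
qed

text \<open>All that potential theory needs to know about the curve. The bound \<open>C\<close> on the normal is not one,
  because the outer normal takes an unspecified value at corners and off the curve.\<close>

locale layer_curve =
  fixes g :: "real \<Rightarrow> complex" and \<rho> C :: real
  assumes finite_arclength: "finite_measure (arclength g)"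
    and bounded_curve: "AE y in arclength g. norm y \<le> \<rho>"
    and no_atoms: "emeasure (arclength g) {x} = 0"
    and normal_measurable: "outer_normal (path_image g) \<in> borel_measurable borel"
    and normal_bounded: "norm (outer_normal (path_image g) y) \<le> C"
begin

abbreviation "M \<equiv> arclength g"
abbreviation "\<nu> \<equiv> outer_normal (path_image g)"

sublocale finite_measure M by (rule finite_arclength)
sublocale pair: pair_sigma_finite M lborel ..

lemma sets_M [measurable_cong, simp]: "sets M = sets borel" by (simp add: arclength_def)
lemma space_M [simp]: "space M = UNIV" by (simp add: arclength_def)
lemma measurable_M [simp]: "measurable M N = measurable borel N" by (rule measurable_cong_sets) auto

lemma L2_integrable:
  assumes "q \<in> L2 M" shows "integrable M q" "q \<in> borel_measurable borel"
proof -
  show m: "q \<in> borel_measurable borel" using assms by (simp add: L2_def)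
  have "integrable M (\<lambda>x. 1 + (q x)\<^sup>2)" using assms by (simp add: L2_def)
  then show "integrable M q"
  proof (rule Bochner_Integration.integrable_bound)
    have "\<bar>a\<bar> \<le> 1 + a\<^sup>2" for a :: real
      using sum_squares_bound[of "\<bar>a\<bar>" 1] by simp
    then show "AE x in M. norm (q x) \<le> norm (1 + (q x)\<^sup>2)" by simp
  qed (use m in simp)
qed

text \<open>A potential with a kernel of at most the strength of \<open>kernel_bound\<close> is tested against \<open>\<phi>\<close> by
  testing the kernel first: the inner integrals are bounded uniformly along the curve, and the
  density is integrable.\<close>

lemma kernel_fubini:
  fixes K :: "complex \<Rightarrow> complex \<Rightarrow> real"
  assumes K [measurable]: "(\<lambda>(y, x). K x y) \<in> borel_measurable (borel \<Otimes>\<^sub>M borel)"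
    and bound: "\<And>x y. \<bar>K x y\<bar> \<le> A * kernel_bound (x - y)"
    and q: "q \<in> L2 M" and cont: "continuous_on UNIV \<phi>" and supp: "\<And>x. R < norm x \<Longrightarrow> \<phi> x = 0"
  shows "(\<integral>x. (\<integral>y. K x y * q y \<partial>M) * \<phi> x \<partial>lborel) = (\<integral>y. q y * (\<integral>x. K x y * \<phi> x \<partial>lborel) \<partial>M)"
    and "(\<lambda>x. \<integral>y. K x y * q y \<partial>M) \<in> borel_measurable borel"
proof -
  note q' [measurable] = L2_integrable(2)[OF q] and qi = L2_integrable(1)[OF q]
  have [measurable]: "\<phi> \<in> borel_measurable borel" by (rule borel_measurable_continuous_onI[OF cont])
  obtain c where c: "c > 0" "\<And>x. \<bar>\<phi> x\<bar> \<le> c"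
    using bounded_continuous_compact_support[OF cont supp] by blast
  have A: "A \<ge> 0" using order_trans[OF abs_ge_zero bound[of 1 0]] by (simp add: kernel_bound_def)
  have sets1: "sets (M \<Otimes>\<^sub>M lborel) = sets (borel \<Otimes>\<^sub>M borel)" by (intro sets_pair_measure_cong) auto
  have m [measurable]: "(\<lambda>(y, x). K x y * q y * \<phi> x) \<in> borel_measurable (M \<Otimes>\<^sub>M lborel)"
    unfolding measurable_cong_sets[OF sets1 refl] split_beta'
    using K by (intro borel_measurable_times) (auto simp: split_beta' intro: measurable_compose[OF measurable_fst q'] measurable_compose[OF measurable_snd])
  define J where "J = (\<integral>x. indicator (cball 0 (R + \<rho>)) x * kernel_bound x \<partial>lborel)"
  have le: "\<bar>K x y * \<phi> x\<bar> \<le> A * c * (indicator (cball 0 R) x * kernel_bound (x - y))" for x y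
  proof (cases "norm x \<le> R")
    case True
    have "\<bar>K x y\<bar> * \<bar>\<phi> x\<bar> \<le> (A * kernel_bound (x - y)) * c"
      using bound c A kernel_bound_nonneg by (intro mult_mono) auto
    then show ?thesis using True by (simp add: abs_mult mult_ac)
  qed (use supp A c kernel_bound_nonneg in auto)
  have inner: "integrable lborel (\<lambda>x. K x y * \<phi> x)"
    "(\<integral>x. norm (K x y * \<phi> x) \<partial>lborel) \<le> A * c * J" if y: "norm y \<le> \<rho>" for y
  proof -
    have i: "integrable lborel (\<lambda>x. A * c * (indicator (cball 0 R) x * kernel_bound (x - y)))"
      by (intro integrable_mult_right kernel_bound_translate(1)[OF y])
    have my: "(\<lambda>x. K x y) \<in> borel_measurable borel"
      using measurable_compose[OF measurable_Pair1' K, of y] by simp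
    show 1: "integrable lborel (\<lambda>x. K x y * \<phi> x)"
      by (rule Bochner_Integration.integrable_bound[OF i])
         (use my le A c kernel_bound_nonneg in \<open>auto intro!: borel_measurable_times AE_I2 order_trans[OF le abs_ge_self]\<close>)
    have "(\<integral>x. norm (K x y * \<phi> x) \<partial>lborel) \<le> (\<integral>x. A * c * (indicator (cball 0 R) x * kernel_bound (x - y)) \<partial>lborel)"
      using 1 le by (intro integral_mono i) auto
    also have "\<dots> \<le> A * c * J"
      unfolding J_def using A c kernel_bound_translate(2)[OF y, of R] by (simp add: mult_left_mono)
    finally show "(\<integral>x. norm (K x y * \<phi> x) \<partial>lborel) \<le> A * c * J" .
  qed
  have int: "integrable (M \<Otimes>\<^sub>M lborel) (\<lambda>(y, x). K x y * q y * \<phi> x)"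
  proof (rule pair.Fubini_integrable[OF m])
    have eq: "(\<integral>x. norm (case (y, x) of (y, x) \<Rightarrow> K x y * q y * \<phi> x) \<partial>lborel) = \<bar>q y\<bar> * (\<integral>x. norm (K x y * \<phi> x) \<partial>lborel)" for y
    proof -
      have "norm (case (y, x) of (y, x) \<Rightarrow> K x y * q y * \<phi> x) = \<bar>q y\<bar> * norm (K x y * \<phi> x)" for x
        by (simp add: abs_mult mult_ac)
      then show ?thesis by simp
    qed
    have mi: "(\<lambda>y. \<integral>x. norm (case (y, x) of (y, x) \<Rightarrow> K x y * q y * \<phi> x) \<partial>lborel) \<in> borel_measurable M"
      by (rule lborel.borel_measurable_lebesgue_integral) (use m in \<open>simp add: split_beta'\<close>)
    show "integrable M (\<lambda>y. \<integral>x. norm (case (y, x) of (y, x) \<Rightarrow> K x y * q y * \<phi> x) \<partial>lborel)"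
    proof (rule Bochner_Integration.integrable_bound[OF integrable_mult_right[OF qi, of "A * c * J"] mi])
      show "AE y in M. norm (\<integral>x. norm (case (y, x) of (y, x) \<Rightarrow> K x y * q y * \<phi> x) \<partial>lborel) \<le> norm (A * c * J * q y)"
        using bounded_curve
      proof eventually_elim
        case (elim y)
        have nonneg: "0 \<le> (\<integral>x. norm (K x y * \<phi> x) \<partial>lborel)" by (rule integral_nonneg_AE) simp
        with inner(2)[OF elim] have "\<bar>q y\<bar> * (\<integral>x. norm (K x y * \<phi> x) \<partial>lborel) \<le> \<bar>q y\<bar> * \<bar>A * c * J\<bar>"
          by (intro mult_left_mono) auto
        then show ?case using nonneg unfolding eq by (simp add: abs_mult mult_ac)
      qed
    qed
    show "AE y in M. integrable lborel (\<lambda>x. case (y, x) of (y, x) \<Rightarrow> K x y * q y * \<phi> x)"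
      using bounded_curve
    proof eventually_elim
      case (elim y)
      from integrable_mult_right[OF inner(1)[OF elim], of "q y"] show ?case by (simp add: mult_ac)
    qed
  qed
  have "(\<integral>x. (\<integral>y. K x y * q y * \<phi> x \<partial>M) \<partial>lborel) = (\<integral>y. (\<integral>x. K x y * q y * \<phi> x \<partial>lborel) \<partial>M)"
    using pair.Fubini_integral[OF int] by simp
  then show "(\<integral>x. (\<integral>y. K x y * q y \<partial>M) * \<phi> x \<partial>lborel) = (\<integral>y. q y * (\<integral>x. K x y * \<phi> x \<partial>lborel) \<partial>M)"
    by (simp add: mult_ac flip: integral_mult_right_zero)
  have "(\<lambda>x. \<integral>y. K x y * q y \<partial>M) \<in> borel_measurable (borel :: complex measure)"
  proof (rule borel_measurable_lebesgue_integral)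
    have sets2: "sets (borel \<Otimes>\<^sub>M M) = sets ((borel :: complex measure) \<Otimes>\<^sub>M (borel :: complex measure))" by (intro sets_pair_measure_cong) auto
    have "(\<lambda>p. K (fst p) (snd p)) \<in> borel_measurable ((borel :: complex measure) \<Otimes>\<^sub>M (borel :: complex measure))"
      using measurable_compose[OF measurable_pair_swap' K] by (simp add: split_beta')
    then show "(\<lambda>(x, y). K x y * q y) \<in> borel_measurable ((borel :: complex measure) \<Otimes>\<^sub>M M)"
      unfolding measurable_cong_sets[OF sets2 refl] split_beta'
      by (intro borel_measurable_times measurable_compose[OF measurable_snd q'])
  qed
  then show "(\<lambda>x. \<integral>y. K x y * q y \<partial>M) \<in> borel_measurable borel" .
qed

lemma single_layer_integral:
  assumes q: "q \<in> L2 M" and t: "smooth_expr \<theta>" and supp: "\<And>x. R < norm x \<Longrightarrow> \<theta> x = 0"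
  shows "(\<integral>x. single_layer g q x * laplacian \<theta> x \<partial>lborel) = - (bump_mass / (2 * pi)) * (\<integral>y. q y * \<theta> y \<partial>M)"
    and "single_layer g q \<in> borel_measurable borel"
proof -
  have K: "(\<lambda>(y, x). G (x - y)) \<in> borel_measurable (borel \<Otimes>\<^sub>M borel)"
    unfolding G_def split_beta' by measurable
  have bound: "\<bar>G (x - y)\<bar> \<le> 1 / (2 * pi) * kernel_bound (x - y)" for x y
  proof (cases "x = y")
    case False
    have "\<bar>ln (norm (x - y))\<bar> \<le> kernel_bound (x - y)"
      using False unfolding kernel_bound_def by (intro order_trans[OF abs_ln_norm_le]) auto
    then show ?thesis by (simp add: G_def abs_mult divide_right_mono)
  qed (simp add: G_def kernel_bound_def)
  have s: "single_layer g q = (\<lambda>x. \<integral>y. G (x - y) * q y \<partial>M)" by (simp add: single_layer_def[abs_def])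
  note f = kernel_fubini[OF K bound q smooth_expr_continuous[OF smooth_expr_laplacian[OF t]]
      laplacian_eq_0_off_support[OF supp]]
  show "single_layer g q \<in> borel_measurable borel" unfolding s by (rule f(2)) auto
  have i: "(\<integral>x. G (x - y) * laplacian \<theta> x \<partial>lborel) = - (bump_mass / (2 * pi)) * \<theta> y" for y
  proof -
    have "(\<integral>x. G (x - y) * laplacian \<theta> x \<partial>lborel)
        = - (1 / (2 * pi)) * (\<integral>x. ln (norm (x - y)) * laplacian \<theta> x \<partial>lborel)"
      by (simp only: G_def mult.assoc integral_mult_right_zero)
    then show ?thesis using fundamental_solution[OF t supp, of R y] by simp
  qed
  have "(\<integral>x. single_layer g q x * laplacian \<theta> x \<partial>lborel) = (\<integral>y. q y * (\<integral>x. G (x - y) * laplacian \<theta> x \<partial>lborel) \<partial>M)"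
    unfolding s by (rule f(1)) auto
  also have "\<dots> = (\<integral>y. - (bump_mass / (2 * pi)) * (q y * \<theta> y) \<partial>M)"
    unfolding i by (simp add: mult_ac)
  also have "\<dots> = - (bump_mass / (2 * pi)) * (\<integral>y. q y * \<theta> y \<partial>M)" by (rule integral_mult_right_zero)
  finally show "(\<integral>x. single_layer g q x * laplacian \<theta> x \<partial>lborel) = - (bump_mass / (2 * pi)) * (\<integral>y. q y * \<theta> y \<partial>M)" .
qed

lemma pderiv_dir_G:
  assumes "x \<noteq> y"
  shows "pderiv_dir v (\<lambda>z. G (x - z)) y = 1 / (2 * pi) * ((x - y) \<bullet> v / (norm (x - y))\<^sup>2)"
proof (rule pderiv_dir_eqI)
  have n: "norm (x - y) > 0" using assms by simp
  have "((\<lambda>z. x - z) has_derivative (\<lambda>v. - v)) (at y)" by (auto intro!: derivative_eq_intros)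
  from has_derivative_compose[OF this has_derivative_norm] assms
  have "((\<lambda>z. norm (x - z)) has_derivative (\<lambda>v. - v \<bullet> sgn (x - y))) (at y)" by simp
  then have "((\<lambda>z. - (1 / (2 * pi)) * ln (norm (x - z))) has_derivative
      (\<lambda>v. - (1 / (2 * pi)) * ((- v \<bullet> sgn (x - y)) * inverse (norm (x - y))))) (at y)"
    using n by (intro has_derivative_mult_right has_derivative_ln) auto
  moreover have "- (1 / (2 * pi)) * ((- v \<bullet> sgn z) * inverse (norm z)) = 1 / (2 * pi) * (z \<bullet> v / (norm z)\<^sup>2)"
    for v z :: complex
  proof -
    have "v \<bullet> sgn z = (z \<bullet> v) / norm z" by (simp add: sgn_div_norm inner_commute divide_inverse mult.commute)
    then show ?thesis by (cases "z = 0") (auto simp: power2_eq_square field_simps)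
  qed
  ultimately show "((\<lambda>z. G (x - z)) has_derivative (\<lambda>v. 1 / (2 * pi) * ((x - y) \<bullet> v / (norm (x - y))\<^sup>2))) (at y)"
    by (simp add: G_def[abs_def])
qed

text \<open>At \<open>y = x\<close> the integrand of the double layer potential is an unspecified derivative of a
  function with a pole; since single points carry no arclength, it may be replaced there by the
  value zero of the explicit kernel.\<close>

lemma double_layer_integral:
  assumes p: "p \<in> L2 M" and t: "smooth_expr \<theta>" and supp: "\<And>x. R < norm x \<Longrightarrow> \<theta> x = 0"
  shows "(\<integral>x. double_layer g p x * laplacian \<theta> x \<partial>lborel)
      = - (bump_mass / (2 * pi)) * (\<integral>y. p y * pderiv_dir (\<nu> y) \<theta> y \<partial>M)"
    and "double_layer g p \<in> borel_measurable borel"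
proof -
  note [measurable] = normal_measurable L2_integrable(2)[OF p]
  define K where "K x y = 1 / (2 * pi) * ((x - y) \<bullet> \<nu> y / (norm (x - y))\<^sup>2)" for x y
  have K: "(\<lambda>(y, x). K x y) \<in> borel_measurable (borel \<Otimes>\<^sub>M borel)"
    unfolding K_def split_beta' by measurable
  have bound: "\<bar>K x y\<bar> \<le> C / (2 * pi) * kernel_bound (x - y)" for x y
  proof (cases "x = y")
    case False
    then have n: "norm (x - y) > 0" by simp
    have C: "C \<ge> 0" using normal_bounded order_trans norm_ge_zero by blast
    have "\<bar>(x - y) \<bullet> \<nu> y\<bar> \<le> norm (x - y) * norm (\<nu> y)" by (rule Cauchy_Schwarz_ineq2)
    also have "\<dots> \<le> norm (x - y) * C" using normal_bounded by (intro mult_left_mono) auto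
    finally have "\<bar>(x - y) \<bullet> \<nu> y\<bar> / (norm (x - y))\<^sup>2 \<le> norm (x - y) * C / (norm (x - y))\<^sup>2"
      by (intro divide_right_mono) auto
    also have "\<dots> = C * (1 / norm (x - y))" using n by (simp add: power2_eq_square)
    also have "\<dots> \<le> C * kernel_bound (x - y)"
      using C by (intro mult_left_mono) (auto simp: kernel_bound_def)
    finally have "1 / (2 * pi) * (\<bar>(x - y) \<bullet> \<nu> y\<bar> / (norm (x - y))\<^sup>2) \<le> 1 / (2 * pi) * (C * kernel_bound (x - y))"
      by (intro mult_left_mono) auto
    then show ?thesis by (simp add: K_def abs_mult)
  qed (simp add: K_def kernel_bound_def)
  have s: "double_layer g p = (\<lambda>x. \<integral>y. K x y * p y \<partial>M)"
    unfolding double_layer_def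
  proof
    fix x
    have eq: "pderiv_dir (\<nu> y) (\<lambda>z. G (x - z)) y * p y = K x y * p y" if "y \<noteq> x" for y
      using that pderiv_dir_G[of x y] by (simp add: K_def)
    have m: "(\<lambda>y. K x y * p y) \<in> borel_measurable M"
      unfolding K_def by measurable
    show "(\<integral>y. pderiv_dir (\<nu> y) (\<lambda>z. G (x - z)) y * p y \<partial>M) = (\<integral>y. K x y * p y \<partial>M)"
    proof (rule integral_cong_AE[OF _ m])
      show "(\<lambda>y. pderiv_dir (\<nu> y) (\<lambda>z. G (x - z)) y * p y) \<in> borel_measurable M"
      proof (rule measurable_discrete_difference[OF m, of "{x}"])
        fix y assume "y \<notin> {x}"
        then show "K x y * p y = pderiv_dir (\<nu> y) (\<lambda>z. G (x - z)) y * p y" by (intro eq[symmetric]) simp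
      qed auto
      have "AE y in M. y \<noteq> x"
        using no_atoms[of x] by (intro AE_I[of _ _ "{x}"]) auto
      then show "AE y in M. pderiv_dir (\<nu> y) (\<lambda>z. G (x - z)) y * p y = K x y * p y"
        by eventually_elim (rule eq)
    qed
  qed
  note f = kernel_fubini[OF K bound p smooth_expr_continuous[OF smooth_expr_laplacian[OF t]]
      laplacian_eq_0_off_support[OF supp]]
  show "double_layer g p \<in> borel_measurable borel" unfolding s by (rule f(2)) auto
  have i: "(\<integral>x. K x y * laplacian \<theta> x \<partial>lborel) = - (bump_mass / (2 * pi)) * pderiv_dir (\<nu> y) \<theta> y" for y
  proof -
    have "(\<integral>x. K x y * laplacian \<theta> x \<partial>lborel)
        = 1 / (2 * pi) * (\<integral>x. (x - y) \<bullet> \<nu> y / (norm (x - y))\<^sup>2 * laplacian \<theta> x \<partial>lborel)"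
      by (simp only: K_def mult.assoc integral_mult_right_zero)
    then show ?thesis using fundamental_solution_dipole[OF t supp, of R y "\<nu> y"] by simp
  qed
  have "(\<integral>x. double_layer g p x * laplacian \<theta> x \<partial>lborel) = (\<integral>y. p y * (\<integral>x. K x y * laplacian \<theta> x \<partial>lborel) \<partial>M)"
    unfolding s by (rule f(1)) auto
  also have "\<dots> = (\<integral>y. - (bump_mass / (2 * pi)) * (p y * pderiv_dir (\<nu> y) \<theta> y) \<partial>M)"
    unfolding i by (simp add: mult_ac)
  also have "\<dots> = - (bump_mass / (2 * pi)) * (\<integral>y. p y * pderiv_dir (\<nu> y) \<theta> y \<partial>M)" by (rule integral_mult_right_zero)
  finally show "(\<integral>x. double_layer g p x * laplacian \<theta> x \<partial>lborel)
      = - (bump_mass / (2 * pi)) * (\<integral>y. p y * pderiv_dir (\<nu> y) \<theta> y \<partial>M)" .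
qed

lemma normal_derivative_trace:
  assumes w: "smooth_expr w" and supp: "\<And>x. R < norm x \<Longrightarrow> w x = 0"
  shows "(\<lambda>y. pderiv_dir (\<nu> y) w y) \<in> borel_measurable borel"
    and "neumann_trace g w (\<lambda>y. pderiv_dir (\<nu> y) w y)"
proof -
  note [measurable] = normal_measurable
  have d [measurable]: "pderiv_dir b w \<in> borel_measurable borel" for b
    by (intro borel_measurable_continuous_onI smooth_expr_continuous smooth_expr_pderiv_dir w)
  have eq: "pderiv_dir (\<nu> y) w y = Re (\<nu> y) * pderiv_dir 1 w y + Im (\<nu> y) * pderiv_dir \<i> w y" for y
    by (rule pderiv_dir_decompose[OF smooth_expr_differentiable[OF w]])
  show m [measurable]: "(\<lambda>y. pderiv_dir (\<nu> y) w y) \<in> borel_measurable borel"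
    unfolding eq by measurable
  have bnd: "\<exists>c. \<forall>y. \<bar>pderiv_dir b w y\<bar> \<le> c" for b
    using bounded_continuous_compact_support[of "pderiv_dir b w" R] pderiv_dir_eq_0_off_support[of R w _ b] supp
      smooth_expr_continuous[OF smooth_expr_pderiv_dir[OF w]] by metis
  obtain c1 c2 where c: "\<And>y. \<bar>pderiv_dir 1 w y\<bar> \<le> c1" "\<And>y. \<bar>pderiv_dir \<i> w y\<bar> \<le> c2" using bnd by metis
  have C: "C \<ge> 0" using normal_bounded order_trans norm_ge_zero by blast
  have le: "\<bar>pderiv_dir (\<nu> y) w y\<bar> \<le> C * c1 + C * c2" for y
  proof -
    have "\<bar>Re (\<nu> y)\<bar> \<le> C" "\<bar>Im (\<nu> y)\<bar> \<le> C"
      using abs_Re_le_cmod[of "\<nu> y"] abs_Im_le_cmod[of "\<nu> y"] normal_bounded[of y] by linarith+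
    then have "\<bar>Re (\<nu> y)\<bar> * \<bar>pderiv_dir 1 w y\<bar> + \<bar>Im (\<nu> y)\<bar> * \<bar>pderiv_dir \<i> w y\<bar> \<le> C * c1 + C * c2"
      using c C by (intro add_mono mult_mono) auto
    then show ?thesis unfolding eq abs_mult[symmetric] by (rule order_trans[OF abs_triangle_ineq])
  qed
  have "integrable M (\<lambda>y. (pderiv_dir (\<nu> y) w y)\<^sup>2)"
  proof (rule integrable_const_bound)
    show "AE y in M. norm ((pderiv_dir (\<nu> y) w y)\<^sup>2) \<le> (C * c1 + C * c2)\<^sup>2"
      using power_mono[OF le abs_ge_zero, of _ 2] by simp
  qed (simp add: m)
  then show "neumann_trace g w (\<lambda>y. pderiv_dir (\<nu> y) w y)"
    unfolding neumann_trace_def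
    using smooth_expr_H2loc_jet[OF w] smooth_expr_H2loc_approx[OF w]
    by (intro conjI exI[of _ "grad w"] exI[of _ "hess w"] exI[of _ "\<lambda>_. w"]) (auto simp: L2_def L2_tendsto_def m)
qed

text \<open>The trace norm is an infimum over extensions, so any single extension of norm at most one gives
  a lower bound of the dual norm. The extension \<open>w\<close> can be chosen for the trace at hand, which is
  the freedom exploited at the corner.\<close>

lemma dual_norm_ge:
  assumes "W2_jet w D H" "T w f" "W2_norm w D H \<le> 1"
  shows "ennreal \<bar>q f\<bar> \<le> dual_norm T q"
proof -
  have nonneg: "W2_norm u D H \<ge> 0" for u D H
    unfolding W2_norm_def by (intro real_sqrt_ge_zero add_nonneg_nonneg sum_nonneg integral_nonneg_AE AE_I2) auto
  have "trace_norm T f \<le> W2_norm w D H"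
    unfolding trace_norm_def using assms nonneg by (intro cInf_lower bdd_belowI[of _ 0]) auto
  then show ?thesis
    unfolding dual_norm_def using assms by (intro SUP_upper) (auto simp: trace_space_def)
qed

text \<open>The necessary condition for being a sum of two layer potentials. Pairing with the Laplacian of
  \<open>\<theta>\<close> sees only the two traces of \<open>\<theta>\<close>, and it sees them separately: the Dirichlet trace vanishes,
  and the Neumann trace is measured by the norm of an extension \<open>\<psi>\<close> that need not have anything
  else in common with \<open>\<theta>\<close>.\<close>

lemma representable_pairing_bounded:
  assumes p: "p \<in> H_minus_1_2 g" and v: "single_layer_ext g q v" and w: "double_layer_ext g p w"
    and u: "AE x in lborel. u x = v x + w x"
  shows "\<exists>B. \<forall>\<theta> \<psi> R. smooth_expr \<theta> \<longrightarrow> smooth_expr \<psi> \<longrightarrow>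
    (\<forall>x. R < norm x \<longrightarrow> \<theta> x = 0 \<and> \<psi> x = 0) \<longrightarrow> W2_norm \<psi> (grad \<psi>) (hess \<psi>) \<le> 1 \<longrightarrow>
    (AE y in M. \<theta> y = 0 \<and> pderiv_dir (\<nu> y) \<theta> y = pderiv_dir (\<nu> y) \<psi> y) \<longrightarrow>
    \<bar>\<integral>x. u x * laplacian \<theta> x \<partial>lborel\<bar> \<le> B"
proof -
  let ?T = "neumann_trace g"
  have pf: "dual_norm ?T p < \<infinity>" using p by (simp add: H_minus_1_2_def trace_dual_def)
  obtain qs where qs: "\<And>k. qs k \<in> L2 M" "L2loc_tendsto (\<lambda>k. single_layer g (qs k)) v" and vL: "v \<in> L2loc"
    using v by (auto simp: single_layer_ext_def)
  obtain ps where ps: "\<And>k. ps k \<in> H_1_2 g" "dual_tendsto ?T (\<lambda>k. pivot g (ps k)) p"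
    "L2loc_tendsto (\<lambda>k. double_layer g (ps k)) w" and wL: "w \<in> L2loc"
    using w by (auto simp: double_layer_ext_def)
  have psL: "ps k \<in> L2 M" for k using ps(1)[of k] by (simp add: H_1_2_def)
  define c where "c = bump_mass / (2 * pi)"
  show ?thesis
  proof (intro exI[of _ "\<bar>c\<bar> * enn2real (dual_norm ?T p)"] allI impI)
    fix \<theta> \<psi> R
    assume t: "smooth_expr \<theta>" and psi: "smooth_expr \<psi>"
      and s: "\<forall>x. R < norm x \<longrightarrow> \<theta> x = 0 \<and> \<psi> x = 0"
      and n1: "W2_norm \<psi> (grad \<psi>) (hess \<psi>) \<le> 1"
      and ae: "AE y in M. \<theta> y = 0 \<and> pderiv_dir (\<nu> y) \<theta> y = pderiv_dir (\<nu> y) \<psi> y"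
    have supp: "R < norm x \<Longrightarrow> \<theta> x = 0" "R < norm x \<Longrightarrow> \<psi> x = 0" for x using s by auto
    note lc = smooth_expr_continuous[OF smooth_expr_laplacian[OF t]]
    have supp': "R < norm x \<Longrightarrow> laplacian \<theta> x = 0" for x using laplacian_eq_0_off_support[of R \<theta>] supp by auto
    let ?f = "\<lambda>y. pderiv_dir (\<nu> y) \<psi> y"
    have tr: "?f \<in> borel_measurable borel" "neumann_trace g \<psi> ?f" "(\<lambda>y. pderiv_dir (\<nu> y) \<theta> y) \<in> borel_measurable borel"
      by (rule normal_derivative_trace[OF psi supp(2)] normal_derivative_trace(1)[OF t supp(1)]; assumption)+
    have jet: "W2_jet \<psi> (grad \<psi>) (hess \<psi>)" by (rule smooth_expr_W2_jet[OF psi supp(2)])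
    have ms: "single_layer g (qs k) \<in> borel_measurable borel" and md: "double_layer g (ps k) \<in> borel_measurable borel" for k
      by (rule single_layer_integral(2)[OF qs(1) t supp(1)] double_layer_integral(2)[OF psL t supp(1)]; assumption)+
    have lv: "(\<lambda>k. \<integral>x. single_layer g (qs k) x * laplacian \<theta> x \<partial>lborel) \<longlonglongrightarrow> (\<integral>x. v x * laplacian \<theta> x \<partial>lborel)"
      and lw: "(\<lambda>k. \<integral>x. double_layer g (ps k) x * laplacian \<theta> x \<partial>lborel) \<longlonglongrightarrow> (\<integral>x. w x * laplacian \<theta> x \<partial>lborel)"
      and iv: "integrable lborel (\<lambda>x. v x * laplacian \<theta> x)" "integrable lborel (\<lambda>x. w x * laplacian \<theta> x)"
      by (rule L2loc_tendsto_integral[OF ms vL qs(2) lc supp'] L2loc_tendsto_integral[OF md wL ps(3) lc supp']; assumption)+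
    have "(\<integral>x. single_layer g (qs k) x * laplacian \<theta> x \<partial>lborel) = 0" for k
    proof -
      have "(\<integral>y. qs k y * \<theta> y \<partial>M) = (\<integral>y. 0 \<partial>M)"
      proof (rule integral_cong_AE)
        show "AE y in M. qs k y * \<theta> y = 0" using ae by eventually_elim simp
      qed (use L2_integrable(2)[OF qs(1)[of k]] borel_measurable_continuous_onI[OF smooth_expr_continuous[OF t]]
          in \<open>auto intro!: borel_measurable_times\<close>)
      then show ?thesis by (subst single_layer_integral(1)[OF qs(1) t supp(1)]) simp_all
    qed
    with lv
    have v0: "(\<integral>x. v x * laplacian \<theta> x \<partial>lborel) = 0" by (simp add: LIMSEQ_const_iff)
    have "(\<integral>x. double_layer g (ps k) x * laplacian \<theta> x \<partial>lborel) = - c * pivot g (ps k) ?f" for k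
    proof -
      have "(\<integral>y. ps k y * pderiv_dir (\<nu> y) \<theta> y \<partial>M) = (\<integral>y. ps k y * ?f y \<partial>M)"
      proof (rule integral_cong_AE)
        show "AE y in M. ps k y * pderiv_dir (\<nu> y) \<theta> y = ps k y * ?f y" using ae by eventually_elim simp
      qed (use L2_integrable(2)[OF psL[of k]] tr in \<open>auto intro!: borel_measurable_times\<close>)
      then show ?thesis by (subst double_layer_integral(1)[OF psL t supp(1)]) (simp_all add: c_def pivot_def)
    qed
    with lw
    have w1: "(\<lambda>k. - c * pivot g (ps k) ?f) \<longlonglongrightarrow> (\<integral>x. w x * laplacian \<theta> x \<partial>lborel)" by simp
    have "(\<lambda>k. pivot g (ps k) ?f) \<longlonglongrightarrow> p ?f"
    proof (rule LIM_zero_cancel, rule tendsto_norm_zero_cancel)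
      have "(\<lambda>k. ennreal \<bar>pivot g (ps k) ?f - p ?f\<bar>) \<longlonglongrightarrow> 0"
      proof (rule tendsto_sandwich[OF _ _ tendsto_const])
        show "(\<lambda>k. dual_norm ?T (\<lambda>f. pivot g (ps k) f - p f)) \<longlonglongrightarrow> 0"
          using ps(2) by (simp add: dual_tendsto_def)
        show "eventually (\<lambda>k. ennreal \<bar>pivot g (ps k) ?f - p ?f\<bar> \<le> dual_norm ?T (\<lambda>f. pivot g (ps k) f - p f)) sequentially"
          by (intro always_eventually allI) (rule dual_norm_ge[where T = ?T and f = ?f, OF jet tr(2) n1])
      qed simp
      then show "(\<lambda>k. norm (pivot g (ps k) ?f - p ?f)) \<longlonglongrightarrow> 0"
        by (simp add: ennreal_tendsto_0_iff)
    qed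
    then have "(\<lambda>k. - c * pivot g (ps k) ?f) \<longlonglongrightarrow> - c * p ?f" by (intro tendsto_intros)
    with w1 have w2: "(\<integral>x. w x * laplacian \<theta> x \<partial>lborel) = - c * p ?f" by (rule LIMSEQ_unique)
    have "(\<integral>x. u x * laplacian \<theta> x \<partial>lborel) = - c * p ?f \<or> (\<integral>x. u x * laplacian \<theta> x \<partial>lborel) = 0"
    proof (cases "(\<lambda>x. u x * laplacian \<theta> x) \<in> borel_measurable lborel")
      case True
      have "(\<integral>x. u x * laplacian \<theta> x \<partial>lborel) = (\<integral>x. v x * laplacian \<theta> x + w x * laplacian \<theta> x \<partial>lborel)"
        using u borel_measurable_integrable[OF iv(1)] borel_measurable_integrable[OF iv(2)]
        by (intro integral_cong_AE[OF True]) (auto elim!: eventually_mono simp: distrib_right)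
      then show ?thesis using iv by (simp add: v0 w2)
    next
      case False
      then have "\<not> integrable lborel (\<lambda>x. u x * laplacian \<theta> x)" by (auto dest: borel_measurable_integrable)
      then show ?thesis by (simp add: not_integrable_integral_eq)
    qed
    moreover have "\<bar>p ?f\<bar> \<le> enn2real (dual_norm ?T p)"
      using dual_norm_ge[where T = ?T and f = ?f and q = p, OF jet tr(2) n1] pf
      by (metis abs_ge_zero enn2real_ennreal enn2real_mono infinity_ennreal_def)
    ultimately show "\<bar>\<integral>x. u x * laplacian \<theta> x \<partial>lborel\<bar> \<le> \<bar>c\<bar> * enn2real (dual_norm ?T p)"
      by (auto simp: abs_mult intro!: mult_left_mono)
  qed
qed

end


section \<open>Piecewise affine Jordan curves and their normals\<close>

text \<open>One-sided affinity at every parameter. In contrast to an explicit subdivision, this property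
  passes to joined paths by rescaling alone; the finite set of break points is recovered by
  compactness.\<close>

definition piecewise_affine :: "(real \<Rightarrow> complex) \<Rightarrow> bool" where
  "piecewise_affine g \<longleftrightarrow> (\<forall>t\<in>{0..1}. \<exists>e>0. \<exists>a b. \<forall>s\<in>{0..1}. \<bar>s - t\<bar> < e \<longrightarrow>
     g s = g t + (s - t) *\<^sub>R (if s < t then a else b))"

lemma piecewise_affineE:
  assumes "piecewise_affine g" "t \<in> {0..1}"
  obtains e a b where "e > 0" "\<And>s. s \<in> {0..1} \<Longrightarrow> \<bar>s - t\<bar> < e \<Longrightarrow> g s = g t + (s - t) *\<^sub>R (if s < t then a else b)"
  using assms unfolding piecewise_affine_def by metis

lemma piecewise_affine_linepath: "piecewise_affine (linepath a b)"
  unfolding piecewise_affine_def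
  by (intro ballI exI[of _ 1] conjI exI[of _ "b - a"]) (auto simp: linepath_def algebra_simps)

lemma piecewise_affine_const: "piecewise_affine (\<lambda>_. a)"
  unfolding piecewise_affine_def
  by (intro ballI exI[of _ "1::real"] conjI exI[of _ "0::complex"]) auto

lemma affine_atI:
  assumes "e > 0"
    and "\<And>s. s \<in> {0..1} \<Longrightarrow> \<bar>s - t\<bar> < e \<Longrightarrow> g s = g t + (s - t) *\<^sub>R (if s < t then a else b)"
  shows "\<exists>e>0. \<exists>a b. \<forall>s\<in>{0..1}. \<bar>s - t\<bar> < e \<longrightarrow> g s = g t + (s - t) *\<^sub>R (if s < t then a else b)"
  using assms by blast

lemma piecewise_affine_join:
  assumes p: "piecewise_affine p" and q: "piecewise_affine q" and pq: "pathfinish p = pathstart q"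
  shows "piecewise_affine (p +++ q)"
  unfolding piecewise_affine_def
proof
  fix t :: real assume t: "t \<in> {0..1}"
  consider "t < 1 / 2" | "t > 1 / 2" | "t = 1 / 2" by linarith
  then show "\<exists>e>0. \<exists>a b. \<forall>s\<in>{0..1}. \<bar>s - t\<bar> < e \<longrightarrow>
     (p +++ q) s = (p +++ q) t + (s - t) *\<^sub>R (if s < t then a else b)"
  proof cases
    case 1
    have "2 * t \<in> {0..1}" using t 1 by auto
    from piecewise_affineE[OF p this] obtain e a b where
      e: "e > 0" "\<And>s. s \<in> {0..1} \<Longrightarrow> \<bar>s - 2 * t\<bar> < e \<Longrightarrow> p s = p (2 * t) + (s - 2 * t) *\<^sub>R (if s < 2 * t then a else b)"
      by metis
    show ?thesis
    proof (rule affine_atI[where e = "min (e / 2) (1 / 2 - t)" and a = "2 *\<^sub>R a" and b = "2 *\<^sub>R b"])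
      fix s assume s: "s \<in> {0..1}" "\<bar>s - t\<bar> < min (e / 2) (1 / 2 - t)"
      then have "2 * s \<in> {0..1}" "\<bar>2 * s - 2 * t\<bar> < e" "s \<le> 1 / 2"
        unfolding abs_less_iff by auto
      from e(2)[OF this(1,2)] this(3) 1
      show "(p +++ q) s = (p +++ q) t + (s - t) *\<^sub>R (if s < t then 2 *\<^sub>R a else 2 *\<^sub>R b)"
        by (auto simp: joinpaths_def algebra_simps)
    qed (use e 1 in auto)
  next
    case 2
    have "2 * t - 1 \<in> {0..1}" using t 2 by auto
    from piecewise_affineE[OF q this] obtain e a b where
      e: "e > 0" "\<And>s. s \<in> {0..1} \<Longrightarrow> \<bar>s - (2 * t - 1)\<bar> < e \<Longrightarrow> q s = q (2 * t - 1) + (s - (2 * t - 1)) *\<^sub>R (if s < 2 * t - 1 then a else b)"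
      by metis
    show ?thesis
    proof (rule affine_atI[where e = "min (e / 2) (t - 1 / 2)" and a = "2 *\<^sub>R a" and b = "2 *\<^sub>R b"])
      fix s assume s: "s \<in> {0..1}" "\<bar>s - t\<bar> < min (e / 2) (t - 1 / 2)"
      then have "2 * s - 1 \<in> {0..1}" "\<bar>2 * s - 1 - (2 * t - 1)\<bar> < e" "\<not> s \<le> 1 / 2"
        unfolding abs_less_iff by auto
      from e(2)[OF this(1,2)] this(3) 2
      show "(p +++ q) s = (p +++ q) t + (s - t) *\<^sub>R (if s < t then 2 *\<^sub>R a else 2 *\<^sub>R b)"
        by (auto simp: joinpaths_def algebra_simps)
    qed (use e 2 in auto)
  next
    case 3
    obtain e1 a1 b1 where
      e1: "e1 > 0" "\<And>s. s \<in> {0..1} \<Longrightarrow> \<bar>s - 1\<bar> < e1 \<Longrightarrow> p s = p 1 + (s - 1) *\<^sub>R (if s < 1 then a1 else b1)"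
      using piecewise_affineE[OF p, of 1] by auto
    obtain e2 a2 b2 where
      e2: "e2 > 0" "\<And>s. s \<in> {0..1} \<Longrightarrow> \<bar>s - 0\<bar> < e2 \<Longrightarrow> q s = q 0 + (s - 0) *\<^sub>R (if s < 0 then a2 else b2)"
      using piecewise_affineE[OF q, of 0] by auto
    have m: "p 1 = q 0" using pq by (simp add: pathfinish_def pathstart_def)
    show ?thesis
    proof (rule affine_atI[where e = "min (e1 / 2) (e2 / 2)" and a = "2 *\<^sub>R a1" and b = "2 *\<^sub>R b2"])
      fix s assume s: "s \<in> {0..1}" "\<bar>s - t\<bar> < min (e1 / 2) (e2 / 2)"
      show "(p +++ q) s = (p +++ q) t + (s - t) *\<^sub>R (if s < t then 2 *\<^sub>R a1 else 2 *\<^sub>R b2)"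
      proof (cases "s < 1 / 2")
        case True
        then have "2 * s \<in> {0..1}" "\<bar>2 * s - 1\<bar> < e1" using s 3 unfolding abs_less_iff by auto
        from e1(2)[OF this] True 3 show ?thesis by (auto simp: joinpaths_def algebra_simps)
      next
        case False
        then have "2 * s - 1 \<in> {0..1}" "\<bar>2 * s - 1 - 0\<bar> < e2" using s 3 unfolding abs_less_iff by auto
        from e2(2)[OF this] False 3 m show ?thesis by (auto simp: joinpaths_def algebra_simps)
      qed
    qed (use e1 e2 in auto)
  qed
qed

lemma polygonal_path_pathstart: "pathstart (polygonal_path (a # xs)) = a"
  by (induction "a # xs" arbitrary: a xs rule: polygonal_path.induct) auto

lemma polygonal_path_pathfinish: "pathfinish (polygonal_path (a # xs)) = last (a # xs)"
  by (induction "a # xs" arbitrary: a xs rule: polygonal_path.induct) auto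

lemma piecewise_affine_polygonal_path: "piecewise_affine (polygonal_path vs)"
  by (induction vs rule: polygonal_path.induct)
     (auto intro!: piecewise_affine_linepath piecewise_affine_const piecewise_affine_join simp: polygonal_path_pathstart)

lemma inner_unit_rotate:
  "z \<bullet> d = Re (z * cnj d)" "z \<bullet> (\<i> * d) = Im (z * cnj d)"
  by (auto simp: inner_complex_def algebra_simps)

lemma unit_decompose:
  assumes "norm d = 1" shows "z = d * (z * cnj d)"
proof -
  have "d * cnj d = 1" using assms by (simp add: complex_norm_square[symmetric])
  then show ?thesis by (simp add: mult.left_commute)
qed

lemma unit_perp_cases:
  assumes "norm d = 1" "norm n = 1" "d \<bullet> n = 0" shows "n = \<i> * d \<or> n = - (\<i> * d)"
proof -
  define w where "w = n * cnj d"
  have "Re w = 0" using assms(3) unfolding w_def inner_unit_rotate(1)[symmetric] by (simp only: inner_commute)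
  moreover have "norm w = 1" using assms by (simp add: w_def norm_mult)
  ultimately have "w = \<i> \<or> w = - \<i>" by (auto simp: complex_eq_iff cmod_def)
  moreover have "n = d * w" using unit_decompose[OF assms(1), of n] by (simp add: w_def)
  ultimately show ?thesis by (auto simp: mult.commute)
qed

locale polygon_curve =
  fixes g :: "real \<Rightarrow> complex"
  assumes affine: "piecewise_affine g" and simple: "simple_path g" and closed: "pathfinish g = pathstart g"
begin

abbreviation "\<Gamma> \<equiv> path_image g"

lemma g01: "g 0 = g 1" using closed by (simp add: pathfinish_def pathstart_def)

lemma g_inj: "s \<in> {0..1} \<Longrightarrow> t \<in> {0<..<1} \<Longrightarrow> g s = g t \<Longrightarrow> s = t"
  using simple by (fastforce simp: simple_path_def loop_free_def)

lemma continuous_g: "continuous_on {0..1} g"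
  using simple_path_imp_path[OF simple] by (simp add: path_def)

lemma compact_curve: "compact \<Gamma>" using simple_path_imp_path[OF simple] by (rule compact_path_image)

lemma Jordan:
  "open (inside \<Gamma>)" "open (outside \<Gamma>)" "frontier (inside \<Gamma>) = \<Gamma>" "frontier (outside \<Gamma>) = \<Gamma>"
  "inside \<Gamma> \<inter> outside \<Gamma> = {}" "inside \<Gamma> \<union> outside \<Gamma> = - \<Gamma>"
  using Jordan_inside_outside[OF simple closed] by auto

lemma finite_preimage: "finite {t \<in> {0..1}. g t = x}"
proof (cases "\<exists>t\<in>{0<..<1}. g t = x")
  case True
  then obtain t where t: "t \<in> {0<..<1}" "g t = x" by blast
  have "{t \<in> {0..1}. g t = x} \<subseteq> {t}" using g_inj[OF _ t(1)] t(2) by auto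
  then show ?thesis by (rule finite_subset) simp
next
  case False
  have "{t \<in> {0..1}. g t = x} \<subseteq> {0, 1}"
  proof
    fix t assume "t \<in> {t \<in> {0..1}. g t = x}"
    then have "t \<in> {0..1}" "t \<notin> {0<..<1}" using False by auto
    then show "t \<in> {0, 1}" by auto
  qed
  then show ?thesis by (rule finite_subset) simp
qed

definition locally_affine :: "complex set \<Rightarrow> real \<Rightarrow> bool" where
  "locally_affine B t \<longleftrightarrow> (\<exists>e>0. \<exists>b\<in>B. \<forall>s. \<bar>s - t\<bar> < e \<longrightarrow> s \<in> {0..1} \<and> g s = g t + (s - t) *\<^sub>R b)"

text \<open>Around each parameter there is an interval on which the curve is affine on either side. Finitely
  many of these intervals cover the parameter range, and every other parameter lies on one side of
  a centre.\<close>

lemma finite_breaks: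
  "\<exists>S B. finite S \<and> finite B \<and> {0, 1} \<subseteq> S \<and> (\<forall>t\<in>{0..1} - S. locally_affine B t)"
proof -
  have "\<forall>t\<in>{0..1}. \<exists>e a b. e > 0 \<and> (\<forall>s\<in>{0..1}. \<bar>s - t\<bar> < e \<longrightarrow> g s = g t + (s - t) *\<^sub>R (if s < t then a else b))"
    using affine unfolding piecewise_affine_def by blast
  then obtain e a b where e: "\<And>t. t \<in> {0..1} \<Longrightarrow> e t > 0"
    and g: "\<And>s t. t \<in> {0..1} \<Longrightarrow> s \<in> {0..1} \<Longrightarrow> \<bar>s - t\<bar> < e t \<Longrightarrow> g s = g t + (s - t) *\<^sub>R (if s < t then a t else b t)"
    by metis
  have "{0..1} \<subseteq> (\<Union>t\<in>{0..1}. ball t (e t))" using e by force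
  then obtain T where T: "T \<subseteq> {0..1}" "finite T" "{0..1} \<subseteq> (\<Union>t\<in>T. ball t (e t))"
    by (rule compactE_image[OF compact_Icc, rotated]) auto
  have "locally_affine (a ` T \<union> b ` T) t" if t: "t \<in> {0..1} - (T \<union> {0, 1})" for t
  proof -
    obtain r where r: "r \<in> T" "\<bar>t - r\<bar> < e r" using T(3) t by (auto simp: dist_real_def abs_minus_commute)
    then have r01: "r \<in> {0..1}" and tr: "t \<noteq> r" using T t by auto
    define c where "c = (if t < r then a r else b r)"
    define h where "h = min (min \<bar>t - r\<bar> (e r - \<bar>t - r\<bar>)) (min t (1 - t))"
    have h: "h > 0" using r tr t by (auto simp: h_def)
    have gt: "g t = g r + (t - r) *\<^sub>R c" using g[OF r01 _ r(2)] t by (simp add: c_def)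
    show ?thesis unfolding locally_affine_def
    proof (intro exI[of _ h] conjI bexI[of _ c] allI impI h)
      fix s assume s: "\<bar>s - t\<bar> < h"
      then show s01: "s \<in> {0..1}" by (auto simp: h_def)
      have "\<bar>s - r\<bar> < e r" "s < r \<longleftrightarrow> t < r" using s by (auto simp: h_def)
      then have "g s = g r + (s - r) *\<^sub>R c" using g[OF r01 s01] by (simp add: c_def)
      then show "g s = g t + (s - t) *\<^sub>R c" by (simp add: gt algebra_simps)
    qed (use r in \<open>auto simp: c_def\<close>)
  qed
  then show ?thesis using T(2) by (intro exI[of _ "T \<union> {0, 1}"] exI[of _ "a ` T \<union> b ` T"]) auto
qed

text \<open>By injectivity, the part of the curve with parameters away from \<open>t\<close> is a compact set that misses
  \<open>g t\<close>; near \<open>g t\<close> only the affine piece through it remains.\<close>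

lemma locally_affine_line:
  assumes t: "locally_affine B t"
  shows "\<exists>e>0. \<exists>d. norm d = 1 \<and> \<Gamma> \<inter> ball (g t) e = {g t + s *\<^sub>R d | s. \<bar>s\<bar> < e}"
proof -
  obtain e b where e: "e > 0" "\<And>s. \<bar>s - t\<bar> < e \<Longrightarrow> s \<in> {0..1} \<and> g s = g t + (s - t) *\<^sub>R b"
    using t unfolding locally_affine_def by blast
  have "t - e / 2 \<in> {0..1}" "t + e / 2 \<in> {0..1}"
    using e(1) e(2)[of "t - e / 2"] e(2)[of "t + e / 2"] by auto
  then have t01: "t \<in> {0<..<1}" using e(1) by auto
  have b: "b \<noteq> 0"
  proof
    assume "b = 0"
    then have "g (t + e / 2) = g t" using e(1) e(2)[of "t + e / 2"] by simp
    then show False using g_inj[OF _ t01, of "t + e / 2"] \<open>t + e / 2 \<in> {0..1}\<close> e(1) by auto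
  qed
  define K where "K = g ` ({0..1} - ball t e)"
  have "compact K" unfolding K_def
    by (intro compact_continuous_image continuous_on_subset[OF continuous_g] compact_diff) auto
  moreover have "g t \<notin> K" unfolding K_def using g_inj[OF _ t01] e(1) by force
  ultimately obtain \<delta> where \<delta>: "\<delta> > 0" "\<forall>x\<in>K. \<delta> \<le> dist (g t) x"
    using separate_point_closed[of K "g t"] compact_imp_closed by blast
  define r where "r = min \<delta> (e * norm b)"
  define d where "d = (1 / norm b) *\<^sub>R b"
  have d: "norm d = 1" "b = norm b *\<^sub>R d" using b by (auto simp: d_def)
  have r: "r > 0" using \<delta>(1) e(1) b by (simp add: r_def)
  have "\<Gamma> \<inter> ball (g t) r = {g t + s *\<^sub>R d | s. \<bar>s\<bar> < r}"
  proof (intro equalityI subsetI)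
    fix x assume "x \<in> \<Gamma> \<inter> ball (g t) r"
    then obtain s where s: "s \<in> {0..1}" "x = g s" "dist (g t) x < r" by (auto simp: path_image_def)
    have "\<not> \<delta> \<le> dist (g t) x" using s(3) by (simp add: r_def)
    then have "x \<notin> K" using \<delta>(2) by blast
    then have "\<bar>s - t\<bar> < e" using s by (auto simp: K_def dist_real_def abs_minus_commute)
    then have x: "x = g t + ((s - t) * norm b) *\<^sub>R d" using e(2)[of s] s(2) b by (simp add: d_def)
    moreover have "\<bar>(s - t) * norm b\<bar> < r" using s(3) unfolding x by (simp add: dist_norm d(1))
    ultimately show "x \<in> {g t + s *\<^sub>R d | s. \<bar>s\<bar> < r}" by blast
  next
    fix x assume "x \<in> {g t + s *\<^sub>R d | s. \<bar>s\<bar> < r}"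
    then obtain s where s: "x = g t + s *\<^sub>R d" "\<bar>s\<bar> < r" by blast
    have "\<bar>(t + s / norm b) - t\<bar> < e" using s(2) b by (simp add: r_def abs_divide divide_less_eq)
    from e(2)[OF this] have "t + s / norm b \<in> {0..1}" "g (t + s / norm b) = x"
      using b by (auto simp: s(1) d_def)
    then have "x \<in> \<Gamma>" by (auto simp: path_image_def)
    moreover have "dist (g t) x < r" using s d(1) by (simp add: dist_norm)
    ultimately show "x \<in> \<Gamma> \<inter> ball (g t) r" by simp
  qed
  then show ?thesis using r d(1) by blast
qed

text \<open>Each of the two sets avoids the curve and is connected, hence lies in one of the two components.
  As \<open>y\<close> is a boundary point of both components, both have points near \<open>y\<close>, so the two sets cannot
  lie in the same one.\<close>

lemma two_sides:
  assumes y: "y \<in> \<Gamma>" "e > 0" and P: "connected P" "P \<inter> \<Gamma> = {}" and N: "connected N" "N \<inter> \<Gamma> = {}"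
    and cover: "ball y e \<subseteq> P \<union> N \<union> \<Gamma>"
  shows "P \<subseteq> inside \<Gamma> \<and> N \<subseteq> outside \<Gamma> \<or> N \<subseteq> inside \<Gamma> \<and> P \<subseteq> outside \<Gamma>"
proof -
  have side: "A \<subseteq> inside \<Gamma> \<or> A \<subseteq> outside \<Gamma>" if "connected A" "A \<inter> \<Gamma> = {}" for A
  proof (rule ccontr)
    assume "\<not> ?thesis"
    then have "A \<inter> inside \<Gamma> \<noteq> {}" "A - inside \<Gamma> \<noteq> {}" using that(2) Jordan(6) by blast+
    from connected_Int_frontier[OF that(1) this] show False using that(2) Jordan(3) by blast
  qed
  have meets: "\<exists>x\<in>ball y e. x \<in> D" if "open D" "frontier D = \<Gamma>" for D
  proof -
    have "y \<in> closure D" using y that by (auto simp: frontier_def)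
    then obtain x where "x \<in> D" "dist x y < e" using y(2) unfolding closure_approachable by blast
    then show ?thesis by (auto simp: dist_commute)
  qed
  from meets[OF Jordan(1,3)] obtain x1 where "x1 \<in> ball y e" "x1 \<in> inside \<Gamma>" by blast
  moreover from meets[OF Jordan(2,4)] obtain x2 where "x2 \<in> ball y e" "x2 \<in> outside \<Gamma>" by blast
  moreover from calculation have "x1 \<notin> \<Gamma>" "x2 \<notin> \<Gamma>" using Jordan(6) by blast+
  ultimately have "x1 \<in> P \<union> N" "x2 \<in> P \<union> N" "x1 \<in> inside \<Gamma>" "x2 \<in> outside \<Gamma>" using cover by blast+
  then show ?thesis using side[OF P] side[OF N] Jordan(5) by blast
qed

text \<open>A normal vector at \<open>y\<close> is orthogonal to the curve and therefore determined up to sign; the sign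
  is determined because the inside and the outside are disjoint.\<close>

lemma outer_normal_eqI:
  assumes n: "is_outer_normal \<Gamma> y n" and d: "norm d = 1" "d \<bullet> n = 0"
    and line: "r > 0" "\<And>s. 0 < s \<Longrightarrow> s < r \<Longrightarrow> y + s *\<^sub>R d \<in> \<Gamma>"
  shows "outer_normal \<Gamma> y = n"
  unfolding outer_normal_def
proof (rule the_equality)
  show "is_outer_normal \<Gamma> y n" by (rule n)
next
  fix m assume m: "is_outer_normal \<Gamma> y m"
  obtain e where e: "e > 0" "\<And>t. 0 < t \<Longrightarrow> t < e \<Longrightarrow> y + t *\<^sub>R n \<in> outside \<Gamma> \<and> y - t *\<^sub>R n \<in> inside \<Gamma>"
    and n1: "norm n = 1"
    using n unfolding is_outer_normal_def by (metis greaterThanLessThan_iff)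
  obtain e' where e': "e' > 0" "\<And>t. 0 < t \<Longrightarrow> t < e' \<Longrightarrow> y + t *\<^sub>R m \<in> outside \<Gamma> \<and> y - t *\<^sub>R m \<in> inside \<Gamma>"
    "\<And>z. z \<in> \<Gamma> \<inter> ball y e' \<Longrightarrow> (z - y) \<bullet> m = 0" and m1: "norm m = 1"
    using m unfolding is_outer_normal_def by (metis greaterThanLessThan_iff)
  define s where "s = min r e' / 2"
  have s: "0 < s" "s < r" "s < e'" using line(1) e'(1) by (auto simp: s_def)
  then have "y + s *\<^sub>R d \<in> \<Gamma> \<inter> ball y e'" using line(2)[of s] d by (auto simp: dist_norm)
  from e'(3)[OF this] have dm: "d \<bullet> m = 0" using s by simp
  have "m = n \<or> m = - n"
    using unit_perp_cases[OF d(1) n1 d(2)] unit_perp_cases[OF d(1) m1 dm] by auto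
  moreover have "m \<noteq> - n"
  proof
    assume mn: "m = - n"
    define t where "t = min e e' / 2"
    have t: "0 < t" "t < e" "t < e'" using e(1) e'(1) by (auto simp: t_def)
    have "y - t *\<^sub>R n \<in> inside \<Gamma>" using e(2) t by blast
    moreover have "y - t *\<^sub>R n \<in> outside \<Gamma>" using e'(2)[of t] t mn by simp
    ultimately show False using Jordan(5) by blast
  qed
  ultimately show "m = n" by blast
qed

text \<open>Two half-discs at a point of a straight piece are separated by the curve in the sense of
  \<open>two_sides\<close>. They contain the corresponding smaller half-discs at all nearby points of the
  piece, which thus share the same normal.\<close>

lemma outer_normal_locally_constant:
  assumes t: "locally_affine B t"
  shows "\<exists>e>0. \<exists>n d. norm n = 1 \<and> norm d = 1 \<and> d \<bullet> n = 0 \<and> \<Gamma> \<inter> ball (g t) e = {g t + s *\<^sub>R d | s. \<bar>s\<bar> < e} \<and>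
    (\<forall>y\<in>\<Gamma> \<inter> ball (g t) e. outer_normal \<Gamma> y = n)"
proof -
  obtain e d where e: "e > 0" and d: "norm d = 1" and line: "\<Gamma> \<inter> ball (g t) e = {g t + s *\<^sub>R d | s. \<bar>s\<bar> < e}"
    using locally_affine_line[OF t] by blast
  define H where "H n = ball (g t) e \<inter> {x. n \<bullet> x > n \<bullet> g t}" for n
  have conv: "connected (H n)" for n
    unfolding H_def by (intro convex_connected convex_Int convex_ball convex_halfspace_gt)
  have perp: "d \<bullet> (\<i> * d) = 0" by (simp add: inner_complex_def)
  have disj: "H n \<inter> \<Gamma> = {}" if "d \<bullet> n = 0" for n
  proof -
    have False if "x \<in> H n" "x \<in> \<Gamma>" for x
    proof -
      from that have "x \<in> {g t + s *\<^sub>R d | s. \<bar>s\<bar> < e}" using line by (auto simp: H_def)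
      then show False using that(1) \<open>d \<bullet> n = 0\<close> by (auto simp: H_def inner_add_right inner_commute)
    qed
    then show ?thesis by blast
  qed
  have cover: "ball (g t) e \<subseteq> H (\<i> * d) \<union> H (- (\<i> * d)) \<union> \<Gamma>"
  proof
    fix x assume x: "x \<in> ball (g t) e"
    define z where "z = x - g t"
    show "x \<in> H (\<i> * d) \<union> H (- (\<i> * d)) \<union> \<Gamma>"
    proof (cases "z \<bullet> (\<i> * d) = 0")
      case True
      then have "z * cnj d = of_real (Re (z * cnj d))" by (simp add: inner_unit_rotate complex_eq_iff)
      then have z: "z = Re (z * cnj d) *\<^sub>R d" using unit_decompose[OF d, of z] by (metis mult.commute scaleR_conv_of_real)
      then have "norm z = \<bar>Re (z * cnj d)\<bar>" using d by (metis norm_scaleR mult_1_right)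
      then have "\<bar>Re (z * cnj d)\<bar> < e" using x by (simp add: z_def dist_norm norm_minus_commute)
      moreover have "x = g t + Re (z * cnj d) *\<^sub>R d" by (subst z[symmetric]) (simp add: z_def)
      ultimately show ?thesis using line by blast
    next
      case False
      have zn: "z \<bullet> n = n \<bullet> x - n \<bullet> g t" for n
        unfolding z_def inner_diff_left by (simp only: inner_commute)
      have "(\<i> * d) \<bullet> x > (\<i> * d) \<bullet> g t \<or> (- (\<i> * d)) \<bullet> x > (- (\<i> * d)) \<bullet> g t"
        using False unfolding zn inner_minus_left by linarith
      then show ?thesis using x unfolding H_def by blast
    qed
  qed
  have "g t \<in> {g t + s *\<^sub>R d | s. \<bar>s\<bar> < e}" proof -
    have "g t = g t + 0 *\<^sub>R d \<and> \<bar>0\<bar> < e" using e by simp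
    then show ?thesis by blast
  qed
  then have gt: "g t \<in> \<Gamma>" using line by blast
  have "\<exists>n. norm n = 1 \<and> d \<bullet> n = 0 \<and> H n \<subseteq> outside \<Gamma> \<and> H (- n) \<subseteq> inside \<Gamma>"
  proof -
    have perp': "d \<bullet> (- (\<i> * d)) = 0" unfolding inner_minus_right perp by simp
    from two_sides[OF gt e conv disj[OF perp] conv disj[OF perp'] cover] show ?thesis
  proof
    assume "H (\<i> * d) \<subseteq> inside \<Gamma> \<and> H (- (\<i> * d)) \<subseteq> outside \<Gamma>"
    then show ?thesis using perp' d by (intro exI[of _ "- (\<i> * d)"]) (simp add: norm_mult)
  next
    assume "H (- (\<i> * d)) \<subseteq> inside \<Gamma> \<and> H (\<i> * d) \<subseteq> outside \<Gamma>"
    then show ?thesis using perp d by (intro exI[of _ "\<i> * d"]) (simp add: norm_mult)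
  qed qed
  then obtain n where n: "norm n = 1" "d \<bullet> n = 0" "H n \<subseteq> outside \<Gamma>" "H (- n) \<subseteq> inside \<Gamma>" by blast
  have "outer_normal \<Gamma> y = n" if y: "y \<in> \<Gamma> \<inter> ball (g t) e" for y
  proof -
    from y line obtain s where s: "y = g t + s *\<^sub>R d" "\<bar>s\<bar> < e" by blast
    define \<epsilon> where "\<epsilon> = e - \<bar>s\<bar>"
    have \<epsilon>: "\<epsilon> > 0" using s by (simp add: \<epsilon>_def)
    have ball: "y + z \<in> ball (g t) e" if "norm z < \<epsilon>" for z
    proof -
      have "norm (s *\<^sub>R d + z) \<le> \<bar>s\<bar> + norm z" using norm_triangle_ineq[of "s *\<^sub>R d" z] d by simp
      moreover have eq: "g t - (y + z) = - (s *\<^sub>R d + z)" by (simp add: s)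
      ultimately show ?thesis using that unfolding mem_ball dist_norm eq norm_minus_cancel \<epsilon>_def by linarith
    qed
    show ?thesis
    proof (rule outer_normal_eqI[OF _ d n(2) \<epsilon>])
      fix r assume r: "0 < r" "r < \<epsilon>"
      then have "y + r *\<^sub>R d = g t + (s + r) *\<^sub>R d" "\<bar>s + r\<bar> < e"
        unfolding \<epsilon>_def by (simp add: s scaleR_add_left, linarith)
      then show "y + r *\<^sub>R d \<in> \<Gamma>" using line by blast
    next
      show "is_outer_normal \<Gamma> y n"
        unfolding is_outer_normal_def
      proof (intro conjI exI[of _ \<epsilon>] \<epsilon> ballI n(1))
        fix z assume z: "z \<in> \<Gamma> \<inter> ball y \<epsilon>"
        then have "norm (z - y) < \<epsilon>" by (simp add: dist_norm norm_minus_commute)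
        from ball[OF this] z have "z \<in> {g t + s *\<^sub>R d | s. \<bar>s\<bar> < e}" using line by auto
        then show "(z - y) \<bullet> n = 0" using n(2) by (auto simp: s inner_diff_left inner_add_left)
      next
        fix r assume r: "r \<in> {0<..<\<epsilon>}"
        have nn: "n \<bullet> n = 1" using n(1) by (simp add: dot_square_norm)
        have nd: "n \<bullet> d = 0" using n(2) by (simp add: inner_commute)
        have ny: "n \<bullet> y = n \<bullet> g t" by (simp add: s inner_add_right nd)
        have b: "y + r *\<^sub>R n \<in> ball (g t) e" "y + - (r *\<^sub>R n) \<in> ball (g t) e"
          by (rule ball; use r n(1) in simp)+
        have "n \<bullet> (y + r *\<^sub>R n) = n \<bullet> g t + r" "- n \<bullet> (y + - (r *\<^sub>R n)) = - n \<bullet> g t + r"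
          by (simp_all add: inner_add_right inner_diff_right ny nn)
        then have "y + r *\<^sub>R n \<in> H n" "y + - (r *\<^sub>R n) \<in> H (- n)"
          using b r unfolding H_def by auto
        then show "y + r *\<^sub>R n \<in> outside \<Gamma>" "y - r *\<^sub>R n \<in> inside \<Gamma>" using n(3,4) by auto
      qed
    qed
  qed
  then show ?thesis using e n d line by blast
qed

text \<open>A point off the curve has no outer normal, since small displacements in both directions stay in
  one component. The definite description then has the same value everywhere.\<close>

lemma outer_normal_off_curve:
  assumes "x \<notin> \<Gamma>" shows "outer_normal \<Gamma> x = (THE n. False)"
proof -
  have "\<not> is_outer_normal \<Gamma> x n" for n
  proof
    assume "is_outer_normal \<Gamma> x n"
    then obtain e where e: "e > 0" "norm n = 1" "\<And>t. 0 < t \<Longrightarrow> t < e \<Longrightarrow> x + t *\<^sub>R n \<in> outside \<Gamma> \<and> x - t *\<^sub>R n \<in> inside \<Gamma>"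
      unfolding is_outer_normal_def by (metis greaterThanLessThan_iff)
    obtain D where D: "D = inside \<Gamma> \<or> D = outside \<Gamma>" "x \<in> D" using assms Jordan(6) by blast
    then have "open D" using Jordan by blast
    then obtain r where r: "r > 0" "ball x r \<subseteq> D" using D(2) by (meson openE)
    define t where "t = min e r / 2"
    have t: "0 < t" "t < e" "t < r" using e r by (auto simp: t_def)
    then have "x + t *\<^sub>R n \<in> D" "x - t *\<^sub>R n \<in> D" using r(2) e(2) by (auto simp: subset_iff dist_norm)
    then show False using e(3)[of t] t D(1) Jordan(5) by blast
  qed
  then show ?thesis by (simp add: outer_normal_def)
qed

end


section \<open>Arclength, the normal as a Borel map, and a convex corner\<close>

context polygon_curve
begin

text \<open>The derivative is locally constant away from the finitely many break points and takes finitely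
  many values there.\<close>

lemma speed_measurable_bounded:
  shows "(\<lambda>t. norm (vector_derivative g (at t))) \<in> borel_measurable (restrict_space lborel {0..1})"
    and "\<exists>K\<ge>0. AE t in restrict_space lborel {0..1}. norm (vector_derivative g (at t)) \<le> K"
proof -
  let ?f = "\<lambda>t. norm (vector_derivative g (at t))"
  let ?L = "restrict_space lborel {0..1::real}"
  obtain S B where S: "finite S" "finite B" "{0, 1} \<subseteq> S" "\<And>t. t \<in> {0..1} - S \<Longrightarrow> locally_affine B t"
    using finite_breaks by metis
  have vd: "\<exists>e>0. \<exists>b\<in>B. \<forall>s. \<bar>s - t\<bar> < e \<longrightarrow> vector_derivative g (at s) = b" if t: "t \<in> {0..1} - S" for t
  proof -
    obtain e b where e: "e > 0" "b \<in> B" "\<And>s. \<bar>s - t\<bar> < e \<Longrightarrow> g s = g t + (s - t) *\<^sub>R b"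
      using S(4)[OF t] unfolding locally_affine_def by blast
    have "vector_derivative g (at s) = b" if s: "\<bar>s - t\<bar> < e" for s
    proof (rule vector_derivative_at)
      have "((\<lambda>s. g t + (s - t) *\<^sub>R b) has_vector_derivative b) (at s)"
        by (auto intro!: derivative_eq_intros)
      then show "(g has_vector_derivative b) (at s)"
      proof (rule has_vector_derivative_transform_within_open[OF _ open_ball[of t e]])
        show "g t + (x - t) *\<^sub>R b = g x" if "x \<in> ball t e" for x
          using that by (intro e(3)[symmetric]) (simp add: dist_real_def abs_minus_commute)
      qed (use s in \<open>simp add: dist_real_def abs_minus_commute\<close>)
    qed
    then show ?thesis using e by blast
  qed
  have "continuous_on ({0..1} - S) ?f"
    unfolding continuous_on_iff
  proof (intro ballI allI impI)
    fix t \<epsilon> :: real assume t: "t \<in> {0..1} - S" and \<epsilon>: "\<epsilon> > 0"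
    obtain e b where "e > 0" "\<And>s. \<bar>s - t\<bar> < e \<Longrightarrow> vector_derivative g (at s) = b" using vd[OF t] by blast
    then show "\<exists>d>0. \<forall>x'\<in>{0..1} - S. dist x' t < d \<longrightarrow> dist (?f x') (?f t) < \<epsilon>"
      using \<epsilon> by (intro exI[of _ e]) (auto simp: dist_real_def)
  qed
  then have m: "(\<lambda>t. indicator ({0..1} - S) t *\<^sub>R ?f t) \<in> borel_measurable borel"
    using S(1) by (intro borel_measurable_continuous_on_indicator) (auto intro: sets.Diff finite_imp_closed borel_closed)
  then have m': "(\<lambda>t. indicator ({0..1} - S) t *\<^sub>R ?f t) \<in> borel_measurable ?L"
    by (intro measurable_restrict_space1) simp
  show "?f \<in> borel_measurable ?L"
  proof (rule measurable_discrete_difference[OF m', of "S \<inter> {0..1}"])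
    show "{x} \<in> sets ?L" if "x \<in> S \<inter> {0..1}" for x
      using that by (subst sets_restrict_space_iff) auto
  qed (use S(1) in \<open>auto simp: space_restrict_space countable_finite\<close>)
  have "AE t in lborel. t \<notin> S"
    using S(1) by (intro AE_not_in finite_imp_null_set_lborel)
  then have "AE t in lborel. t \<in> {0..1} \<longrightarrow> ?f t \<le> (\<Sum>b\<in>B. norm b)"
  proof eventually_elim
    case (elim t)
    show ?case
    proof
      assume "t \<in> {0..1}"
      then have t: "t \<in> {0..1} - S" using elim by blast
      obtain e b where "e > 0" "b \<in> B" "\<And>s. \<bar>s - t\<bar> < e \<Longrightarrow> vector_derivative g (at s) = b" using vd[OF t] by blast
      then have "vector_derivative g (at t) \<in> B" by simp
      then show "?f t \<le> (\<Sum>b\<in>B. norm b)" using S(2) by (intro member_le_sum) auto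
    qed
  qed
  then have "AE t in ?L. ?f t \<le> (\<Sum>b\<in>B. norm b)" by (subst AE_restrict_space_iff) auto
  then show "\<exists>K\<ge>0. AE t in ?L. ?f t \<le> K" by (intro exI[of _ "\<Sum>b\<in>B. norm b"]) (auto intro: sum_nonneg)
qed

lemma emeasure_arclength:
  assumes A: "A \<in> sets borel"
  shows "emeasure (arclength g) A = (\<integral>\<^sup>+t. ennreal (norm (vector_derivative g (at t))) * indicator (g -` A) t \<partial>restrict_space lborel {0..1})"
proof -
  let ?L = "restrict_space lborel {0..1::real}"
  have g [measurable]: "g \<in> borel_measurable ?L"
    using borel_measurable_continuous_on_restrict[OF continuous_g]
    by (simp cong: measurable_cong_sets add: sets_restrict_space_cong[OF sets_lborel])
  have f: "(\<lambda>t. ennreal (norm (vector_derivative g (at t)))) \<in> borel_measurable ?L"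
    using speed_measurable_bounded(1) by measurable
  have gA: "g -` A \<inter> space ?L \<in> sets ?L" using measurable_sets[OF g A] .
  have "emeasure (arclength g) A = emeasure (density ?L (\<lambda>t. ennreal (norm (vector_derivative g (at t))))) (g -` A \<inter> space ?L)"
    unfolding arclength_def using g A by (subst emeasure_distr) auto
  also have "\<dots> = (\<integral>\<^sup>+t. ennreal (norm (vector_derivative g (at t))) * indicator (g -` A \<inter> space ?L) t \<partial>?L)"
    by (rule emeasure_density[OF f gA])
  also have "\<dots> = (\<integral>\<^sup>+t. ennreal (norm (vector_derivative g (at t))) * indicator (g -` A) t \<partial>?L)"
    by (intro nn_integral_cong) (auto simp: indicator_def)
  finally show ?thesis .
qed

lemma finite_measure_arclength: "finite_measure (arclength g)"
proof
  obtain K where K: "K \<ge> 0" "AE t in restrict_space lborel {0..1}. norm (vector_derivative g (at t)) \<le> K"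
    using speed_measurable_bounded(2) by blast
  have "emeasure (arclength g) UNIV \<le> (\<integral>\<^sup>+t. ennreal K \<partial>restrict_space lborel {0..1::real})"
    by (subst emeasure_arclength, simp) (rule nn_integral_mono_AE, use K(2) in \<open>auto elim!: eventually_mono intro: ennreal_leI\<close>)
  also have "\<dots> < \<infinity>"
    using K(1) by (simp add: emeasure_restrict_space space_restrict_space ennreal_mult_less_top)
  finally show "emeasure (arclength g) (space (arclength g)) \<noteq> \<infinity>" by (simp add: arclength_def)
qed

lemma null_arclength:
  assumes A: "A \<in> sets borel" and fin: "finite {t \<in> {0..1}. g t \<in> A}"
  shows "emeasure (arclength g) A = 0"
proof -
  have "AE t in lborel. t \<notin> {t \<in> {0..1}. g t \<in> A}"
    by (intro AE_not_in finite_imp_null_set_lborel fin)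
  then have "AE t in restrict_space lborel {0..1}. ennreal (norm (vector_derivative g (at t))) * indicator (g -` A) t = 0"
    by (subst AE_restrict_space_iff) (auto elim!: eventually_mono simp: indicator_def)
  then show ?thesis unfolding emeasure_arclength[OF A] by (subst nn_integral_cong_AE) auto
qed

lemma AE_arclength:
  assumes A: "A \<in> sets borel" "finite {t \<in> {0..1}. g t \<in> A}" and P: "\<And>y. y \<in> \<Gamma> \<Longrightarrow> y \<notin> A \<Longrightarrow> P y"
  shows "AE y in arclength g. P y"
proof (rule AE_I[of _ _ "- \<Gamma> \<union> A"])
  have "{t \<in> {0..1}. g t \<in> - \<Gamma> \<union> A} = {t \<in> {0..1}. g t \<in> A}" by (auto simp: path_image_def)
  then show "emeasure (arclength g) (- \<Gamma> \<union> A) = 0"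
    using A compact_imp_closed[OF compact_curve] by (intro null_arclength) (auto intro: borel_closed)
  show "- \<Gamma> \<union> A \<in> sets (arclength g)"
    using A compact_imp_closed[OF compact_curve] by (auto simp: arclength_def intro: borel_closed)
  show "{y \<in> space (arclength g). \<not> P y} \<subseteq> - \<Gamma> \<union> A" using P by blast
qed

lemma finite_exceptional_set:
  "\<exists>E. finite E \<and> finite {t \<in> {0..1}. g t \<in> E} \<and> (\<forall>y\<in>\<Gamma> - E. \<exists>B t. y = g t \<and> locally_affine B t)"
proof -
  obtain S B where S: "finite S" "\<And>t. t \<in> {0..1} - S \<Longrightarrow> locally_affine B t"
    using finite_breaks by metis
  have "{t \<in> {0..1}. g t \<in> g ` S} = (\<Union>y\<in>g ` S. {t \<in> {0..1}. g t = y})" by auto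
  moreover have "finite (\<Union>y\<in>g ` S. {t \<in> {0..1}. g t = y})"
    using S(1) finite_preimage by blast
  ultimately have "finite {t \<in> {0..1}. g t \<in> g ` S}" by simp
  moreover have "\<forall>y\<in>\<Gamma> - g ` S. \<exists>B t. y = g t \<and> locally_affine B t"
    using S(2) by (fastforce simp: path_image_def)
  ultimately show ?thesis using S(1) by blast
qed

text \<open>The integrand of the double layer potential must be Borel on the whole plane. The normal is
  locally constant on the curve without finitely many points, and constant off the curve.\<close>

lemma outer_normal_measurable_bounded:
  shows "outer_normal \<Gamma> \<in> borel_measurable borel" and "\<exists>C. \<forall>y. norm (outer_normal \<Gamma> y) \<le> C"
proof -
  let ?\<nu> = "outer_normal \<Gamma>" and ?c = "THE n::complex. False"
  obtain E where E: "finite E" "\<And>y. y \<in> \<Gamma> - E \<Longrightarrow> \<exists>B t. y = g t \<and> locally_affine B t"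
    using finite_exceptional_set by metis
  have loc: "\<exists>e>0. \<exists>n. norm n = 1 \<and> (\<forall>y'\<in>\<Gamma> \<inter> ball y e. ?\<nu> y' = n)" if "y \<in> \<Gamma> - E" for y
    using E(2)[OF that] outer_normal_locally_constant by metis
  have "continuous_on (\<Gamma> - E) ?\<nu>"
    unfolding continuous_on_iff
  proof (intro ballI allI impI)
    fix y \<epsilon> assume y: "y \<in> \<Gamma> - E" and \<epsilon>: "(\<epsilon>::real) > 0"
    obtain e n where e: "e > 0" "\<forall>y'\<in>\<Gamma> \<inter> ball y e. ?\<nu> y' = n" using loc[OF y] by blast
    then have "?\<nu> y = n" using y by simp
    with e \<epsilon> show "\<exists>d>0. \<forall>x'\<in>\<Gamma> - E. dist x' y < d \<longrightarrow> dist (?\<nu> x') (?\<nu> y) < \<epsilon>"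
      by (intro exI[of _ e]) (auto simp: dist_commute)
  qed
  moreover have set: "\<Gamma> - E \<in> sets borel"
    using E(1) compact_imp_closed[OF compact_curve] by (intro sets.Diff) (auto intro: borel_closed finite_imp_closed)
  ultimately have i: "(\<lambda>y. indicator (\<Gamma> - E) y *\<^sub>R ?\<nu> y) \<in> borel_measurable borel"
    by (intro borel_measurable_continuous_on_indicator)
  have m: "(\<lambda>y. indicator (\<Gamma> - E) y *\<^sub>R ?\<nu> y + indicator (- (\<Gamma> - E)) y *\<^sub>R ?c) \<in> borel_measurable borel"
    by (rule borel_measurable_add[OF i])
       (intro borel_measurable_scaleR borel_measurable_indicator borel_measurable_const borel_comp set)
  show "?\<nu> \<in> borel_measurable borel"
    by (rule measurable_discrete_difference[OF m, of E])
       (use E(1) outer_normal_off_curve in \<open>auto simp: countable_finite indicator_def\<close>)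
  have "norm (?\<nu> y) \<le> 1 + norm ?c + (\<Sum>y\<in>E. norm (?\<nu> y))" for y
  proof -
    have s: "0 \<le> (\<Sum>y\<in>E. norm (?\<nu> y))" by (intro sum_nonneg) auto
    consider "y \<in> E" | "y \<in> \<Gamma> - E" | "y \<notin> \<Gamma>" by blast
    then show ?thesis
    proof cases
      case 1
      then have "norm (?\<nu> y) \<le> (\<Sum>y\<in>E. norm (?\<nu> y))" using E(1) by (intro member_le_sum) auto
      then show ?thesis using norm_ge_zero[of ?c] by linarith
    next
      case 2
      then have "norm (?\<nu> y) = 1" using loc[OF 2] by auto
      then show ?thesis using s norm_ge_zero[of ?c] by linarith
    next
      case 3
      then show ?thesis using s outer_normal_off_curve by simp
    qed
  qed
  then show "\<exists>C. \<forall>y. norm (?\<nu> y) \<le> C" by blast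
qed

lemma layer_curve: "\<exists>\<rho> C. layer_curve g \<rho> C"
proof -
  obtain C where C: "\<And>y. norm (outer_normal \<Gamma> y) \<le> C" using outer_normal_measurable_bounded(2) by blast
  obtain \<rho> where \<rho>: "\<And>y. y \<in> \<Gamma> \<Longrightarrow> norm y \<le> \<rho>"
    using compact_imp_bounded[OF compact_curve] by (auto simp: bounded_iff)
  have "layer_curve g \<rho> C"
  proof (rule layer_curve.intro)
    show "finite_measure (arclength g)" by (rule finite_measure_arclength)
    show "AE y in arclength g. norm y \<le> \<rho>" by (rule AE_arclength[of "{}"]) (use \<rho> in auto)
    show "emeasure (arclength g) {x} = 0" for x using finite_preimage[of x] by (intro null_arclength) auto
  qed (use outer_normal_measurable_bounded(1) C in auto)
  then show ?thesis by blast
qed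

text \<open>The two pieces of the curve that meet at \<open>v\<close>, parametrized by \<open>\<alpha>\<close> and \<open>\<beta>\<close> starting from \<open>v\<close>. If
  \<open>v\<close> is the base point of the loop, these are the initial piece and the reversed final piece;
  this lemma hides that distinction.\<close>

lemma edges_at_point:
  assumes v: "v \<in> \<Gamma>"
  obtains e a b \<alpha> \<beta> where "e > 0"
    "\<And>s. 0 \<le> s \<Longrightarrow> s < e \<Longrightarrow> \<alpha> s \<in> {0..1} \<and> g (\<alpha> s) = v + s *\<^sub>R a"
    "\<And>s. 0 \<le> s \<Longrightarrow> s < e \<Longrightarrow> \<beta> s \<in> {0..1} \<and> g (\<beta> s) = v + s *\<^sub>R b"
    "\<And>s s'. 0 < s \<Longrightarrow> s < e \<Longrightarrow> 0 < s' \<Longrightarrow> s' < e \<Longrightarrow> g (\<alpha> s) \<noteq> g (\<beta> s')"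
    "\<And>s. 0 < s \<Longrightarrow> s < e \<Longrightarrow> g (\<alpha> s) \<noteq> v \<and> g (\<beta> s) \<noteq> v"
    "v \<notin> closure (g ` ({0..1} - (\<alpha> ` {0..<e} \<union> \<beta> ` {0..<e})))"
proof -
  obtain t where t: "t \<in> {0..1}" "g t = v" using v by (auto simp: path_image_def)
  have far: "v \<notin> closure (g ` K)" if "compact K" "K \<subseteq> {0..1}" "\<And>s. s \<in> K \<Longrightarrow> g s \<noteq> v" for K
  proof -
    have "compact (g ` K)" using that continuous_on_subset[OF continuous_g] by (intro compact_continuous_image) auto
    then have "closure (g ` K) = g ` K" by (simp add: compact_imp_closed)
    then show ?thesis using that(3) by auto
  qed
  show ?thesis
  proof (cases "t \<in> {0<..<1}")
    case True
    obtain e a b where e: "e > 0" "\<And>s. s \<in> {0..1} \<Longrightarrow> \<bar>s - t\<bar> < e \<Longrightarrow> g s = g t + (s - t) *\<^sub>R (if s < t then a else b)"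
      using piecewise_affineE[OF affine t(1)] by metis
    define r where "r = min e (min t (1 - t))"
    have r: "r > 0" using e True by (auto simp: r_def)
    show ?thesis
    proof (rule that[of r "\<lambda>s. t + s" b "\<lambda>s. t - s" "- a"])
      show "t + s \<in> {0..1} \<and> g (t + s) = v + s *\<^sub>R b" if "0 \<le> s" "s < r" for s
        using e(2)[of "t + s"] that t by (auto simp: r_def)
      show "t - s \<in> {0..1} \<and> g (t - s) = v + s *\<^sub>R - a" if "0 \<le> s" "s < r" for s
        using e(2)[of "t - s"] that t by (cases "s = 0") (auto simp: r_def)
      show "g (t + s) \<noteq> g (t - s')" if "0 < s" "s < r" "0 < s'" "s' < r" for s s'
        using g_inj[of "t + s" "t - s'"] that True by (auto simp: r_def)
      show "g (t + s) \<noteq> v \<and> g (t - s) \<noteq> v" if "0 < s" "s < r" for s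
        using g_inj[OF _ True, of "t + s"] g_inj[OF _ True, of "t - s"] that t by (auto simp: r_def)
      have "s \<in> (\<lambda>s. t + s) ` {0..<r} \<union> (\<lambda>s. t - s) ` {0..<r}" if "\<bar>s - t\<bar> < r" for s
        using that by (cases "s \<ge> t") (auto intro: image_eqI[of _ _ "s - t"] image_eqI[of _ _ "t - s"])
      then have sub: "{0..1} - ((\<lambda>s. t + s) ` {0..<r} \<union> (\<lambda>s. t - s) ` {0..<r}) \<subseteq> {0..1} - ball t r"
        by (auto simp: dist_real_def abs_minus_commute)
      have "v \<notin> closure (g ` ({0..1} - ball t r))"
        using g_inj[OF _ True] t r by (intro far compact_diff) force+
      then show "v \<notin> closure (g ` ({0..1} - ((\<lambda>s. t + s) ` {0..<r} \<union> (\<lambda>s. t - s) ` {0..<r})))"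
        using closure_mono[OF image_mono[OF sub]] by blast
    qed (rule r)
  next
    case False
    then have v0: "g 0 = v" and v1: "g 1 = v" using t g01 by (auto simp: less_le)
    obtain e1 a1 b1 where e1: "e1 > 0" "\<And>s. s \<in> {0..1} \<Longrightarrow> \<bar>s - 0\<bar> < e1 \<Longrightarrow> g s = g 0 + (s - 0) *\<^sub>R (if s < 0 then a1 else b1)"
      using piecewise_affineE[OF affine, of 0] by auto
    obtain e2 a2 b2 where e2: "e2 > 0" "\<And>s. s \<in> {0..1} \<Longrightarrow> \<bar>s - 1\<bar> < e2 \<Longrightarrow> g s = g 1 + (s - 1) *\<^sub>R (if s < 1 then a2 else b2)"
      using piecewise_affineE[OF affine, of 1] by auto
    define r where "r = min (1 / 2) (min e1 e2)"
    have r: "r > 0" using e1 e2 by (auto simp: r_def)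
    show ?thesis
    proof (rule that[of r "\<lambda>s. s" b1 "\<lambda>s. 1 - s" "- a2"])
      show "s \<in> {0..1} \<and> g s = v + s *\<^sub>R b1" if "0 \<le> s" "s < r" for s
        using e1(2)[of s] that v0 by (auto simp: r_def)
      show "1 - s \<in> {0..1} \<and> g (1 - s) = v + s *\<^sub>R - a2" if "0 \<le> s" "s < r" for s
        using e2(2)[of "1 - s"] that v1 by (cases "s = 0") (auto simp: r_def)
      show "g s \<noteq> g (1 - s')" if "0 < s" "s < r" "0 < s'" "s' < r" for s s'
        using g_inj[of s "1 - s'"] that by (auto simp: r_def)
      show "g s \<noteq> v \<and> g (1 - s) \<noteq> v" if "0 < s" "s < r" for s
        using g_inj[of 0 s] g_inj[of 0 "1 - s"] that v0 by (auto simp: r_def)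
      have "s \<in> (\<lambda>s. s) ` {0..<r} \<union> (\<lambda>s. 1 - s) ` {0..<r}" if "s \<in> {0..1}" "s \<notin> {r..1 - r}" for s
        using that by (cases "s < r") (auto intro: image_eqI[of _ _ "1 - s"])
      then have sub: "{0..1} - ((\<lambda>s. s) ` {0..<r} \<union> (\<lambda>s. 1 - s) ` {0..<r}) \<subseteq> {r..1 - r}"
        by blast
      have "v \<notin> closure (g ` {r..1 - r})"
      proof (rule far)
        fix s assume "s \<in> {r..1 - r}"
        then show "g s \<noteq> v" using g_inj[of 0 s] v0 r by auto
      qed (use r in auto)
      then show "v \<notin> closure (g ` ({0..1} - ((\<lambda>s. s) ` {0..<r} \<union> (\<lambda>s. 1 - s) ` {0..<r})))"
        using closure_mono[OF image_mono[OF sub]] by blast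
    qed (rule r)
  qed
qed

text \<open>A point of maximal norm on the curve. The curve stays in the disc through \<open>v\<close>, so both edges
  point strictly into the half-plane \<open>v \<bullet> x < 0\<close>; in particular they are not opposite to each
  other, and they differ because the curve is simple.\<close>

lemma convex_corner:
  obtains v d1 d2 \<delta> where "v \<in> \<Gamma>" "\<Gamma> \<subseteq> cball 0 (norm v)" "norm d1 = 1" "norm d2 = 1" "\<delta> > 0"
    "v \<bullet> d1 < 0" "v \<bullet> d2 < 0" "d1 \<noteq> d2"
    "\<Gamma> \<inter> ball v \<delta> = {v + s *\<^sub>R d1 | s. 0 \<le> s \<and> s < \<delta>} \<union> {v + s *\<^sub>R d2 | s. 0 \<le> s \<and> s < \<delta>}"
proof -
  have "\<exists>v\<in>\<Gamma>. \<forall>y\<in>\<Gamma>. norm y \<le> norm v"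
    using compact_curve by (intro continuous_attains_sup) (auto intro: continuous_intros)
  then obtain v where v: "v \<in> \<Gamma>" "\<And>y. y \<in> \<Gamma> \<Longrightarrow> norm y \<le> norm v" by blast
  obtain e a b \<alpha> \<beta> where e: "e > 0"
    and \<alpha>: "\<And>s. 0 \<le> s \<Longrightarrow> s < e \<Longrightarrow> \<alpha> s \<in> {0..1} \<and> g (\<alpha> s) = v + s *\<^sub>R a"
    and \<beta>: "\<And>s. 0 \<le> s \<Longrightarrow> s < e \<Longrightarrow> \<beta> s \<in> {0..1} \<and> g (\<beta> s) = v + s *\<^sub>R b"
    and ne: "\<And>s s'. 0 < s \<Longrightarrow> s < e \<Longrightarrow> 0 < s' \<Longrightarrow> s' < e \<Longrightarrow> g (\<alpha> s) \<noteq> g (\<beta> s')"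
    and nv: "\<And>s. 0 < s \<Longrightarrow> s < e \<Longrightarrow> g (\<alpha> s) \<noteq> v \<and> g (\<beta> s) \<noteq> v"
    and far: "v \<notin> closure (g ` ({0..1} - (\<alpha> ` {0..<e} \<union> \<beta> ` {0..<e})))"
    by (rule edges_at_point[OF v(1)]) (rule that; assumption)
  have half: "0 < e / 2" "e / 2 < e" "0 \<le> e / 2" using e by auto
  have ab: "a \<noteq> 0" "b \<noteq> 0" using nv[OF half(1,2)] \<alpha>[OF half(3,2)] \<beta>[OF half(3,2)] by auto
  define d1 where "d1 = (1 / norm a) *\<^sub>R a"
  define d2 where "d2 = (1 / norm b) *\<^sub>R b"
  have d: "norm d1 = 1" "norm d2 = 1" "a = norm a *\<^sub>R d1" "b = norm b *\<^sub>R d2" using ab by (auto simp: d1_def d2_def)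
  have neg: "v \<bullet> c < 0" if "v + s *\<^sub>R c \<in> \<Gamma>" "s > 0" "c \<noteq> 0" for s c
  proof -
    have "(norm (v + s *\<^sub>R c))\<^sup>2 \<le> (norm v)\<^sup>2" using v(2)[OF that(1)] by (intro power_mono) auto
    moreover have "(norm (v + s *\<^sub>R c))\<^sup>2 = (norm v)\<^sup>2 + 2 * s * (v \<bullet> c) + s\<^sup>2 * (c \<bullet> c)"
      unfolding power2_norm_eq_inner inner_add_left inner_add_right inner_scaleR_left inner_scaleR_right
      by (simp add: inner_commute[of c v] power2_eq_square distrib_left)
    ultimately have "2 * s * (v \<bullet> c) + s\<^sup>2 * (c \<bullet> c) \<le> 0" by linarith
    moreover have "s\<^sup>2 * (c \<bullet> c) > 0" using that by simp
    ultimately have "s * (v \<bullet> c) < 0" by linarith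
    then show ?thesis using that(2) by (simp add: mult_less_0_iff)
  qed
  have "v + (e / 2) *\<^sub>R a \<in> \<Gamma>" "v + (e / 2) *\<^sub>R b \<in> \<Gamma>"
    using \<alpha>[OF half(3,2)] \<beta>[OF half(3,2)] by (auto simp: path_image_def intro: image_eqI[rotated])
  then have "v \<bullet> a < 0" "v \<bullet> b < 0" using neg half(1) ab by blast+
  then have vd: "v \<bullet> d1 < 0" "v \<bullet> d2 < 0" using ab by (auto simp: d1_def d2_def divide_less_0_iff)
  \<comment> \<open>up to this distance from \<open>v\<close>, the affine pieces extend\<close>
  define m where "m = e * min (norm a) (norm b)"
  have m: "m > 0" using e ab by (simp add: m_def)
  obtain r where r: "r > 0" "\<And>y. y \<in> g ` ({0..1} - (\<alpha> ` {0..<e} \<union> \<beta> ` {0..<e})) \<Longrightarrow> r \<le> dist v y"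
    using far unfolding closure_approachable by (metis dist_commute not_le)
  define \<delta> where "\<delta> = min r m"
  have \<delta>: "\<delta> > 0" using r m by (simp add: \<delta>_def)
  have small: "0 \<le> s / norm a \<and> s / norm a < e \<and> v + s *\<^sub>R d1 = v + (s / norm a) *\<^sub>R a"
    "0 \<le> s / norm b \<and> s / norm b < e \<and> v + s *\<^sub>R d2 = v + (s / norm b) *\<^sub>R b" if "0 \<le> s" "s < \<delta>" for s
  proof -
    have "s < m" using that by (simp add: \<delta>_def)
    then have "s < e * norm a" "s < e * norm b"
      using e by (auto simp: m_def intro: less_le_trans)
    then show "0 \<le> s / norm a \<and> s / norm a < e \<and> v + s *\<^sub>R d1 = v + (s / norm a) *\<^sub>R a"
      "0 \<le> s / norm b \<and> s / norm b < e \<and> v + s *\<^sub>R d2 = v + (s / norm b) *\<^sub>R b"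
      using that ab by (auto simp: d1_def d2_def divide_less_eq)
  qed
  have d12: "d1 \<noteq> d2"
  proof
    assume eq: "d1 = d2"
    have h: "0 \<le> \<delta> / 2" "\<delta> / 2 < \<delta>" "0 < \<delta> / 2" using \<delta> by auto
    have "g (\<alpha> (\<delta> / 2 / norm a)) = g (\<beta> (\<delta> / 2 / norm b))"
      using \<alpha>[of "\<delta> / 2 / norm a"] \<beta>[of "\<delta> / 2 / norm b"] small[OF h(1,2)] eq by simp
    moreover have "0 < \<delta> / 2 / norm a" "0 < \<delta> / 2 / norm b" using \<delta> ab by auto
    ultimately show False using ne small[OF h(1,2)] by blast
  qed
  have "\<Gamma> \<inter> ball v \<delta> = {v + s *\<^sub>R d1 | s. 0 \<le> s \<and> s < \<delta>} \<union> {v + s *\<^sub>R d2 | s. 0 \<le> s \<and> s < \<delta>}"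
  proof (intro equalityI subsetI)
    fix x assume x: "x \<in> \<Gamma> \<inter> ball v \<delta>"
    then obtain t where t: "t \<in> {0..1}" "x = g t" by (auto simp: path_image_def)
    have "\<not> r \<le> dist v x" using x by (simp add: \<delta>_def)
    then have "t \<in> \<alpha> ` {0..<e} \<union> \<beta> ` {0..<e}" using r(2) t by blast
    then obtain s where s: "0 \<le> s" "s < e" "t = \<alpha> s \<or> t = \<beta> s" by auto
    from s(3) show "x \<in> {v + s *\<^sub>R d1 | s. 0 \<le> s \<and> s < \<delta>} \<union> {v + s *\<^sub>R d2 | s. 0 \<le> s \<and> s < \<delta>}"
    proof
      assume "t = \<alpha> s"
      then have "x = v + (s * norm a) *\<^sub>R d1" using \<alpha>[OF s(1,2)] t(2) ab by (simp add: d1_def)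
      moreover from this have "s * norm a < \<delta>" using x s(1) d(1) by (simp add: dist_norm abs_mult)
      ultimately show ?thesis using s(1) by (intro UnI1 CollectI exI[of _ "s * norm a"]) auto
    next
      assume "t = \<beta> s"
      then have "x = v + (s * norm b) *\<^sub>R d2" using \<beta>[OF s(1,2)] t(2) ab by (simp add: d2_def)
      moreover from this have "s * norm b < \<delta>" using x s(1) d(2) by (simp add: dist_norm abs_mult)
      ultimately show ?thesis using s(1) by (intro UnI2 CollectI exI[of _ "s * norm b"]) auto
    qed
  next
    fix x assume "x \<in> {v + s *\<^sub>R d1 | s. 0 \<le> s \<and> s < \<delta>} \<union> {v + s *\<^sub>R d2 | s. 0 \<le> s \<and> s < \<delta>}"
    then obtain s where s: "0 \<le> s" "s < \<delta>" "x = v + s *\<^sub>R d1 \<or> x = v + s *\<^sub>R d2" by blast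
    then have "x \<in> \<Gamma>"
      using small[OF s(1,2)] \<alpha>[of "s / norm a"] \<beta>[of "s / norm b"] by (auto simp: path_image_def intro: image_eqI[rotated])
    moreover have "dist v x < \<delta>" using s d by (auto simp: dist_norm)
    ultimately show "x \<in> \<Gamma> \<inter> ball v \<delta>" by simp
  qed
  then show ?thesis using that[of v d1 d2 \<delta>] v d(1,2) \<delta> vd d12 by (auto simp: subset_iff)
qed

end

lemma polygon_curve_polygon_loop:
  assumes "simple_polygon vs" shows "polygon_curve (polygon_loop vs)"
proof
  show "piecewise_affine (polygon_loop vs)"
    unfolding polygon_loop_def by (rule piecewise_affine_polygonal_path)
  show "simple_path (polygon_loop vs)" using assms by (simp add: simple_polygon_def)
  obtain a xs where "vs = a # xs" using assms by (cases vs) (auto simp: simple_polygon_def)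
  then show "pathfinish (polygon_loop vs) = pathstart (polygon_loop vs)"
    unfolding polygon_loop_def by (simp del: polygonal_path.simps add: polygonal_path_pathstart polygonal_path_pathfinish)
qed


section \<open>The singular harmonic function and a Green formula\<close>

lemma pderiv_dir_transform_open:
  assumes "open S" "x \<in> S" "\<And>y. y \<in> S \<Longrightarrow> f y = h y"
  shows "pderiv_dir b h x = pderiv_dir b f x" "h differentiable at x \<longleftrightarrow> f differentiable at x"
proof -
  have "(f has_derivative D) (at x) \<longleftrightarrow> (h has_derivative D) (at x)" for D
    using has_derivative_transform_within_open[OF _ assms(1,2), of f D UNIV h]
      has_derivative_transform_within_open[OF _ assms(1,2), of h D UNIV f] assms(3) by auto
  then show "pderiv_dir b h x = pderiv_dir b f x" "h differentiable at x \<longleftrightarrow> f differentiable at x"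
    by (auto simp: pderiv_dir_def frechet_derivative_def differentiable_def)
qed

lemma harmonic_on_transform:
  assumes h: "harmonic_on S h" and eq: "\<And>x. x \<in> S \<Longrightarrow> u x = h x"
  shows "harmonic_on S u"
proof -
  have S: "open S" using h by (simp add: harmonic_on_def)
  have 1: "x \<in> S \<Longrightarrow> pderiv_dir b u x = pderiv_dir b h x" "x \<in> S \<Longrightarrow> u differentiable at x \<longleftrightarrow> h differentiable at x" for x b
    using pderiv_dir_transform_open[OF S, of x h u] eq by auto
  have 2: "x \<in> S \<Longrightarrow> pderiv_dir c (pderiv_dir b u) x = pderiv_dir c (pderiv_dir b h) x"
    "x \<in> S \<Longrightarrow> pderiv_dir b u differentiable at x \<longleftrightarrow> pderiv_dir b h differentiable at x" for x b c
    using pderiv_dir_transform_open[OF S, of x "pderiv_dir b h" "pderiv_dir b u"] 1 by auto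
  show ?thesis
    using h unfolding harmonic_on_def laplacian_def
    by (auto simp: 1 2 cong: continuous_on_cong)
qed

lemma harmonic_on_Un:
  assumes "harmonic_on A u" "harmonic_on B u" shows "harmonic_on (A \<union> B) u"
  using assms unfolding harmonic_on_def by (auto intro: continuous_on_open_Un)

lemma pderiv_dir_Re_holomorphic:
  assumes "f holomorphic_on S" "open S" "x \<in> S"
  shows "((\<lambda>x. Re (f x)) has_derivative (\<lambda>b. Re (b * deriv f x))) (at x)"
proof -
  have "(f has_field_derivative deriv f x) (at x)"
    using assms by (meson holomorphic_derivI)
  then have "(f has_derivative (*) (deriv f x)) (at x)" by (simp add: has_field_derivative_def)
  from has_derivative_Re[OF this] show ?thesis by (simp add: mult.commute)
qed

lemma harmonic_on_Re_holomorphic: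
  assumes f: "f holomorphic_on S" and S: "open S"
  shows "harmonic_on S (\<lambda>x. Re (f x))"
proof -
  let ?h = "\<lambda>x. Re (f x)"
  have 1: "x \<in> S \<Longrightarrow> ?h differentiable at x" "x \<in> S \<Longrightarrow> pderiv_dir b ?h x = Re (b * deriv f x)" for x b
    using pderiv_dir_Re_holomorphic[OF f S] by (auto simp: differentiable_def intro: pderiv_dir_eqI)
  have f': "(\<lambda>x. b * deriv f x) holomorphic_on S" for b
    by (intro holomorphic_intros holomorphic_deriv f S)
  have d': "x \<in> S \<Longrightarrow> deriv (\<lambda>x. b * deriv f x) x = b * deriv (deriv f) x" for x b
    using holomorphic_on_imp_differentiable_at[OF holomorphic_deriv[OF f S] S] by (simp add: deriv_cmult)
  have 2: "pderiv_dir b ?h differentiable at x"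
    "pderiv_dir c (pderiv_dir b ?h) x = Re (c * (b * deriv (deriv f) x))" if x: "x \<in> S" for x b c
  proof -
    have D: "((\<lambda>x. Re (b * deriv f x)) has_derivative (\<lambda>c. Re (c * (b * deriv (deriv f) x)))) (at x)"
      using pderiv_dir_Re_holomorphic[OF f'[of b] S x] unfolding d'[OF x] .
    have eq: "Re (b * deriv f y) = pderiv_dir b ?h y" if "y \<in> S" for y using 1(2)[OF that] by simp
    show "pderiv_dir b ?h differentiable at x"
      using pderiv_dir_transform_open(2)[OF S x eq] D by (auto simp only: differentiable_def)
    show "pderiv_dir c (pderiv_dir b ?h) x = Re (c * (b * deriv (deriv f) x))"
      using pderiv_dir_transform_open(1)[OF S x eq, where b = c] pderiv_dir_eqI[OF D, of c] by (simp only:)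
  qed
  have "continuous_on S (deriv (deriv f))"
    by (intro holomorphic_on_imp_continuous_on holomorphic_deriv f S)
  then have "continuous_on S (pderiv_dir c (pderiv_dir b ?h))" for b c
    by (subst continuous_on_cong[OF refl 2(2)]) (auto intro!: continuous_intros)
  moreover have "laplacian ?h x = 0" if "x \<in> S" for x
    using 2(2)[OF that] by (simp add: laplacian_eq)
  ultimately show ?thesis using S 1(1) 2(1) by (simp add: harmonic_on_def)
qed

text \<open>Just square integrable at the origin: the modulus of \<open>1 / z\<close> fails to be so by a logarithm, and
  the factor \<open>1 / Ln\<close> saves the integral. On the other hand, its integral along a ray from the
  origin diverges like \<open>ln ln\<close>.\<close>

definition corner_sing :: "real \<Rightarrow> complex \<Rightarrow> complex" where
  "corner_sing R z = 1 / (z * Ln (z / of_real R))"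

definition slit_disc :: "real \<Rightarrow> complex set" where
  "slit_disc R = ball 0 R - \<real>\<^sub>\<le>\<^sub>0"

lemma open_slit_disc: "open (slit_disc R)"
  unfolding slit_disc_def by (intro open_Diff open_ball closed_nonpos_Reals_complex)

lemma slit_disc_props:
  assumes "z \<in> slit_disc R"
  shows "R > 0" "z \<noteq> 0" "norm z < R" "z / of_real R \<notin> \<real>\<^sub>\<le>\<^sub>0" "ln (R / norm z) > 0" "ln (R / norm z) \<le> norm (Ln (z / of_real R))"
    "Ln (z / of_real R) \<noteq> 0"
proof -
  have z: "norm z < R" "z \<notin> \<real>\<^sub>\<le>\<^sub>0" using assms by (auto simp: slit_disc_def)
  show R: "R > 0" using z(1) norm_ge_zero[of z] by linarith
  show z0: "z \<noteq> 0" using z(2) by auto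
  show "norm z < R" by (rule z(1))
  show "z / of_real R \<notin> \<real>\<^sub>\<le>\<^sub>0"
  proof
    assume "z / of_real R \<in> \<real>\<^sub>\<le>\<^sub>0"
    then have "Im z = 0" "Re z \<le> 0" using R by (auto simp: complex_nonpos_Reals_iff divide_le_0_iff)
    then show False using z(2) by (simp add: complex_nonpos_Reals_iff)
  qed
  show l: "ln (R / norm z) > 0" using z(1) z0 R by (intro ln_gt_zero) (simp add: less_divide_eq)
  have "Re (Ln (z / of_real R)) = ln (norm z / R)" using z0 R by (simp add: Re_Ln norm_divide)
  also have "\<dots> = - ln (R / norm z)" using z0 R by (simp add: ln_div)
  finally show le: "ln (R / norm z) \<le> norm (Ln (z / of_real R))"
    using abs_Re_le_cmod[of "Ln (z / of_real R)"] by simp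
  show "Ln (z / of_real R) \<noteq> 0" using l le by auto
qed

lemma corner_sing_holomorphic: "corner_sing R holomorphic_on slit_disc R"
  unfolding corner_sing_def[abs_def]
  by (intro holomorphic_intros) (auto dest: slit_disc_props)

lemma corner_sing_bound:
  assumes "z \<in> slit_disc R"
  shows "norm (corner_sing R z) \<le> 1 / (norm z * ln (R / norm z))"
  using slit_disc_props[OF assms] by (auto simp: corner_sing_def norm_divide norm_mult intro!: divide_left_mono mult_left_mono mult_pos_pos)

lemma corner_sing_real:
  assumes "0 < t" "t < R"
  shows "corner_sing R (of_real t) = of_real (- (1 / (t * ln (R / t))))"
proof -
  have "Ln (of_real t / of_real R) = of_real (ln (t / R))"
    using assms by (simp flip: of_real_divide add: Ln_of_real)
  also have "ln (t / R) = - ln (R / t)" using assms by (simp add: ln_div)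
  finally show ?thesis by (simp add: corner_sing_def)
qed

text \<open>The corner singularity placed at \<open>v\<close>, with the ray of direction \<open>d\<close> as the positive real axis,
  and cut off by the set \<open>\<Omega>\<close>.\<close>

definition singular_fun :: "complex set \<Rightarrow> complex \<Rightarrow> complex \<Rightarrow> real \<Rightarrow> complex \<Rightarrow> real" where
  "singular_fun \<Omega> v d R x = (if x \<in> \<Omega> then Re (corner_sing R (cnj d * (x - v))) else 0)"

lemma singular_fun_harmonic:
  assumes \<Omega>: "open \<Omega>" and slit: "\<And>x. x \<in> \<Omega> \<Longrightarrow> cnj d * (x - v) \<in> slit_disc R"
    and E: "open E" "E \<inter> \<Omega> = {}"
  shows "harmonic_on (\<Omega> \<union> E) (singular_fun \<Omega> v d R)"
proof (rule harmonic_on_Un)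
  have "(corner_sing R \<circ> (\<lambda>x. cnj d * (x - v))) holomorphic_on \<Omega>"
    by (rule holomorphic_on_compose_gen[OF _ corner_sing_holomorphic])
       (use slit in \<open>auto intro!: holomorphic_intros\<close>)
  then have "(\<lambda>x. corner_sing R (cnj d * (x - v))) holomorphic_on \<Omega>" by (simp add: o_def)
  then have "harmonic_on \<Omega> (\<lambda>x. Re (corner_sing R (cnj d * (x - v))))"
    by (rule harmonic_on_Re_holomorphic[OF _ \<Omega>])
  then show "harmonic_on \<Omega> (singular_fun \<Omega> v d R)"
    by (rule harmonic_on_transform) (simp add: singular_fun_def)
  have "harmonic_on E (\<lambda>x. Re 0)"
    by (rule harmonic_on_Re_holomorphic) (auto intro: holomorphic_intros E)
  then show "harmonic_on E (singular_fun \<Omega> v d R)"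
    by (rule harmonic_on_transform) (use E(2) in \<open>auto simp: singular_fun_def\<close>)
qed

lemma singular_fun_measurable:
  assumes \<Omega>: "open \<Omega>" and slit: "\<And>x. x \<in> \<Omega> \<Longrightarrow> cnj d * (x - v) \<in> slit_disc R"
  shows "singular_fun \<Omega> v d R \<in> borel_measurable borel"
proof -
  have "continuous_on \<Omega> (\<lambda>x. corner_sing R (cnj d * (x - v)))"
    by (rule continuous_on_compose2[OF holomorphic_on_imp_continuous_on[OF corner_sing_holomorphic]])
       (use slit in \<open>auto intro!: continuous_intros\<close>)
  then have "(\<lambda>x. indicator \<Omega> x *\<^sub>R Re (corner_sing R (cnj d * (x - v)))) \<in> borel_measurable borel"
    by (intro borel_measurable_continuous_on_indicator borel_open \<Omega> continuous_intros)
  also have "(\<lambda>x. indicator \<Omega> x *\<^sub>R Re (corner_sing R (cnj d * (x - v)))) = singular_fun \<Omega> v d R"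
    by (auto simp: singular_fun_def indicator_def)
  finally show ?thesis .
qed

text \<open>On the \<open>k\<close>-th dyadic annulus the square is of order \<open>4 ^ k / k\<^sup>2\<close>, while the area is of order \<open>4
  ^ - k\<close>.\<close>

lemma singular_fun_L2:
  assumes \<Omega>: "open \<Omega>" and slit: "\<And>x. x \<in> \<Omega> \<Longrightarrow> cnj d * (x - v) \<in> slit_disc R" and d: "norm d = 1"
    and small: "\<And>x. x \<in> \<Omega> \<Longrightarrow> norm (x - v) \<le> R / 2" and R: "R > 0"
  shows "singular_fun \<Omega> v d R \<in> L2 lborel"
proof -
  let ?u = "singular_fun \<Omega> v d R"
  note m [measurable] = singular_fun_measurable[OF \<Omega> slit]
  \<comment> \<open>zero for \<open>k = 0\<close>, in accordance with the support of \<open>singular_fun\<close> in a disc of radius \<open>R / 2\<close>\<close>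
  define a where "a k = 4 * 4 ^ k / (R\<^sup>2 * (real k * ln 2)\<^sup>2)" for k :: nat
  have "(\<integral>\<^sup>+y. ennreal ((?u (v + y))\<^sup>2) \<partial>lborel) < \<infinity>"
  proof (rule nn_integral_dyadic_annuli[OF _ R])
    show "(\<lambda>y. (?u (v + y))\<^sup>2) \<in> borel_measurable borel" by measurable
  next
    fix k and y :: complex assume y: "R / 2 ^ Suc k < norm y" "norm y \<le> R / 2 ^ k"
    show "(?u (v + y))\<^sup>2 \<le> a k"
    proof (cases "v + y \<in> \<Omega>")
      case True
      have "norm y \<le> R / 2" using small[OF True] by simp
      then have k: "k \<noteq> 0" using y R by (intro notI) simp
      have y0: "norm y > 0" using y R by (smt (verit) divide_pos_pos zero_less_power)
      have z: "cnj d * y \<in> slit_disc R" using slit[OF True] by simp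
      have nz: "norm (cnj d * y) = norm y" using d by (simp add: norm_mult)
      have "real k * ln 2 = ln (2 ^ k)" by (simp add: ln_realpow)
      also have "\<dots> \<le> ln (R / norm y)" using y y0 R by (intro ln_mono) (auto simp: field_simps)
      finally have l: "real k * ln 2 \<le> ln (R / norm y)" .
      have l0: "real k * ln 2 > 0" using k by simp
      have "\<bar>?u (v + y)\<bar> \<le> norm (corner_sing R (cnj d * y))"
        using True abs_Re_le_cmod by (simp add: singular_fun_def)
      also have "\<dots> \<le> 1 / (norm y * ln (R / norm y))" using corner_sing_bound[OF z] by (simp add: nz)
      also have "\<dots> \<le> 1 / (R / 2 ^ Suc k * (real k * ln 2))"
      proof (rule frac_le)
        show "0 < R / 2 ^ Suc k * (real k * ln 2)" using R by (intro mult_pos_pos[OF _ l0]) simp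
        show "R / 2 ^ Suc k * (real k * ln 2) \<le> norm y * ln (R / norm y)"
          using y y0 l l0 R by (intro mult_mono) auto
      qed auto
      finally have "\<bar>?u (v + y)\<bar>\<^sup>2 \<le> (1 / (R / 2 ^ Suc k * (real k * ln 2)))\<^sup>2"
        by (intro power_mono) auto
      also have "\<dots> = ((2::real) ^ Suc k)\<^sup>2 / (R\<^sup>2 * (real k * ln 2)\<^sup>2)"
        by (simp add: power_divide power_mult_distrib)
      also have "((2::real) ^ Suc k)\<^sup>2 = 4 * 4 ^ k"
        by (simp add: power2_eq_square flip: power_mult_distrib)
      finally show ?thesis by (simp add: a_def)
    qed (simp add: singular_fun_def a_def)
  next
    fix y :: complex assume "R < norm y"
    then have "v + y \<notin> \<Omega>" using small[of "v + y"] R by auto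
    then show "(?u (v + y))\<^sup>2 \<le> 0" by (simp add: singular_fun_def)
  next
    have "summable (\<lambda>k. 4 / (R\<^sup>2 * (ln 2)\<^sup>2) * inverse (real k ^ 2))"
      by (intro summable_mult inverse_power_summable) simp
    also have "(\<lambda>k. 4 / (R\<^sup>2 * (ln 2)\<^sup>2) * inverse (real k ^ 2)) = (\<lambda>k. a k / 4 ^ k)"
      by (simp add: a_def power_mult_distrib divide_inverse fun_eq_iff)
    finally show "summable (\<lambda>k. a k / 4 ^ k)" .
  qed (simp add: a_def)
  also have "(\<integral>\<^sup>+y. ennreal ((?u (v + y))\<^sup>2) \<partial>lborel) = (\<integral>\<^sup>+x. ennreal ((?u x)\<^sup>2) \<partial>distr lborel borel ((+) v))"
    by (rule nn_integral_distr[symmetric]) auto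
  finally have "(\<integral>\<^sup>+x. ennreal ((?u x)\<^sup>2) \<partial>lborel) < \<infinity>" by (simp only: lborel_distr_plus)
  then have "integrable lborel (\<lambda>x. (?u x)\<^sup>2)" by (intro integrableI_nonneg) auto
  then show ?thesis using m by (simp add: L2_def)
qed

lemma integral_complex:
  fixes h :: "complex \<Rightarrow> real"
  assumes h: "integrable lborel h"
  shows "(\<integral>z. h z \<partial>lborel) = (\<integral>y. \<integral>x. h (Complex x y) \<partial>lborel \<partial>lborel)"
    and "(\<integral>z. h z \<partial>lborel) = (\<integral>x. \<integral>y. h (Complex x y) \<partial>lborel \<partial>lborel)"
proof -
  have [measurable]: "h \<in> borel_measurable borel" using borel_measurable_integrable[OF h] by simp
  have i: "integrable (lborel \<Otimes>\<^sub>M lborel) (\<lambda>(x, y). h (Complex x y))"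
    using h by (subst (asm) lborel_complex_eq) (simp add: integrable_distr_eq split_beta')
  have eq: "(\<integral>z. h z \<partial>lborel) = (\<integral>p. h (Complex (fst p) (snd p)) \<partial>(lborel \<Otimes>\<^sub>M lborel))"
    by (subst lborel_complex_eq) (simp add: integral_distr split_beta')
  show "(\<integral>z. h z \<partial>lborel) = (\<integral>y. \<integral>x. h (Complex x y) \<partial>lborel \<partial>lborel)"
    unfolding eq using lborel_pair.integral_snd[OF i] by (simp add: split_beta')
  show "(\<integral>z. h z \<partial>lborel) = (\<integral>x. \<integral>y. h (Complex x y) \<partial>lborel \<partial>lborel)"
    unfolding eq using lborel_pair.integral_fst'[of "\<lambda>p. h (Complex (fst p) (snd p))"] i by (simp add: split_beta')
qed

text \<open>The components of the vector field \<open>V \<nabla>\<theta> - \<theta> \<nabla>V\<close>, whose divergence is \<open>V \<Delta>\<theta>\<close> when \<open>V\<close> is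
  harmonic.\<close>

lemma flux_derivative:
  assumes V: "harmonic_on S V" and t: "smooth_expr \<theta>" and b: "b \<in> Basis" and z: "z \<in> S"
  shows "(\<lambda>z. V z * pderiv_dir b \<theta> z - pderiv_dir b V z * \<theta> z) differentiable at z"
    and "pderiv_dir b (\<lambda>z. V z * pderiv_dir b \<theta> z - pderiv_dir b V z * \<theta> z) z
      = V z * pderiv_dir b (pderiv_dir b \<theta>) z - pderiv_dir b (pderiv_dir b V) z * \<theta> z"
proof -
  have d: "V differentiable at z" "pderiv_dir b V differentiable at z"
    using V b z by (auto simp: harmonic_on_def)
  note td = smooth_expr_differentiable[OF t] smooth_expr_differentiable[OF smooth_expr_pderiv_dir[OF t]]
  have "((\<lambda>z. V z * pderiv_dir b \<theta> z - pderiv_dir b V z * \<theta> z) has_derivative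
      (\<lambda>c. (V z * pderiv_dir c (pderiv_dir b \<theta>) z + pderiv_dir c V z * pderiv_dir b \<theta> z)
        - (pderiv_dir b V z * pderiv_dir c \<theta> z + pderiv_dir c (pderiv_dir b V) z * \<theta> z))) (at z)"
    by (intro has_derivative_diff has_derivative_mult pderiv_dir_has_derivative d td)
  then show "(\<lambda>z. V z * pderiv_dir b \<theta> z - pderiv_dir b V z * \<theta> z) differentiable at z"
    "pderiv_dir b (\<lambda>z. V z * pderiv_dir b \<theta> z - pderiv_dir b V z * \<theta> z) z
      = V z * pderiv_dir b (pderiv_dir b \<theta>) z - pderiv_dir b (pderiv_dir b V) z * \<theta> z"
    by (auto simp: differentiable_def pderiv_dir_eqI)
qed

lemma line_FTC:
  assumes C: "\<And>z. z \<in> S \<Longrightarrow> C differentiable at z" and cont: "continuous_on S (pderiv_dir b C)"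
    and ab: "a \<le> c" and seg: "\<And>t. a \<le> t \<Longrightarrow> t \<le> c \<Longrightarrow> p + t *\<^sub>R b \<in> S"
  shows "(\<integral>t. indicator {a..c} t * pderiv_dir b C (p + t *\<^sub>R b) \<partial>lborel) = C (p + c *\<^sub>R b) - C (p + a *\<^sub>R b)"
proof -
  have "(\<integral>t. indicator {a..c} t *\<^sub>R pderiv_dir b C (p + t *\<^sub>R b) \<partial>lborel) = C (p + c *\<^sub>R b) - C (p + a *\<^sub>R b)"
  proof (rule integral_FTC_Icc[OF ab])
    fix t assume "a \<le> t" "t \<le> c"
    from pderiv_dir_line[OF C[OF seg[OF this]]]
    show "((\<lambda>t. C (p + t *\<^sub>R b)) has_vector_derivative pderiv_dir b C (p + t *\<^sub>R b)) (at t within {a..c})"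
      unfolding has_real_derivative_iff_has_vector_derivative[symmetric] by (rule DERIV_subset) simp
  next
    show "continuous_on {a..c} (\<lambda>t. pderiv_dir b C (p + t *\<^sub>R b))"
      by (rule continuous_on_compose2[OF cont]) (use seg in \<open>auto intro!: continuous_intros\<close>)
  qed
  then show ?thesis by simp
qed

text \<open>Green's formula for the half-plane \<open>0 < \<sigma> Im z\<close>. The support of \<open>\<theta>\<close> lies in the interior of a
  rectangle on which \<open>V\<close> is harmonic, so the divergence of the flux can be integrated along lines:
  horizontal lines contribute nothing, and vertical lines leave the flux through the real axis,
  where \<open>\<theta>\<close> vanishes.\<close>

lemma half_plane_green:
  assumes V: "harmonic_on S V" and t: "smooth_expr \<theta>" and K: "closed K"
    and KQ: "\<And>z. z \<in> K \<Longrightarrow> a < Re z \<and> Re z < b \<and> - c < Im z \<and> Im z < c"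
    and QS: "\<And>z. a \<le> Re z \<Longrightarrow> Re z \<le> b \<Longrightarrow> - c \<le> Im z \<Longrightarrow> Im z \<le> c \<Longrightarrow> z \<in> S"
    and supp: "\<And>z. z \<notin> K \<Longrightarrow> \<theta> z = 0" and axis: "\<And>x. \<theta> (of_real x) = 0"
    and ab: "a < b" and c: "c > 0" and \<sigma>: "\<sigma> = 1 \<or> \<sigma> = (-1::real)"
  shows "(\<integral>z. (if 0 < \<sigma> * Im z then V z else 0) * laplacian \<theta> z \<partial>lborel)
    = - \<sigma> * (\<integral>x. indicator {a..b} x * (V (of_real x) * pderiv_dir \<i> \<theta> (of_real x)) \<partial>lborel)"
proof -
  define C where "C e z = V z * pderiv_dir e \<theta> z - pderiv_dir e V z * \<theta> z" for e z
  define D where "D e z = V z * pderiv_dir e (pderiv_dir e \<theta>) z - pderiv_dir e (pderiv_dir e V) z * \<theta> z" for e z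
  define Q where "Q = {z. a \<le> Re z \<and> Re z \<le> b \<and> - c \<le> Im z \<and> Im z \<le> c}"
  have QS': "Q \<subseteq> S" using QS by (auto simp: Q_def)
  have "Q = cbox (Complex a (- c)) (Complex b c)"
    by (auto simp: Q_def cbox_def Basis_complex_def)
  then have Qc: "compact Q" by simp
  have off: "\<theta> z = 0" "pderiv_dir e \<theta> z = 0" "pderiv_dir f (pderiv_dir e \<theta>) z = 0" if "z \<notin> K" for z e f
  proof -
    have o: "open (- K)" using K by (rule open_Compl)
    show "\<theta> z = 0" using supp that by simp
    have 1: "pderiv_dir e \<theta> y = 0" if "y \<notin> K" for y e
      using pderiv_dir_transform_open(1)[OF o, of y "\<lambda>_. 0" \<theta> e] supp that by simp
    then show "pderiv_dir e \<theta> z = 0" using that by simp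
    show "pderiv_dir f (pderiv_dir e \<theta>) z = 0"
      using pderiv_dir_transform_open(1)[OF o, of z "\<lambda>_. 0" "pderiv_dir e \<theta>" f] 1 that by simp
  qed
  have Coff: "C e z = 0" if "z \<notin> K" for e z using off[OF that] by (simp add: C_def)
  have Cd: "C e differentiable at z" and CD: "pderiv_dir e (C e) z = D e z" if "e \<in> {1, \<i>}" "z \<in> S" for e z
    using flux_derivative[OF V t _ that(2), of e] that(1) by (auto simp: C_def[abs_def] D_def Basis_complex_def)
  have Dc: "continuous_on S (D e)" if "e \<in> {1, \<i>}" for e
  proof -
    have "continuous_on S V"
      using V by (auto simp: harmonic_on_def intro: continuous_at_imp_continuous_on differentiable_imp_continuous_within)
    moreover have "continuous_on S (pderiv_dir e (pderiv_dir e V))"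
      using V that by (auto simp: harmonic_on_def Basis_complex_def)
    ultimately show ?thesis
      unfolding D_def[abs_def]
      by (intro continuous_on_diff continuous_on_mult smooth_expr_continuous[OF t]
          smooth_expr_continuous[OF smooth_expr_pderiv_dir[OF smooth_expr_pderiv_dir[OF t]]])
  qed
  have CDc: "continuous_on S (pderiv_dir e (C e))" if "e \<in> {1, \<i>}" for e
    using Dc[OF that] CD[OF that] by (subst continuous_on_cong[OF refl, of _ _ "D e"]) auto
  define I where "I e z = indicator {z. 0 < \<sigma> * Im z} z *\<^sub>R (indicator Q z *\<^sub>R D e z)" for e z
  have I: "integrable lborel (I e)" if "e \<in> {1, \<i>}" for e
    unfolding I_def
  proof (rule integrable_mult_indicator)
    have "open {z. 0 < \<sigma> * Im z}" by (intro open_Collect_less continuous_intros)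
    then show "{z. 0 < \<sigma> * Im z} \<in> sets lborel" by simp
    show "integrable lborel (\<lambda>z. indicator Q z *\<^sub>R D e z)"
      by (rule borel_integrable_compact[OF Qc continuous_on_subset[OF Dc[OF that] QS']])
  qed
  have "(if 0 < \<sigma> * Im z then V z else 0) * laplacian \<theta> z = I 1 z + I \<i> z" for z
  proof (cases "z \<in> Q")
    case True
    then have "laplacian V z = 0" using V QS' by (auto simp: harmonic_on_def)
    then have s: "pderiv_dir 1 (pderiv_dir 1 V) z = - pderiv_dir \<i> (pderiv_dir \<i> V) z" by (simp add: laplacian_eq)
    show ?thesis using True by (simp add: I_def D_def s laplacian_eq algebra_simps)
  next
    case False
    then have "z \<notin> K" using KQ[of z] by (auto simp: Q_def)
    then have "laplacian \<theta> z = 0" using off(3) by (simp add: laplacian_eq)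
    then show ?thesis using False by (simp add: I_def)
  qed
  then have split: "(\<integral>z. (if 0 < \<sigma> * Im z then V z else 0) * laplacian \<theta> z \<partial>lborel)
      = (\<integral>z. I 1 z \<partial>lborel) + (\<integral>z. I \<i> z \<partial>lborel)"
    using I by simp
  have I0: "I e (Complex x y) = 0" if "\<not> (0 < \<sigma> * y \<and> a \<le> x \<and> x \<le> b \<and> - c \<le> y \<and> y \<le> c)" for e x y
    using that by (auto simp: I_def Q_def indicator_def)
  have "(\<integral>x. I 1 (Complex x y) \<partial>lborel) = 0" for y
  proof (cases "0 < \<sigma> * y \<and> - c \<le> y \<and> y \<le> c")
    case True
    have p: "Complex 0 y + x *\<^sub>R 1 = Complex x y" for x by (simp add: complex_eq_iff)
    have seg: "a \<le> x \<Longrightarrow> x \<le> b \<Longrightarrow> Complex 0 y + x *\<^sub>R 1 \<in> S" for x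
      unfolding p using True QS by simp
    have "(\<integral>x. I 1 (Complex x y) \<partial>lborel) = (\<integral>x. indicator {a..b} x * pderiv_dir 1 (C 1) (Complex 0 y + x *\<^sub>R 1) \<partial>lborel)"
    proof (rule Bochner_Integration.integral_cong[OF refl])
      fix x
      show "I 1 (Complex x y) = indicator {a..b} x * pderiv_dir 1 (C 1) (Complex 0 y + x *\<^sub>R 1)"
      proof (cases "x \<in> {a..b}")
        case x: True
        then have "pderiv_dir 1 (C 1) (Complex 0 y + x *\<^sub>R 1) = D 1 (Complex x y)"
          using CD[of 1, OF _ seg] unfolding p by simp
        then show ?thesis using x True by (simp add: I_def Q_def)
      qed (use I0 in auto)
    qed
    also have "\<dots> = C 1 (Complex 0 y + b *\<^sub>R 1) - C 1 (Complex 0 y + a *\<^sub>R 1)"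
      using ab seg by (intro line_FTC[where S = S] Cd CDc) auto
    also have "\<dots> = 0"
    proof -
      have "Complex b y \<notin> K" "Complex a y \<notin> K" using KQ[of "Complex b y"] KQ[of "Complex a y"] by auto
      then show ?thesis unfolding p by (simp add: Coff)
    qed
    finally show ?thesis .
  next
    case False
    then have "I 1 (Complex x y) = 0" for x using I0 by blast
    then show ?thesis by simp
  qed
  then have I1: "(\<integral>z. I 1 z \<partial>lborel) = 0" using integral_complex(1)[OF I[of 1]] by simp
  have inner: "(\<integral>y. I \<i> (Complex x y) \<partial>lborel) = indicator {a..b} x * (- \<sigma> * (V (of_real x) * pderiv_dir \<i> \<theta> (of_real x)))" for x
  proof (cases "x \<in> {a..b}")
    case True
    \<comment> \<open>the part of the vertical side of the rectangle that lies in the half-plane\<close>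
    define l u where "l = (if \<sigma> = 1 then 0 else - c)" and "u = (if \<sigma> = 1 then c else 0)"
    have lu: "l < u" "- c \<le> l" "u \<le> c" using c by (auto simp: l_def u_def)
    have p: "of_real x + y *\<^sub>R \<i> = Complex x y" for y by (simp add: complex_eq_iff)
    have seg: "l \<le> y \<Longrightarrow> y \<le> u \<Longrightarrow> of_real x + y *\<^sub>R \<i> \<in> S" for y
      unfolding p using True QS lu by simp
    have "(\<integral>y. I \<i> (Complex x y) \<partial>lborel) = (\<integral>y. indicator {l..u} y * pderiv_dir \<i> (C \<i>) (of_real x + y *\<^sub>R \<i>) \<partial>lborel)"
    proof (rule integral_discrete_difference[of "{0}"])
      fix y :: real assume "y \<notin> {0}"
      then have cond: "0 < \<sigma> * y \<and> - c \<le> y \<and> y \<le> c \<longleftrightarrow> y \<in> {l..u}"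
        using \<sigma> c by (auto simp: l_def u_def)
      show "I \<i> (Complex x y) = indicator {l..u} y * pderiv_dir \<i> (C \<i>) (of_real x + y *\<^sub>R \<i>)"
      proof (cases "y \<in> {l..u}")
        case y: True
        then have "pderiv_dir \<i> (C \<i>) (of_real x + y *\<^sub>R \<i>) = D \<i> (Complex x y)"
          using CD[of \<i>, OF _ seg] unfolding p by simp
        then show ?thesis using y True cond by (simp add: I_def Q_def)
      next
        case y: False
        then have "I \<i> (Complex x y) = 0" using cond I0 by blast
        then show ?thesis using y by simp
      qed
    qed auto
    also have "\<dots> = C \<i> (of_real x + u *\<^sub>R \<i>) - C \<i> (of_real x + l *\<^sub>R \<i>)"
      using lu seg by (intro line_FTC[where S = S] Cd CDc) auto
    also have "\<dots> = - \<sigma> * C \<i> (of_real x)"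
    proof -
      have "Complex x c \<notin> K" "Complex x (- c) \<notin> K" using KQ[of "Complex x c"] KQ[of "Complex x (- c)"] by auto
      moreover have "of_real x = Complex x 0" by (simp add: complex_eq_iff)
      ultimately show ?thesis unfolding p using \<sigma> by (auto simp: Coff l_def u_def)
    qed
    also have "C \<i> (of_real x) = V (of_real x) * pderiv_dir \<i> \<theta> (of_real x)" by (simp add: C_def axis)
    finally show ?thesis using True by simp
  next
    case False
    then have "I \<i> (Complex x y) = 0" for y using I0 by auto
    then show ?thesis using False by simp
  qed
  have "(\<integral>z. I \<i> z \<partial>lborel) = (\<integral>x. - \<sigma> * (indicator {a..b} x * (V (of_real x) * pderiv_dir \<i> \<theta> (of_real x))) \<partial>lborel)"
    unfolding integral_complex(2)[OF I[of \<i>, simplified]] inner by (simp add: mult_ac)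
  also have "\<dots> = - \<sigma> * (\<integral>x. indicator {a..b} x * (V (of_real x) * pderiv_dir \<i> \<theta> (of_real x)) \<partial>lborel)"
    by (rule integral_mult_right_zero)
  finally show ?thesis unfolding split I1 by simp
qed


section \<open>Scale-invariant families of test functions\<close>

text \<open>The mixed derivatives cancel between the two directions \<open>a\<close>
  and \<open>a * \<i>\<close>.\<close>

lemma laplacian_isometry:
  assumes f: "smooth_expr f" and a: "norm a = 1"
  shows "laplacian (\<lambda>x. f (a * (x - v))) x = laplacian f (a * (x - v))"
proof -
  have p: "pderiv_dir b (\<lambda>x. h (a * (x - v))) = (\<lambda>x. pderiv_dir (a * b) h (a * (x - v)))" if "smooth_expr h" for b h
    by (intro ext pderiv_dir_affine smooth_expr_differentiable that)
  have dec: "pderiv_dir e h z = Re e * pderiv_dir 1 h z + Im e * pderiv_dir \<i> h z" if "smooth_expr h" for e h z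
    by (rule pderiv_dir_decompose[OF smooth_expr_differentiable[OF that]])
  have dec2: "pderiv_dir c (pderiv_dir e f) z = Re e * pderiv_dir c (pderiv_dir 1 f) z + Im e * pderiv_dir c (pderiv_dir \<i> f) z" for c e z
  proof -
    have "pderiv_dir e f = (\<lambda>z. Re e * pderiv_dir 1 f z + Im e * pderiv_dir \<i> f z)" by (rule ext) (rule dec[OF f])
    moreover have "((\<lambda>z. Re e * pderiv_dir 1 f z + Im e * pderiv_dir \<i> f z) has_derivative
        (\<lambda>c. Re e * pderiv_dir c (pderiv_dir 1 f) z + Im e * pderiv_dir c (pderiv_dir \<i> f) z)) (at z)"
      by (intro has_derivative_add has_derivative_mult_right pderiv_dir_has_derivative smooth_expr_differentiable smooth_expr_pderiv_dir f)
    ultimately show ?thesis by (simp add: pderiv_dir_eqI)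
  qed
  let ?z = "a * (x - v)"
  have n: "(Re a)\<^sup>2 + (Im a)\<^sup>2 = 1" using a by (metis cmod_power2 one_power2)
  let ?A = "pderiv_dir 1 (pderiv_dir 1 f) ?z" and ?B = "pderiv_dir \<i> (pderiv_dir \<i> f) ?z"
  have dec3: "pderiv_dir e (pderiv_dir e f) ?z = Re e * (Re e * ?A + Im e * pderiv_dir \<i> (pderiv_dir 1 f) ?z)
      + Im e * (Re e * pderiv_dir 1 (pderiv_dir \<i> f) ?z + Im e * ?B)" for e
    by (simp only: dec2[of e e] dec[OF smooth_expr_pderiv_dir[OF f, of 1], of e]
        dec[OF smooth_expr_pderiv_dir[OF f, of \<i>], of e])
  have "laplacian (\<lambda>x. f (a * (x - v))) x = pderiv_dir a (pderiv_dir a f) ?z + pderiv_dir (a * \<i>) (pderiv_dir (a * \<i>) f) ?z"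
    by (simp add: laplacian_eq p f smooth_expr_pderiv_dir)
  also have "\<dots> = ((Re a)\<^sup>2 + (Im a)\<^sup>2) * ?A + ((Re a)\<^sup>2 + (Im a)\<^sup>2) * ?B"
  proof -
    have alg: "Re a * (Re a * A + Im a * P) + Im a * (Re a * Q + Im a * B)
        + (Re (a * \<i>) * (Re (a * \<i>) * A + Im (a * \<i>) * P) + Im (a * \<i>) * (Re (a * \<i>) * Q + Im (a * \<i>) * B))
      = ((Re a)\<^sup>2 + (Im a)\<^sup>2) * A + ((Re a)\<^sup>2 + (Im a)\<^sup>2) * B" for A B P Q :: real
      by (simp add: power2_eq_square algebra_simps)
    show ?thesis unfolding dec3[of a] dec3[of "a * \<i>"] by (rule alg)
  qed
  finally show ?thesis by (simp add: n laplacian_eq)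
qed

text \<open>The scaling that leaves second derivatives invariant in \<open>L\<^sup>2\<close> of the plane.\<close>

definition rescaled :: "(complex \<Rightarrow> real) \<Rightarrow> complex \<Rightarrow> real \<Rightarrow> complex \<Rightarrow> real" where
  "rescaled \<Phi> v r x = r * \<Phi> (of_real (1 / r) * (x - v))"

text \<open>\<open>M\<close> bounds the function and its derivatives of order one and two, which is all that enters the
  norm of \<open>W\<^sup>2\<close>.\<close>

definition unit_bump :: "(complex \<Rightarrow> real) \<Rightarrow> real \<Rightarrow> bool" where
  "unit_bump \<Phi> M \<longleftrightarrow> smooth_expr \<Phi> \<and> (\<forall>z. 1 < norm z \<longrightarrow> \<Phi> z = 0) \<and> (\<forall>z. \<bar>\<Phi> z\<bar> \<le> M) \<and>
     (\<forall>z. \<forall>b\<in>{1, \<i>}. \<bar>pderiv_dir b \<Phi> z\<bar> \<le> M) \<and>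
     (\<forall>z. \<forall>b\<in>{1, \<i>}. \<forall>c\<in>{1, \<i>}. \<bar>pderiv_dir c (pderiv_dir b \<Phi>) z\<bar> \<le> M)"

text \<open>The second derivatives grow like \<open>1 / r\<close>, but only on a disc of radius \<open>r\<close>, so their \<open>L\<^sup>2\<close> norm
  does not depend on \<open>r\<close>.\<close>

lemma rescaled_props:
  assumes bump: "unit_bump \<Phi> M"
    and r: "0 < r" "r \<le> 1"
  shows "smooth_expr (rescaled \<Phi> v r)"
    and "\<bar>rescaled \<Phi> v r x\<bar> \<le> M * indicator (cball v 1) x"
    and "b \<in> {1, \<i>} \<Longrightarrow> \<bar>pderiv_dir b (rescaled \<Phi> v r) x\<bar> \<le> M * indicator (cball v 1) x"
    and "b \<in> {1, \<i>} \<Longrightarrow> c \<in> {1, \<i>} \<Longrightarrow>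
      \<bar>pderiv_dir c (pderiv_dir b (rescaled \<Phi> v r)) x\<bar> \<le> M / r * indicator (cball v r) x"
    and "r < norm (x - v) \<Longrightarrow> rescaled \<Phi> v r x = 0"
proof -
  have \<Phi>: "smooth_expr \<Phi>" and supp: "\<And>z. 1 < norm z \<Longrightarrow> \<Phi> z = 0"
    and M: "\<And>z. \<bar>\<Phi> z\<bar> \<le> M" "\<And>z b. b \<in> {1, \<i>} \<Longrightarrow> \<bar>pderiv_dir b \<Phi> z\<bar> \<le> M"
      "\<And>z b c. b \<in> {1, \<i>} \<Longrightarrow> c \<in> {1, \<i>} \<Longrightarrow> \<bar>pderiv_dir c (pderiv_dir b \<Phi>) z\<bar> \<le> M"
    using bump by (auto simp: unit_bump_def)
  let ?a = "of_real (1 / r) :: complex"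
  have M0: "M \<ge> 0" using M(1)[of 0] by linarith
  have na: "norm (?a * (x - v)) = norm (x - v) / r" for x using r by (simp add: norm_mult norm_divide)
  have supp': "pderiv_dir b \<Phi> z = 0" "pderiv_dir c (pderiv_dir b \<Phi>) z = 0" if "1 < norm z" for b c z
    using pderiv_dir_eq_0_off_support[OF supp that] pderiv_dir_eq_0_off_support[OF pderiv_dir_eq_0_off_support[OF supp] that] by auto
  have sc: "pderiv_dir (?a * b) h z = pderiv_dir b h z / r" if "smooth_expr h" for b h z
    using pderiv_dir_decompose[OF smooth_expr_differentiable[OF that], of "?a * b" z]
      pderiv_dir_decompose[OF smooth_expr_differentiable[OF that], of b z]
    by (simp add: Re_divide_of_real Im_divide_of_real add_divide_distrib)
  have cm: "pderiv_dir b (\<lambda>x. k * h x) = (\<lambda>x. k * pderiv_dir b h x)" if "smooth_expr h" for b k h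
    using pderiv_dir_mult[of "\<lambda>_. k" _ h b] smooth_expr_differentiable[OF that] by (auto simp: fun_eq_iff)
  show s: "smooth_expr (rescaled \<Phi> v r)"
    unfolding rescaled_def[abs_def] by (intro smooth_expr.mult smooth_expr.const smooth_expr_affine \<Phi>)
  have p1: "pderiv_dir b (rescaled \<Phi> v r) = (\<lambda>x. pderiv_dir b \<Phi> (?a * (x - v)))" for b
    unfolding rescaled_def[abs_def] cm[OF smooth_expr_affine[OF \<Phi>]]
    using r by (simp add: pderiv_dir_affine smooth_expr_differentiable \<Phi> sc fun_eq_iff del: of_real_divide)
  have p2: "pderiv_dir c (pderiv_dir b (rescaled \<Phi> v r)) = (\<lambda>x. pderiv_dir c (pderiv_dir b \<Phi>) (?a * (x - v)) / r)" for b c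
    unfolding p1
    by (simp add: pderiv_dir_affine smooth_expr_differentiable smooth_expr_pderiv_dir \<Phi> sc fun_eq_iff del: of_real_divide)
  have far: "1 < norm (?a * (x - v))" if "r < norm (x - v)" for x
    unfolding na using that r by (simp add: less_divide_eq)
  show "r < norm (x - v) \<Longrightarrow> rescaled \<Phi> v r x = 0"
    using far supp by (simp add: rescaled_def del: of_real_divide)
  show "\<bar>rescaled \<Phi> v r x\<bar> \<le> M * indicator (cball v 1) x"
  proof (cases "norm (x - v) \<le> r")
    case True
    have "\<bar>r\<bar> * \<bar>\<Phi> (?a * (x - v))\<bar> \<le> 1 * M" using r M by (intro mult_mono) auto
    then show ?thesis using True r by (simp add: rescaled_def abs_mult dist_norm norm_minus_commute del: of_real_divide)
  qed (use far supp M0 in \<open>simp add: rescaled_def del: of_real_divide\<close>)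
  show "\<bar>pderiv_dir b (rescaled \<Phi> v r) x\<bar> \<le> M * indicator (cball v 1) x" if "b \<in> {1, \<i>}"
  proof (cases "norm (x - v) \<le> r")
    case True
    then show ?thesis using M(2)[OF that] r by (simp add: p1 dist_norm norm_minus_commute del: of_real_divide)
  qed (use far supp' M0 in \<open>simp add: p1 del: of_real_divide\<close>)
  show "\<bar>pderiv_dir c (pderiv_dir b (rescaled \<Phi> v r)) x\<bar> \<le> M / r * indicator (cball v r) x"
    if "b \<in> {1, \<i>}" "c \<in> {1, \<i>}"
  proof (cases "norm (x - v) \<le> r")
    case True
    then show ?thesis using M(3)[OF that] r
      by (simp add: p2 dist_norm norm_minus_commute divide_right_mono del: of_real_divide)
  qed (use far supp' M0 r in \<open>simp add: p2 del: of_real_divide\<close>)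
qed

lemma integral_square_indicator_bound:
  fixes h :: "complex \<Rightarrow> real"
  assumes [measurable]: "h \<in> borel_measurable borel" and A: "A \<ge> 0" "B \<ge> 0" and r: "r \<ge> 0" "s \<ge> 0"
    and le: "\<And>x. \<bar>h x\<bar> \<le> A * indicator (cball v r) x + B * indicator (cball v s) x"
  shows "(\<integral>x. (h x)\<^sup>2 \<partial>lborel) \<le> 2 * pi * ((A * r)\<^sup>2 + (B * s)\<^sup>2)"
proof -
  let ?k = "\<lambda>x. 2 * A\<^sup>2 * indicator (cball v r) x + 2 * B\<^sup>2 * indicator (cball v s) x"
  have fin: "emeasure lborel (cball v t) < \<infinity>" for t by (rule emeasure_bounded_finite) simp
  have i: "integrable lborel ?k"
    by (intro Bochner_Integration.integrable_add integrable_mult_right integrable_real_indicator fin) auto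
  have sq: "(h x)\<^sup>2 \<le> ?k x" for x
  proof -
    let ?a = "A * indicator (cball v r) x" and ?b = "B * indicator (cball v s) x"
    have "(h x)\<^sup>2 \<le> (?a + ?b)\<^sup>2" using le[of x] power_mono[of "\<bar>h x\<bar>" "?a + ?b" 2] by simp
    also have "\<dots> \<le> 2 * ?a\<^sup>2 + 2 * ?b\<^sup>2" using sum_squares_bound[of ?a ?b] by (simp add: power2_sum)
    also have "\<dots> = ?k x" by (simp add: power_mult_distrib indicator_def)
    finally show ?thesis .
  qed
  have "(\<integral>x. (h x)\<^sup>2 \<partial>lborel) \<le> (\<integral>x. ?k x \<partial>lborel)"
    by (rule integral_mono[OF Bochner_Integration.integrable_bound[OF i] i sq]) (use sq in \<open>auto intro!: AE_I2 order_trans[OF sq abs_ge_self]\<close>)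
  also have "\<dots> = 2 * A\<^sup>2 * measure lborel (cball v r) + 2 * B\<^sup>2 * measure lborel (cball v s)"
    by (subst Bochner_Integration.integral_add) (auto intro!: integrable_mult_right integrable_real_indicator fin)
  also have "\<dots> = 2 * pi * ((A * r)\<^sup>2 + (B * s)\<^sup>2)"
    using r by (simp add: measure_def emeasure_cball_complex power_mult_distrib algebra_simps)
  finally show ?thesis .
qed

lemma lg_ge_half: "lg x \<ge> 1 / 2" and rho_ge_1: "rho x \<ge> 1"
proof -
  have "1 / 2 \<le> ln (2::real)" using ln_le_minus_one[of "1 / 2 :: real"] by (simp add: ln_div)
  also have "\<dots> \<le> lg x" unfolding lg_def by (intro ln_mono) auto
  finally show "lg x \<ge> 1 / 2" .
  show "rho x \<ge> 1" by (simp add: rho_def)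
qed

text \<open>Scale invariance: the bound holds for all radii. For \<open>s \<ll> r\<close>, this difference is an annular
  truncation of a function that is homogeneous of degree one, the critical degree for \<open>W\<^sup>2\<close> in the
  plane. The factor \<open>16\<close> absorbs the seven integrals in the norm.\<close>

lemma W2_norm_rescaled_difference:
  fixes v :: complex
  assumes bump: "unit_bump \<Phi> M"
    and r: "0 < r" "r \<le> 1" and s: "0 < s" "s \<le> 1" and M1: "16 * M \<le> 1"
  defines "\<psi> \<equiv> \<lambda>x. rescaled \<Phi> v r x - rescaled \<Phi> v s x"
  shows "W2_norm \<psi> (grad \<psi>) (hess \<psi>) \<le> 1"
proof -
  note R = rescaled_props[OF bump r] and S = rescaled_props[OF bump s]
  have "\<bar>\<Phi> 0\<bar> \<le> M" using bump by (simp add: unit_bump_def)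
  then have M0: "M \<ge> 0" by linarith
  have ps: "smooth_expr \<psi>" unfolding \<psi>_def by (intro smooth_expr_diff R(1) S(1))
  have pd: "pderiv_dir b (\<lambda>x. f x - h x) = (\<lambda>x. pderiv_dir b f x - pderiv_dir b h x)" if "smooth_expr f" "smooth_expr h" for b f h
    by (intro ext pderiv_dir_eqI has_derivative_diff pderiv_dir_has_derivative smooth_expr_differentiable that)
  have g: "pderiv_dir b \<psi> x = pderiv_dir b (rescaled \<Phi> v r) x - pderiv_dir b (rescaled \<Phi> v s) x" for b x
    unfolding \<psi>_def by (simp add: pd R(1) S(1))
  have hs: "pderiv_dir c (pderiv_dir b \<psi>) x = pderiv_dir c (pderiv_dir b (rescaled \<Phi> v r)) x - pderiv_dir c (pderiv_dir b (rescaled \<Phi> v s)) x" for b c x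
    unfolding \<psi>_def by (simp add: pd R(1) S(1) smooth_expr_pderiv_dir)
  have m: "\<psi> \<in> borel_measurable borel" "pderiv_dir b \<psi> \<in> borel_measurable borel" "pderiv_dir c (pderiv_dir b \<psi>) \<in> borel_measurable borel" for b c
    by (intro borel_measurable_continuous_onI smooth_expr_continuous smooth_expr_pderiv_dir ps)+
  have lgm: "lg \<in> borel_measurable borel" "rho \<in> borel_measurable borel"
    by (intro borel_measurable_continuous_onI continuous_lg continuous_rho)+
  note [measurable] = m lgm
  have weight: "\<bar>h / w\<bar> \<le> 2 * M * i + 2 * M * i" if "\<bar>h\<bar> \<le> M * i + M * i" "w \<ge> 1 / 2" for h w i :: real
  proof -
    have "\<bar>h / w\<bar> \<le> \<bar>h\<bar> / (1 / 2)" unfolding abs_divide using that by (intro frac_le) auto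
    also have "\<dots> = 2 * \<bar>h\<bar>" by simp
    also have "\<dots> \<le> 2 * (M * i + M * i)" using that(1) by simp
    finally show ?thesis by (simp add: algebra_simps)
  qed
  have w2: "(rho x)\<^sup>2 * lg x \<ge> 1 / 2" "rho x * lg x \<ge> 1 / 2" for x
  proof -
    have "1 * (1 / 2) \<le> (rho x)\<^sup>2 * lg x" using rho_ge_1[of x] lg_ge_half[of x] by (intro mult_mono) (auto simp: one_le_power)
    then show "(rho x)\<^sup>2 * lg x \<ge> 1 / 2" by simp
    have "1 * (1 / 2) \<le> rho x * lg x" using rho_ge_1[of x] lg_ge_half[of x] by (intro mult_mono) auto
    then show "rho x * lg x \<ge> 1 / 2" by simp
  qed
  have "(\<integral>x. (\<psi> x / ((rho x)\<^sup>2 * lg x))\<^sup>2 \<partial>lborel) \<le> 2 * pi * ((2 * M * 1)\<^sup>2 + (2 * M * 1)\<^sup>2)"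
  proof (rule integral_square_indicator_bound[where v = v])
    show "\<bar>\<psi> x / ((rho x)\<^sup>2 * lg x)\<bar> \<le> 2 * M * indicator (cball v 1) x + 2 * M * indicator (cball v 1) x" for x
    proof (rule weight[OF _ w2(1)])
      show "\<bar>\<psi> x\<bar> \<le> M * indicator (cball v 1) x + M * indicator (cball v 1) x"
        using R(2)[of v x] S(2)[of v x] unfolding \<psi>_def by linarith
    qed
  qed (use M0 in auto)
  then have 1: "(\<integral>x. (\<psi> x / ((rho x)\<^sup>2 * lg x))\<^sup>2 \<partial>lborel) \<le> 16 * pi * M\<^sup>2" by (simp add: power2_eq_square)
  have 2: "(\<integral>x. (pderiv_dir b \<psi> x / (rho x * lg x))\<^sup>2 \<partial>lborel) \<le> 16 * pi * M\<^sup>2" if b: "b \<in> {1, \<i>}" for b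
  proof -
    have "(\<integral>x. (pderiv_dir b \<psi> x / (rho x * lg x))\<^sup>2 \<partial>lborel) \<le> 2 * pi * ((2 * M * 1)\<^sup>2 + (2 * M * 1)\<^sup>2)"
    proof (rule integral_square_indicator_bound[where v = v])
      show "\<bar>pderiv_dir b \<psi> x / (rho x * lg x)\<bar> \<le> 2 * M * indicator (cball v 1) x + 2 * M * indicator (cball v 1) x" for x
      proof (rule weight[OF _ w2(2)])
        show "\<bar>pderiv_dir b \<psi> x\<bar> \<le> M * indicator (cball v 1) x + M * indicator (cball v 1) x"
          using R(3)[OF b, of v x] S(3)[OF b, of v x] unfolding g by linarith
      qed
    qed (use M0 in auto)
    then show ?thesis by (simp add: power2_eq_square)
  qed
  have 3: "(\<integral>x. (pderiv_dir c (pderiv_dir b \<psi>) x)\<^sup>2 \<partial>lborel) \<le> 4 * pi * M\<^sup>2" if b: "b \<in> {1, \<i>}" "c \<in> {1, \<i>}" for b c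
  proof -
    have "(\<integral>x. (pderiv_dir c (pderiv_dir b \<psi>) x)\<^sup>2 \<partial>lborel) \<le> 2 * pi * ((M / r * r)\<^sup>2 + (M / s * s)\<^sup>2)"
    proof (rule integral_square_indicator_bound[where v = v])
      show "\<bar>pderiv_dir c (pderiv_dir b \<psi>) x\<bar> \<le> M / r * indicator (cball v r) x + M / s * indicator (cball v s) x" for x
        using R(4)[OF b, of v x] S(4)[OF b, of v x] unfolding hs by linarith
    qed (use M0 r s in auto)
    then show ?thesis using r s by simp
  qed
  have "(LINT x|lborel. (\<psi> x / ((rho x)\<^sup>2 * lg x))\<^sup>2) +
     (\<Sum>b\<in>Basis. LINT x|lborel. (pderiv_dir b \<psi> x / (rho x * lg x))\<^sup>2) +
     (\<Sum>b\<in>Basis. \<Sum>c\<in>Basis. LINT x|lborel. (pderiv_dir c (pderiv_dir b \<psi>) x)\<^sup>2)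
     \<le> 16 * pi * M\<^sup>2 + (\<Sum>b\<in>{1, \<i>}. 16 * pi * M\<^sup>2) + (\<Sum>b\<in>{1, \<i>}. \<Sum>c\<in>{1, \<i>}. 4 * pi * M\<^sup>2)"
    unfolding Basis_complex_def by (intro add_mono sum_mono 1 2 3)
  also have "\<dots> = pi * (64 * M\<^sup>2)" by simp
  also have "\<dots> \<le> 4 * (1 / 4)"
  proof (intro mult_mono)
    have "(16 * M)\<^sup>2 \<le> 1\<^sup>2" using M0 M1 by (intro power_mono) auto
    then show "64 * M\<^sup>2 \<le> 1 / 4" by (simp add: power_mult_distrib)
  qed (use pi_less_4 in auto)
  finally show ?thesis unfolding W2_norm_def by simp
qed


section \<open>Cutoff functions along a ray\<close>

definition annulus_cutoff :: "real \<Rightarrow> real \<Rightarrow> complex \<Rightarrow> real" where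
  "annulus_cutoff \<delta> \<epsilon> z = cutoff ((norm z)\<^sup>2 / \<delta>\<^sup>2) - cutoff ((norm z)\<^sup>2 / \<epsilon>\<^sup>2)"

text \<open>Supported in a thin half-strip around the positive real axis and equal to one on that axis
  beyond \<open>\<epsilon> / 2\<close>.\<close>

definition ray_cutoff :: "real \<Rightarrow> real \<Rightarrow> complex \<Rightarrow> real" where
  "ray_cutoff \<eta> \<epsilon> z = (1 - cutoff (2 * Re z / \<epsilon>)) * cutoff ((Im z)\<^sup>2 / \<eta>\<^sup>2)"

lemma cutoff_square_eq_0: "0 < r \<Longrightarrow> r \<le> \<bar>s\<bar> \<Longrightarrow> cutoff (s\<^sup>2 / r\<^sup>2) = 0"
  using power_mono[of r "\<bar>s\<bar>" 2] by (intro cutoff_eq_0) simp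

lemma cutoff_square_eq_1: "0 < r \<Longrightarrow> \<bar>s\<bar> \<le> r / 2 \<Longrightarrow> cutoff (s\<^sup>2 / r\<^sup>2) = 1"
  using power_mono[of "\<bar>s\<bar>" "r / 2" 2] by (intro cutoff_eq_1) (simp add: power_divide divide_le_eq)

lemma smooth_expr_scaled_square: "smooth_expr f \<Longrightarrow> smooth_expr (\<lambda>z. (f z)\<^sup>2 / c)"
  unfolding power2_eq_square divide_inverse by (intro smooth_expr.mult smooth_expr.const)

lemma smooth_expr_annulus_cutoff: "smooth_expr (annulus_cutoff \<delta> \<epsilon>)"
  unfolding annulus_cutoff_def[abs_def] divide_inverse
  by (intro smooth_expr_diff smooth_expr_cutoff smooth_expr.mult smooth_expr_norm2 smooth_expr.const)

lemma smooth_expr_ray_cutoff: "smooth_expr (ray_cutoff \<eta> \<epsilon>)"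
proof -
  have "smooth_expr (\<lambda>z. 2 * Re z / \<epsilon>)"
    unfolding divide_inverse by (intro smooth_expr.mult smooth_expr.const smooth_expr.re)
  then show ?thesis unfolding ray_cutoff_def[abs_def]
    by (intro smooth_expr.mult smooth_expr_diff smooth_expr.const smooth_expr_cutoff
        smooth_expr_scaled_square smooth_expr.im)
qed

lemma annulus_cutoff_values:
  assumes "0 < \<epsilon>" "\<epsilon> \<le> \<delta> / 2"
  shows "0 \<le> annulus_cutoff \<delta> \<epsilon> z"
    and "\<delta> \<le> norm z \<Longrightarrow> annulus_cutoff \<delta> \<epsilon> z = 0"
    and "norm z \<le> \<epsilon> / 2 \<Longrightarrow> annulus_cutoff \<delta> \<epsilon> z = 0"
    and "\<epsilon> \<le> norm z \<Longrightarrow> norm z \<le> \<delta> / 2 \<Longrightarrow> annulus_cutoff \<delta> \<epsilon> z = 1"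
proof -
  have \<delta>: "\<delta> > 0" using assms by linarith
  show "0 \<le> annulus_cutoff \<delta> \<epsilon> z"
  proof (cases "norm z \<le> \<delta> / 2")
    case True
    then show ?thesis using \<delta> cutoff_bounds by (simp add: annulus_cutoff_def cutoff_square_eq_1)
  next
    case False
    then have "cutoff ((norm z)\<^sup>2 / \<epsilon>\<^sup>2) = 0" using assms by (intro cutoff_square_eq_0) auto
    then show ?thesis using cutoff_bounds by (simp add: annulus_cutoff_def)
  qed
  show "\<delta> \<le> norm z \<Longrightarrow> annulus_cutoff \<delta> \<epsilon> z = 0"
    using assms \<delta> by (simp add: annulus_cutoff_def cutoff_square_eq_0)
  show "norm z \<le> \<epsilon> / 2 \<Longrightarrow> annulus_cutoff \<delta> \<epsilon> z = 0"
    using assms \<delta> by (simp add: annulus_cutoff_def cutoff_square_eq_1)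
  show "\<epsilon> \<le> norm z \<Longrightarrow> norm z \<le> \<delta> / 2 \<Longrightarrow> annulus_cutoff \<delta> \<epsilon> z = 1"
    using assms \<delta> by (simp add: annulus_cutoff_def cutoff_square_eq_0 cutoff_square_eq_1)
qed

lemma ray_cutoff_values:
  assumes "0 < \<epsilon>" "0 < \<eta>"
  shows "0 \<le> ray_cutoff \<eta> \<epsilon> z"
    and "Re z \<le> \<epsilon> / 8 \<or> \<eta> \<le> \<bar>Im z\<bar> \<Longrightarrow> ray_cutoff \<eta> \<epsilon> z = 0"
    and "\<epsilon> / 2 \<le> t \<Longrightarrow> ray_cutoff \<eta> \<epsilon> (of_real t) = 1"
proof -
  show "0 \<le> ray_cutoff \<eta> \<epsilon> z" using cutoff_bounds by (simp add: ray_cutoff_def)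
  show "Re z \<le> \<epsilon> / 8 \<or> \<eta> \<le> \<bar>Im z\<bar> \<Longrightarrow> ray_cutoff \<eta> \<epsilon> z = 0"
    using assms cutoff_square_eq_0[of \<eta> "Im z"] cutoff_eq_1[of "2 * Re z / \<epsilon>"]
    by (auto simp: ray_cutoff_def divide_le_eq)
  show "\<epsilon> / 2 \<le> t \<Longrightarrow> ray_cutoff \<eta> \<epsilon> (of_real t) = 1"
    using assms cutoff_eq_0[of "2 * t / \<epsilon>"] cutoff_eq_1[of 0] by (simp add: ray_cutoff_def le_divide_eq)
qed

lemma pderiv_dir_even_eq_0:
  assumes f: "f differentiable at y" and even: "\<And>t. f (y + (- t) *\<^sub>R n) = f (y + t *\<^sub>R n)"
  shows "pderiv_dir n f y = 0"
proof -
  have d: "((\<lambda>t. f (y + t *\<^sub>R n)) has_real_derivative pderiv_dir n f y) (at 0)"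
    using pderiv_dir_line[of f y 0 n] f by simp
  then have "((\<lambda>t. f (y + t *\<^sub>R n)) has_real_derivative pderiv_dir n f y) (at (- 0))" by simp
  then have "((\<lambda>t. f (y + (- t) *\<^sub>R n)) has_real_derivative - pderiv_dir n f y) (at 0)"
    by (subst (asm) DERIV_mirror)
  then have "((\<lambda>t. f (y + t *\<^sub>R n)) has_real_derivative - pderiv_dir n f y) (at 0)" unfolding even .
  from DERIV_unique[OF d this] show ?thesis by simp
qed

text \<open>The squared distance from \<open>v\<close> is even along a line that is orthogonal to \<open>y - v\<close> at \<open>y\<close>.\<close>

lemma pderiv_dir_annulus_cutoff_tangential:
  assumes "(y - v) \<bullet> n = 0"
  shows "pderiv_dir n (\<lambda>x. annulus_cutoff \<delta> \<epsilon> (x - v)) y = 0"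
proof (rule pderiv_dir_even_eq_0)
  show "(\<lambda>x. annulus_cutoff \<delta> \<epsilon> (x - v)) differentiable at y"
    by (rule smooth_expr_differentiable[OF smooth_expr_translate[OF smooth_expr_annulus_cutoff]])
  fix t
  have gen: "(norm (z + s *\<^sub>R n))\<^sup>2 = (norm z)\<^sup>2 + s\<^sup>2 * (n \<bullet> n)" if "z \<bullet> n = 0" for z :: complex and s
    using that unfolding power2_norm_eq_inner inner_add_left inner_add_right inner_scaleR_left inner_scaleR_right
    by (simp add: inner_commute[of n z] power2_eq_square)
  have "(norm (y + s *\<^sub>R n - v))\<^sup>2 = (norm (y - v))\<^sup>2 + s\<^sup>2 * (n \<bullet> n)" for s
    using gen[OF assms, of s] by (simp only: add_diff_eq diff_add_eq)
  from this[of t] this[of "- t"] show "annulus_cutoff \<delta> \<epsilon> (y + (- t) *\<^sub>R n - v) = annulus_cutoff \<delta> \<epsilon> (y + t *\<^sub>R n - v)"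
    by (simp only: annulus_cutoff_def power2_minus)
qed

lemma loglog_integral:
  fixes p q R :: real
  assumes "0 < p" "p \<le> q" "q < R"
  shows "integrable lborel (\<lambda>t. indicator {p..q} t * (1 / (t * ln (R / t))))"
    and "(\<integral>t. indicator {p..q} t * (1 / (t * ln (R / t))) \<partial>lborel) = ln (ln (R / p)) - ln (ln (R / q))"
proof -
  have pos: "0 < t" "ln R - ln t > 0" "ln (R / t) = ln R - ln t" if "p \<le> t" "t \<le> q" for t
  proof -
    show t: "0 < t" using that assms by linarith
    show "ln R - ln t > 0" using that assms t by simp
    show "ln (R / t) = ln R - ln t" using that assms t by (simp add: ln_div)
  qed
  have D: "((\<lambda>t. - ln (ln R - ln t)) has_vector_derivative 1 / (t * (ln R - ln t))) (at t within {p..q})"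
    if t: "p \<le> t" "t \<le> q" for t
  proof -
    have "((\<lambda>t. - ln (ln R - ln t)) has_real_derivative - ((1 / (ln R - ln t)) * (0 - 1 / t))) (at t)"
      using pos(1,2)[OF t] by (intro derivative_intros DERIV_chain2[OF DERIV_ln_divide] DERIV_ln_divide) auto
    then have "((\<lambda>t. - ln (ln R - ln t)) has_real_derivative 1 / (t * (ln R - ln t))) (at t)"
      by (simp add: mult.commute)
    then show ?thesis
      unfolding has_real_derivative_iff_has_vector_derivative[symmetric] by (rule DERIV_subset) simp
  qed
  have "continuous_on {p..q} (\<lambda>t. 1 / (t * (ln R - ln t)))"
  proof (intro continuous_intros ballI)
    fix t assume "t \<in> {p..q}"
    then show "t \<noteq> 0" "t * (ln R - ln t) \<noteq> 0" using pos(1,2)[of t] by auto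
  qed
  from has_bochner_integral_FTC_Icc[OF assms(2) D this]
  have "has_bochner_integral lborel (\<lambda>t. indicator {p..q} t *\<^sub>R (1 / (t * (ln R - ln t)))) (ln (ln (R / p)) - ln (ln (R / q)))"
    using pos(3)[of p] pos(3)[of q] assms by simp
  also have "(\<lambda>t. indicator {p..q} t *\<^sub>R (1 / (t * (ln R - ln t)))) = (\<lambda>t. indicator {p..q} t * (1 / (t * ln (R / t))))"
    using pos(3) by (auto simp: indicator_def)
  finally have "has_bochner_integral lborel (\<lambda>t. indicator {p..q} t * (1 / (t * ln (R / t)))) (ln (ln (R / p)) - ln (ln (R / q)))" .
  then show "integrable lborel (\<lambda>t. indicator {p..q} t * (1 / (t * ln (R / t))))"
    "(\<integral>t. indicator {p..q} t * (1 / (t * ln (R / t))) \<partial>lborel) = ln (ln (R / p)) - ln (ln (R / q))"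
    by (auto simp: has_bochner_integral_iff)
qed

lemma unit_bump_exists:
  fixes e :: complex
  shows "\<exists>\<mu>>0. unit_bump (\<lambda>z. \<mu> * (z \<bullet> e * cutoff ((norm z)\<^sup>2))) (1 / 16)"
proof -
  define f where "f z = z \<bullet> e * cutoff ((norm z)\<^sup>2)" for z
  have f: "smooth_expr f"
    unfolding f_def[abs_def] inner_complex_def
    by (intro smooth_expr.mult smooth_expr.add smooth_expr_cutoff smooth_expr_norm2 smooth_expr.intros)
  have supp: "f z = 0" if "1 < norm z" for z
    using cutoff_square_eq_0[of 1 "norm z"] that by (simp add: f_def)
  have supp1: "pderiv_dir b f z = 0" if "1 < norm z" for b z
    using pderiv_dir_eq_0_off_support[OF supp that] .
  have supp2: "pderiv_dir c (pderiv_dir b f) z = 0" if "1 < norm z" for b c z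
    using pderiv_dir_eq_0_off_support[OF supp1 that] .
  have bnd: "\<exists>C>0. \<forall>z. \<bar>h z\<bar> \<le> C" if "smooth_expr h" "\<And>z. 1 < norm z \<Longrightarrow> h z = 0" for h
    using bounded_continuous_compact_support[OF smooth_expr_continuous[OF that(1)] that(2)] by metis
  obtain C0 where C0: "C0 > 0" "\<And>z. \<bar>f z\<bar> \<le> C0" using bnd[OF f supp] by blast
  have "\<forall>b. \<exists>C>0. \<forall>z. \<bar>pderiv_dir b f z\<bar> \<le> C" using bnd[OF smooth_expr_pderiv_dir[OF f] supp1] by blast
  then obtain C1 where C1: "\<And>b. C1 b > 0" "\<And>b z. \<bar>pderiv_dir b f z\<bar> \<le> C1 b" by metis
  have "\<forall>b c. \<exists>C>0. \<forall>z. \<bar>pderiv_dir c (pderiv_dir b f) z\<bar> \<le> C"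
    using bnd[OF smooth_expr_pderiv_dir[OF smooth_expr_pderiv_dir[OF f]] supp2] by blast
  then obtain C2 where C2: "\<And>b c. C2 b c > 0" "\<And>b c z. \<bar>pderiv_dir c (pderiv_dir b f) z\<bar> \<le> C2 b c" by metis
  define M where "M = C0 + C1 1 + C1 \<i> + C2 1 1 + C2 1 \<i> + C2 \<i> 1 + C2 \<i> \<i>"
  have pos: "C1 1 > 0" "C1 \<i> > 0" "C2 1 1 > 0" "C2 1 \<i> > 0" "C2 \<i> 1 > 0" "C2 \<i> \<i> > 0" using C1 C2 by auto
  have M: "M > 0" using pos C0 by (simp add: M_def)
  have bM: "\<bar>f z\<bar> \<le> M" "b \<in> {1, \<i>} \<Longrightarrow> \<bar>pderiv_dir b f z\<bar> \<le> M"
    "b \<in> {1, \<i>} \<Longrightarrow> c \<in> {1, \<i>} \<Longrightarrow> \<bar>pderiv_dir c (pderiv_dir b f) z\<bar> \<le> M" for b c z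
    using C0(2)[of z] C1(2)[of b z] C2(2)[of c b z] pos C0(1) unfolding M_def by auto
  define \<mu> where "\<mu> = 1 / (16 * M)"
  have \<mu>: "\<mu> > 0" "\<mu> * M = 1 / 16" using M by (auto simp: \<mu>_def)
  have cm: "pderiv_dir b (\<lambda>x. \<mu> * h x) = (\<lambda>x. \<mu> * pderiv_dir b h x)" if "smooth_expr h" for b h
    using pderiv_dir_mult[of "\<lambda>_. \<mu>" _ h b] smooth_expr_differentiable[OF that] by (auto simp: fun_eq_iff)
  have scale: "\<bar>\<mu> * k\<bar> \<le> 1 / 16" if "\<bar>k\<bar> \<le> M" for k
    unfolding \<mu>(2)[symmetric] abs_mult using \<mu>(1) that by simp
  have "unit_bump (\<lambda>z. \<mu> * f z) (1 / 16)"
    unfolding unit_bump_def cm[OF f] cm[OF smooth_expr_pderiv_dir[OF f]]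
    using supp bM by (intro conjI allI ballI impI scale smooth_expr.mult smooth_expr.const f) auto
  then show ?thesis using \<mu>(1) by (auto simp: f_def)
qed


section \<open>The corner argument\<close>

context polygon_curve
begin

text \<open>In coordinates centred at the corner \<open>v\<close> in which the edge of direction \<open>d\<close> is the positive real
  axis, a sufficiently thin sector around that axis meets the curve in the axis only, and the
  curve separates its two halves. The sign \<open>\<sigma>\<close> tells which half is inside.\<close>

lemma corner_sector:
  assumes corner: "\<Gamma> \<inter> ball v \<delta> = {v + s *\<^sub>R d1 | s. 0 \<le> s \<and> s < \<delta>} \<union> {v + s *\<^sub>R d | s. 0 \<le> s \<and> s < \<delta>}"
    and d1: "norm d1 = 1" and d: "norm d = 1" and w: "Im (d1 * cnj d) \<noteq> 0" and \<delta>: "\<delta> > 0"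
  obtains \<kappa> \<sigma> where "0 < \<kappa>" "\<kappa> \<le> 1" "\<sigma> = 1 \<or> \<sigma> = (-1::real)"
    "\<And>z. norm z < \<delta> \<Longrightarrow> \<bar>Im z\<bar> < \<kappa> * Re z \<Longrightarrow> v + d * z \<in> \<Gamma> \<longleftrightarrow> Im z = 0"
    "\<And>z. norm z < \<delta> \<Longrightarrow> \<bar>Im z\<bar> < \<kappa> * Re z \<Longrightarrow> 0 < \<sigma> * Im z \<Longrightarrow> v + d * z \<in> inside \<Gamma>"
    "\<And>z. norm z < \<delta> \<Longrightarrow> \<bar>Im z\<bar> < \<kappa> * Re z \<Longrightarrow> \<sigma> * Im z < 0 \<Longrightarrow> v + d * z \<in> outside \<Gamma>"
proof -
  define w where "w = d1 * cnj d"
  have dd: "d * cnj d = 1" using d by (simp add: complex_norm_square[symmetric])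
  have d1w: "d1 = d * w" using dd by (simp add: w_def mult.left_commute)
  have dist: "dist v (v + d * z) = norm z" for z using d by (simp add: dist_norm norm_mult)
  have dnz: "d \<noteq> 0" using d by auto
  \<comment> \<open>the slope of the first edge, if that edge points into the right half-plane\<close>
  define \<kappa> where "\<kappa> = min 1 (if Re w > 0 then \<bar>Im w\<bar> / Re w else 1)"
  have \<kappa>: "0 < \<kappa>" "\<kappa> \<le> 1" using w by (auto simp: \<kappa>_def w_def[symmetric])
  have sector: "v + d * z \<in> \<Gamma> \<longleftrightarrow> Im z = 0" if z: "norm z < \<delta>" "\<bar>Im z\<bar> < \<kappa> * Re z" for z
  proof -
    have Rez: "Re z > 0" using z(2) \<kappa>(1) by (smt (verit) zero_less_mult_pos)
    have "v + d * z \<in> \<Gamma> \<longleftrightarrow> v + d * z \<in> \<Gamma> \<inter> ball v \<delta>" using z(1) dist by simp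
    also have "\<dots> \<longleftrightarrow> (\<exists>s. 0 \<le> s \<and> s < \<delta> \<and> (z = s *\<^sub>R w \<or> z = of_real s))"
    proof -
      have "v + d * z = v + s *\<^sub>R d1 \<longleftrightarrow> z = s *\<^sub>R w" "v + d * z = v + s *\<^sub>R d \<longleftrightarrow> z = of_real s" for s
        using dnz by (auto simp: d1w scaleR_conv_of_real mult.left_commute[of _ d] mult.commute[of _ d])
      then show ?thesis unfolding corner by auto
    qed
    also have "\<dots> \<longleftrightarrow> Im z = 0"
    proof
      assume "\<exists>s. 0 \<le> s \<and> s < \<delta> \<and> (z = s *\<^sub>R w \<or> z = of_real s)"
      then obtain s where s: "0 \<le> s" "z = s *\<^sub>R w \<or> z = of_real s" by blast
      from s(2) show "Im z = 0"
      proof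
        assume zw: "z = s *\<^sub>R w"
        then have "s * Re w > 0" using Rez by simp
        then have "s > 0" "Re w > 0" using s(1) by (auto simp: zero_less_mult_iff)
        then have "\<kappa> * Re w \<le> \<bar>Im w\<bar>" by (auto simp: \<kappa>_def min_def field_simps)
        then have "s * (\<kappa> * Re w) \<le> s * \<bar>Im w\<bar>" using s(1) by (intro mult_left_mono) auto
        then have "\<kappa> * Re z \<le> \<bar>Im z\<bar>" using s(1) by (simp add: zw abs_mult mult.left_commute)
        then show ?thesis using z(2) by simp
      qed simp
    next
      assume "Im z = 0"
      then have "z = of_real (Re z)" "Re z < \<delta>" using z(1) Rez by (auto simp: complex_eq_iff cmod_def)
      then show "\<exists>s. 0 \<le> s \<and> s < \<delta> \<and> (z = s *\<^sub>R w \<or> z = of_real s)" using Rez by (intro exI[of _ "Re z"]) auto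
    qed
    finally show ?thesis .
  qed
  define A where "A \<tau> = ball 0 \<delta> \<inter> ({z. Complex 0 \<tau> \<bullet> z > 0} \<inter> {z. Complex \<kappa> (- \<tau>) \<bullet> z > 0})" for \<tau> :: real
  define P where "P \<tau> = (\<lambda>z. v + d * z) ` A \<tau>" for \<tau> :: real
  have A_iff: "z \<in> A \<tau> \<longleftrightarrow> norm z < \<delta> \<and> 0 < \<tau> * Im z \<and> \<bar>Im z\<bar> < \<kappa> * Re z" if "\<tau> = 1 \<or> \<tau> = -1" for z \<tau>
    using that by (auto simp: A_def inner_complex_def)
  have conn: "connected (P \<tau>)" for \<tau>
    unfolding P_def A_def
    by (intro connected_continuous_image continuous_intros convex_connected convex_Int convex_ball convex_halfspace_gt)
  have disj: "P \<tau> \<inter> \<Gamma> = {}" if "\<tau> = 1 \<or> \<tau> = -1" for \<tau>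
    using sector A_iff[OF that] by (force simp: P_def)
  \<comment> \<open>a point in the middle of the second edge, with a disc that fits into the sector\<close>
  define y where "y = v + d * of_real (\<delta> / 2)"
  define e where "e = \<kappa> * \<delta> / 8"
  have e: "e > 0" "e \<le> \<delta> / 8" using \<kappa> \<delta> by (auto simp: e_def)
  have yG: "y \<in> \<Gamma>" unfolding y_def using sector[of "of_real (\<delta> / 2)"] \<delta> \<kappa> by (simp add: norm_divide)
  have cover: "ball y e \<subseteq> P 1 \<union> P (-1) \<union> \<Gamma>"
  proof
    fix x assume x: "x \<in> ball y e"
    define z where "z = cnj d * (x - v)"
    have xz: "x = v + d * z" using dd by (simp add: z_def mult.assoc[symmetric])
    have "norm (d * (of_real (\<delta> / 2) - z)) < e" using x by (simp add: xz y_def dist_norm algebra_simps)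
    then have n: "norm (z - of_real (\<delta> / 2)) < e" using d by (simp add: norm_mult norm_minus_commute)
    have "\<bar>Re z - \<delta> / 2\<bar> < e" "\<bar>Im z\<bar> < e"
      using abs_Re_le_cmod[of "z - of_real (\<delta> / 2)"] abs_Im_le_cmod[of "z - of_real (\<delta> / 2)"] n by auto
    moreover have "norm z \<le> norm (z - of_real (\<delta> / 2)) + \<delta> / 2"
      using norm_triangle_ineq[of "z - of_real (\<delta> / 2)" "of_real (\<delta> / 2)"] \<delta> by (simp add: norm_divide)
    ultimately have z: "\<delta> / 8 < Re z" "\<bar>Im z\<bar> < e" "norm z < \<delta>" using n e \<delta> by linarith+
    have "e < \<kappa> * Re z" using z(1) \<kappa>(1) by (simp add: e_def)
    then have sec: "\<bar>Im z\<bar> < \<kappa> * Re z" using z(2) by linarith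
    show "x \<in> P 1 \<union> P (-1) \<union> \<Gamma>"
    proof (cases "Im z = 0")
      case True
      then show ?thesis using sector[OF z(3) sec] xz by simp
    next
      case False
      then have "z \<in> A 1 \<or> z \<in> A (-1)" using A_iff[of 1 z] A_iff[of "-1" z] z(3) sec by auto
      then show ?thesis unfolding P_def xz by blast
    qed
  qed
  have "\<exists>\<sigma>. (\<sigma> = 1 \<or> \<sigma> = -1) \<and> P \<sigma> \<subseteq> inside \<Gamma> \<and> P (- \<sigma>) \<subseteq> outside \<Gamma>"
    using two_sides[OF yG e(1) conn disj conn disj cover] by (metis minus_minus)
  then obtain \<sigma> where \<sigma>: "\<sigma> = 1 \<or> \<sigma> = -1" "P \<sigma> \<subseteq> inside \<Gamma>" "P (- \<sigma>) \<subseteq> outside \<Gamma>" by blast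
  show ?thesis
  proof (rule that[OF \<kappa> \<sigma>(1) sector])
    fix z assume z: "norm z < \<delta>" "\<bar>Im z\<bar> < \<kappa> * Re z"
    show "v + d * z \<in> inside \<Gamma>" if "0 < \<sigma> * Im z"
      using \<sigma>(2) A_iff[OF \<sigma>(1), of z] z that by (auto simp: P_def)
    have m: "- \<sigma> = 1 \<or> - \<sigma> = -1" using \<sigma>(1) by auto
    show "v + d * z \<in> outside \<Gamma>" if "\<sigma> * Im z < 0"
      using \<sigma>(3) A_iff[OF m, of z] z that by (auto simp: P_def)
  qed auto
qed

end

text \<open>A corner \<open>v\<close> of maximal norm with edges of directions \<open>d1\<close> and \<open>d\<close>, and a sector around the
  second edge as in \<open>corner_sector\<close>.\<close>

locale polygon_corner = polygon_curve +
  fixes v d1 d :: complex and \<delta>0 \<kappa> \<sigma> :: real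
  assumes vG: "v \<in> \<Gamma>" and extreme: "\<Gamma> \<subseteq> cball 0 (norm v)"
    and d1: "norm d1 = 1" and d: "norm d = 1" and vd: "v \<bullet> d < 0" and angle: "Im (d1 * cnj d) \<noteq> 0"
    and \<delta>0: "\<delta>0 > 0" and \<kappa>: "0 < \<kappa>" "\<kappa> \<le> 1" and \<sigma>: "\<sigma> = 1 \<or> \<sigma> = -1"
    and corner: "\<Gamma> \<inter> ball v \<delta>0 = {v + s *\<^sub>R d1 | s. 0 \<le> s \<and> s < \<delta>0} \<union> {v + s *\<^sub>R d | s. 0 \<le> s \<and> s < \<delta>0}"
    and sector_on: "\<And>z. norm z < \<delta>0 \<Longrightarrow> \<bar>Im z\<bar> < \<kappa> * Re z \<Longrightarrow> v + d * z \<in> \<Gamma> \<longleftrightarrow> Im z = 0"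
    and sector_in: "\<And>z. norm z < \<delta>0 \<Longrightarrow> \<bar>Im z\<bar> < \<kappa> * Re z \<Longrightarrow> 0 < \<sigma> * Im z \<Longrightarrow> v + d * z \<in> inside \<Gamma>"
    and sector_out: "\<And>z. norm z < \<delta>0 \<Longrightarrow> \<bar>Im z\<bar> < \<kappa> * Re z \<Longrightarrow> \<sigma> * Im z < 0 \<Longrightarrow> v + d * z \<in> outside \<Gamma>"
begin

definition R :: real where "R = 4 * norm v"
text \<open>The outer radius of the test functions: their support must lie in the disc in which the curve
  consists of two edges, in the unit disc, where the scaling estimate applies, and in the disc of
  radius \<open>R\<close>, where the singularity is harmonic.\<close>

definition \<delta> :: real where "\<delta> = min (min (\<delta>0 / 4) 1) (R / 8)"
definition u :: "complex \<Rightarrow> real" where "u = singular_fun (inside \<Gamma>) v d R"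
text \<open>A multiple of the direction of the first edge: it is orthogonal to the normal of the first edge,
  and it has inner product \<open>\<tau>\<close> with the normal \<open>\<tau> \<i> d\<close> of the second edge.\<close>

definition e :: complex where "e = (1 / Im (d1 * cnj d)) *\<^sub>R d1"

lemma R_pos: "R > 0"
  using vd by (auto simp: R_def)

lemma \<delta>: "\<delta> > 0" "\<delta> \<le> 1" "\<delta> < \<delta>0" "4 * \<delta> < R"
  using R_pos \<delta>0 by (auto simp: \<delta>_def min_def)

lemma d_cnj: "d * cnj d = 1" "cnj d * d = 1" and d_nz: "d \<noteq> 0"
  using d by (auto simp: complex_norm_square[symmetric] mult.commute[of "cnj d"])

lemma coord_cancel: "v + d * (cnj d * (x - v)) = x" "cnj d * (v + d * z - v) = z" "cnj d * (d * z) = z"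
  using d_cnj by (simp_all add: mult.assoc[symmetric])

lemma norm_coord: "norm (cnj d * (x - v)) = norm (x - v)"
  using d by (simp add: norm_mult)

text \<open>The inside lies in the closed disc through \<open>v\<close> centred at the origin. The half-line from \<open>v\<close> in
  the direction \<open>- d\<close> leaves this disc, so the principal branch of the logarithm is holomorphic on
  the inside.\<close>

lemma inside_bounds:
  assumes "x \<in> inside \<Gamma>"
  shows "cnj d * (x - v) \<in> slit_disc R" "norm (x - v) \<le> R / 2"
proof -
  have "x \<in> cball 0 (norm v)"
  proof (rule ccontr)
    assume "x \<notin> cball 0 (norm v)"
    then have "x \<in> outside \<Gamma>" using outside_subset_convex[OF convex_cball extreme] by blast
    then show False using assms Jordan(5) by blast
  qed
  then have nx: "norm x \<le> norm v" by simp
  then show n: "norm (x - v) \<le> R / 2" using norm_triangle_ineq4[of x v] by (simp add: R_def)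
  have xv: "x \<noteq> v" using assms vG Jordan(6) by blast
  have "cnj d * (x - v) \<notin> \<real>\<^sub>\<le>\<^sub>0"
  proof
    assume "cnj d * (x - v) \<in> \<real>\<^sub>\<le>\<^sub>0"
    then obtain t where t: "t \<le> 0" "cnj d * (x - v) = of_real t" by (auto elim: nonpos_Reals_cases)
    then have x: "x = v + t *\<^sub>R d" using coord_cancel(1)[of x] by (simp add: scaleR_conv_of_real mult.commute)
    then have t0: "t \<noteq> 0" using xv by auto
    have "(norm x)\<^sup>2 = (norm v)\<^sup>2 + 2 * t * (v \<bullet> d) + t\<^sup>2 * (d \<bullet> d)"
      unfolding x power2_norm_eq_inner inner_add_left inner_add_right inner_scaleR_left inner_scaleR_right
      by (simp add: inner_commute[of d v] power2_eq_square distrib_left)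
    moreover have "t * (v \<bullet> d) \<ge> 0" using t(1) vd by (simp add: mult_nonpos_nonpos)
    moreover have "t\<^sup>2 * (d \<bullet> d) > 0" using t0 d_nz by simp
    moreover have "(norm x)\<^sup>2 \<le> (norm v)\<^sup>2" using nx by (intro power_mono) auto
    ultimately show False by linarith
  qed
  then show "cnj d * (x - v) \<in> slit_disc R" using n R_pos norm_coord by (auto simp: slit_disc_def)
qed

lemma u_L2: "u \<in> L2 lborel"
  unfolding u_def using inside_bounds by (intro singular_fun_L2 Jordan d R_pos)

lemma u_harmonic: "harmonic_on (- \<Gamma>) u"
proof -
  have "harmonic_on (inside \<Gamma> \<union> outside \<Gamma>) u"
    unfolding u_def
  proof (rule singular_fun_harmonic)
    show "outside \<Gamma> \<inter> inside \<Gamma> = {}" using Jordan(5) by blast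
  qed (use Jordan(1,2) inside_bounds(1) in auto)
  then show ?thesis by (simp add: Jordan(6))
qed

text \<open>The test function in the coordinates of the corner: both its traces vanish on the first edge,
  its Dirichlet trace vanishes on the second edge, and its normal derivative there is \<open>\<mu>\<close> times
  the annular cutoff. The half-width of the strip is \<open>\<kappa> \<epsilon> / 16\<close>, so that the support, where \<open>Re z
  \<ge> \<epsilon> / 8\<close>, stays inside the sector.\<close>

definition \<Theta> :: "real \<Rightarrow> real \<Rightarrow> complex \<Rightarrow> real" where
  "\<Theta> \<mu> \<epsilon> z = Im z * (\<mu> * (annulus_cutoff \<delta> \<epsilon> z * ray_cutoff (\<kappa> * \<epsilon> / 16) \<epsilon> z))"

definition \<theta> :: "real \<Rightarrow> real \<Rightarrow> complex \<Rightarrow> real" where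
  "\<theta> \<mu> \<epsilon> x = \<Theta> \<mu> \<epsilon> (cnj d * (x - v))"

definition K :: "real \<Rightarrow> complex set" where
  "K \<epsilon> = {z. \<epsilon> / 8 \<le> Re z \<and> \<bar>Im z\<bar> \<le> \<kappa> * \<epsilon> / 16 \<and> norm z \<le> \<delta>}"

lemma smooth_\<Theta>: "smooth_expr (\<Theta> \<mu> \<epsilon>)"
  unfolding \<Theta>_def[abs_def]
  by (intro smooth_expr.mult smooth_expr.im smooth_expr.const smooth_expr_annulus_cutoff smooth_expr_ray_cutoff)

lemma smooth_\<theta>: "smooth_expr (\<theta> \<mu> \<epsilon>)"
  unfolding \<theta>_def[abs_def] by (rule smooth_expr_affine[OF smooth_\<Theta>])

lemma closed_K: "closed (K \<epsilon>)"
  unfolding K_def by (intro closed_Collect_conj closed_Collect_le continuous_intros)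

lemma \<Theta>_support:
  assumes \<epsilon>: "0 < \<epsilon>" "\<epsilon> \<le> \<delta> / 2" and z: "z \<notin> K \<epsilon>"
  shows "\<Theta> \<mu> \<epsilon> z = 0" "pderiv_dir b (\<Theta> \<mu> \<epsilon>) z = 0" "laplacian (\<Theta> \<mu> \<epsilon>) z = 0"
proof -
  have \<eta>: "0 < \<kappa> * \<epsilon> / 16" using \<epsilon> \<kappa> by simp
  have 0: "\<Theta> \<mu> \<epsilon> y = 0" if "y \<notin> K \<epsilon>" for y
    using that annulus_cutoff_values(2)[OF \<epsilon>, of y] ray_cutoff_values(2)[OF \<epsilon>(1) \<eta>, of y]
    by (auto simp: K_def \<Theta>_def)
  have o: "open (- K \<epsilon>)" using closed_K by (rule open_Compl)
  have 1: "pderiv_dir b (\<Theta> \<mu> \<epsilon>) y = 0" if "y \<notin> K \<epsilon>" for y b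
    using pderiv_dir_transform_open(1)[OF o, of y "\<lambda>_. 0" "\<Theta> \<mu> \<epsilon>" b] 0 that by simp
  have 2: "pderiv_dir c (pderiv_dir b (\<Theta> \<mu> \<epsilon>)) y = 0" if "y \<notin> K \<epsilon>" for y b c
    using pderiv_dir_transform_open(1)[OF o, of y "\<lambda>_. 0" "pderiv_dir b (\<Theta> \<mu> \<epsilon>)" c] 1 that by simp
  show "\<Theta> \<mu> \<epsilon> z = 0" "pderiv_dir b (\<Theta> \<mu> \<epsilon>) z = 0" "laplacian (\<Theta> \<mu> \<epsilon>) z = 0"
    using 0 1 2 z by (auto simp: laplacian_eq)
qed

lemma K_sector:
  assumes \<epsilon>: "0 < \<epsilon>" and z: "z \<in> K \<epsilon>"
  shows "norm z < \<delta>0" "\<bar>Im z\<bar> < \<kappa> * Re z"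
proof -
  show "norm z < \<delta>0" using z \<delta> by (auto simp: K_def)
  have "\<kappa> * \<epsilon> / 16 < \<kappa> * (\<epsilon> / 8)" using \<epsilon> \<kappa> by simp
  also have "\<dots> \<le> \<kappa> * Re z" using z \<kappa> by (auto simp: K_def)
  finally show "\<bar>Im z\<bar> < \<kappa> * Re z" using z by (auto simp: K_def)
qed

lemma \<Theta>_axis: "\<Theta> \<mu> \<epsilon> (of_real t) = 0"
  by (simp add: \<Theta>_def)

lemma \<Theta>_normal_derivative:
  "pderiv_dir \<i> (\<Theta> \<mu> \<epsilon>) (of_real t) = \<mu> * (annulus_cutoff \<delta> \<epsilon> (of_real t) * ray_cutoff (\<kappa> * \<epsilon> / 16) \<epsilon> (of_real t))"
proof -
  let ?B = "\<lambda>z. \<mu> * (annulus_cutoff \<delta> \<epsilon> z * ray_cutoff (\<kappa> * \<epsilon> / 16) \<epsilon> z)"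
  have B: "smooth_expr ?B"
    by (intro smooth_expr.mult smooth_expr.const smooth_expr_annulus_cutoff smooth_expr_ray_cutoff)
  have I: "(Im has_derivative Im) (at z)" for z
    by (rule bounded_linear.has_derivative[OF bounded_linear_Im has_derivative_ident])
  have "pderiv_dir \<i> (\<lambda>z. Im z * ?B z) (of_real t)
      = Im (of_real t) * pderiv_dir \<i> ?B (of_real t) + pderiv_dir \<i> Im (of_real t) * ?B (of_real t)"
    using I by (intro pderiv_dir_mult smooth_expr_differentiable[OF B]) (auto simp: differentiable_def)
  also have "pderiv_dir \<i> Im (of_real t) = 1" using pderiv_dir_eqI[OF I] by simp
  finally show ?thesis by (simp add: \<Theta>_def[abs_def])
qed

definition \<Phi> :: "real \<Rightarrow> complex \<Rightarrow> real" where
  "\<Phi> \<mu> z = \<mu> * (z \<bullet> e * cutoff ((norm z)\<^sup>2))"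

text \<open>The competitor with the same normal trace as \<open>\<theta>\<close>: the linear function \<open>(x - v) \<bullet> e\<close> times the
  annular cutoff. Being a difference of two rescaled copies of one function, it has a norm that is
  bounded independently of \<open>\<epsilon>\<close>.\<close>

definition \<psi> :: "real \<Rightarrow> real \<Rightarrow> complex \<Rightarrow> real" where
  "\<psi> \<mu> \<epsilon> x = rescaled (\<Phi> \<mu>) v \<delta> x - rescaled (\<Phi> \<mu>) v \<epsilon> x"

lemma \<psi>_eq:
  assumes "0 < \<epsilon>"
  shows "\<psi> \<mu> \<epsilon> x = (\<mu> * ((x - v) \<bullet> e)) * annulus_cutoff \<delta> \<epsilon> (x - v)"
proof -
  have "rescaled (\<Phi> \<mu>) v r x = \<mu> * ((x - v) \<bullet> e) * cutoff ((norm (x - v))\<^sup>2 / r\<^sup>2)" if "r > 0" for r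
  proof -
    have s: "of_real (1 / r) * (x - v) = (1 / r) *\<^sub>R (x - v)" by (rule scaleR_conv_of_real[symmetric])
    show ?thesis using that unfolding rescaled_def \<Phi>_def s norm_scaleR inner_scaleR_left power_mult_distrib
      by (simp add: power_divide)
  qed
  then show ?thesis using assms \<delta>(1) by (simp add: \<psi>_def annulus_cutoff_def right_diff_distrib)
qed

lemma pderiv_\<psi>_tangential:
  assumes \<epsilon>: "0 < \<epsilon>" and n: "(y - v) \<bullet> n = 0"
  shows "pderiv_dir n (\<psi> \<mu> \<epsilon>) y = \<mu> * (n \<bullet> e) * annulus_cutoff \<delta> \<epsilon> (y - v)"
proof -
  have "\<psi> \<mu> \<epsilon> = (\<lambda>x. (\<mu> * ((x - v) \<bullet> e)) * annulus_cutoff \<delta> \<epsilon> (x - v))" using \<psi>_eq[OF \<epsilon>] by auto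
  moreover have D: "((\<lambda>x. \<mu> * ((x - v) \<bullet> e)) has_derivative (\<lambda>n. \<mu> * (n \<bullet> e))) (at y)"
    by (auto intro!: derivative_eq_intros)
  moreover have "pderiv_dir n (\<lambda>x. (\<mu> * ((x - v) \<bullet> e)) * annulus_cutoff \<delta> \<epsilon> (x - v)) y
      = \<mu> * ((y - v) \<bullet> e) * pderiv_dir n (\<lambda>x. annulus_cutoff \<delta> \<epsilon> (x - v)) y
        + pderiv_dir n (\<lambda>x. \<mu> * ((x - v) \<bullet> e)) y * annulus_cutoff \<delta> \<epsilon> (y - v)"
    using D by (intro pderiv_dir_mult smooth_expr_differentiable[OF smooth_expr_translate[OF smooth_expr_annulus_cutoff]])
      (auto simp: differentiable_def)
  ultimately show ?thesis
    using pderiv_dir_annulus_cutoff_tangential[OF n] pderiv_dir_eqI[OF D, of n] by simp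
qed

lemma \<psi>_far:
  assumes \<epsilon>: "0 < \<epsilon>" "\<epsilon> \<le> \<delta> / 2" and y: "\<delta> < norm (y - v)"
  shows "\<psi> \<mu> \<epsilon> y = 0" "pderiv_dir n (\<psi> \<mu> \<epsilon>) y = 0"
proof -
  have 0: "\<psi> \<mu> \<epsilon> x = 0" if "\<delta> < norm (x - v)" for x
    using annulus_cutoff_values(2)[OF \<epsilon>, of "x - v"] that \<psi>_eq[OF \<epsilon>(1)] by simp
  then show "\<psi> \<mu> \<epsilon> y = 0" using y by simp
  have "open {x. \<delta> < norm (x - v)}" by (intro open_Collect_less continuous_intros)
  from pderiv_dir_transform_open(1)[OF this, of y "\<lambda>_. 0" "\<psi> \<mu> \<epsilon>" n] 0 y
  show "pderiv_dir n (\<psi> \<mu> \<epsilon>) y = 0" by simp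
qed

lemma \<theta>_trace:
  assumes \<epsilon>: "0 < \<epsilon>" "\<epsilon> \<le> \<delta> / 2" and y: "y \<in> \<Gamma>"
  shows "\<theta> \<mu> \<epsilon> y = 0"
proof (cases "cnj d * (y - v) \<in> K \<epsilon>")
  case True
  from K_sector[OF \<epsilon>(1) True] sector_on[of "cnj d * (y - v)"] y
  have "Im (cnj d * (y - v)) = 0" unfolding coord_cancel by blast
  then show ?thesis by (simp add: \<theta>_def \<Theta>_def)
next
  case False
  then show ?thesis using \<Theta>_support(1)[OF \<epsilon>] by (simp add: \<theta>_def)
qed

lemma pderiv_\<theta>: "pderiv_dir n (\<theta> \<mu> \<epsilon>) y = pderiv_dir (cnj d * n) (\<Theta> \<mu> \<epsilon>) (cnj d * (y - v))"
  unfolding \<theta>_def[abs_def] by (intro pderiv_dir_affine smooth_expr_differentiable smooth_\<Theta>)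

text \<open>A radial cutoff has no normal derivative on an edge that issues from the centre, so the normal
  trace of \<open>\<psi>\<close> on an edge with normal \<open>n\<close> is \<open>\<mu> (n \<bullet> e)\<close> times the cutoff. By the choice of \<open>e\<close>,
  this vanishes on the first edge and equals the normal trace of \<open>\<theta>\<close> on the second one.\<close>

lemma normal_traces_agree:
  assumes \<epsilon>: "0 < \<epsilon>" "\<epsilon> \<le> \<delta> / 2" and y: "y \<in> \<Gamma>" "y = g t" "locally_affine B t"
  shows "pderiv_dir (outer_normal \<Gamma> y) (\<theta> \<mu> \<epsilon>) y = pderiv_dir (outer_normal \<Gamma> y) (\<psi> \<mu> \<epsilon>) y"
proof -
  obtain r n l where r: "r > 0" and n: "norm n = 1" and l: "norm l = 1" "l \<bullet> n = 0"
    and line: "\<Gamma> \<inter> ball y r = {y + s *\<^sub>R l | s. \<bar>s\<bar> < r}" and nu: "\<And>y'. y' \<in> \<Gamma> \<inter> ball y r \<Longrightarrow> outer_normal \<Gamma> y' = n"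
    using outer_normal_locally_constant[OF y(3)] unfolding y(2) by blast
  have nu: "outer_normal \<Gamma> y = n" using nu y(1) r by simp
  have perp: "c \<bullet> n = 0" if c: "norm c = 1" "y = v + s *\<^sub>R c" "0 \<le> s" "s < \<delta>0"
    "\<And>s. 0 \<le> s \<Longrightarrow> s < \<delta>0 \<Longrightarrow> v + s *\<^sub>R c \<in> \<Gamma>" for c s
  proof -
    define h where "h = min (\<delta>0 - s) r / 2"
    have h0: "0 < h" "h \<le> (\<delta>0 - s) / 2" "h \<le> r / 2" using c(4) r by (auto simp: h_def)
    have sd: "s < \<delta>0" by (rule c(4))
    have "2 * h \<le> \<delta>0 - s" using h0(2) by simp
    then have "s + h < \<delta>0" using sd h0(1) by linarith
    with h0 r have h: "0 < h" "h < r" "s + h < \<delta>0" by linarith+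
    have yh: "y + h *\<^sub>R c = v + (s + h) *\<^sub>R c" by (simp add: c(2) scaleR_add_left)
    have "v + (s + h) *\<^sub>R c \<in> \<Gamma>" using c(3) h by (intro c(5)) auto
    moreover have "y + h *\<^sub>R c \<in> ball y r" using c(1) h by (simp add: dist_norm)
    ultimately have "y + h *\<^sub>R c \<in> \<Gamma> \<inter> ball y r" unfolding yh by blast
    then obtain s' where "y + h *\<^sub>R c = y + s' *\<^sub>R l" unfolding line by blast
    then have "(h *\<^sub>R c) \<bullet> n = (s' *\<^sub>R l) \<bullet> n" by simp
    then show ?thesis using l(2) h(1) by simp
  qed
  show ?thesis unfolding nu
  proof (cases "norm (y - v) \<le> \<delta>")
    case False
    then have "cnj d * (y - v) \<notin> K \<epsilon>" using norm_coord[of y] by (auto simp: K_def)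
    then have "pderiv_dir n (\<theta> \<mu> \<epsilon>) y = 0" unfolding pderiv_\<theta> by (rule \<Theta>_support(2)[OF \<epsilon>])
    moreover have "pderiv_dir n (\<psi> \<mu> \<epsilon>) y = 0" using False by (intro \<psi>_far(2)[OF \<epsilon>]) simp
    ultimately show "pderiv_dir n (\<theta> \<mu> \<epsilon>) y = pderiv_dir n (\<psi> \<mu> \<epsilon>) y" by simp
  next
    case True
    then have "y \<in> \<Gamma> \<inter> ball v \<delta>0" using y(1) \<delta>(3) by (simp add: dist_norm norm_minus_commute)
    then consider s where "y = v + s *\<^sub>R d1" "0 \<le> s" "s < \<delta>0" | s where "y = v + s *\<^sub>R d" "0 \<le> s" "s < \<delta>0"
      unfolding corner by blast
    then show "pderiv_dir n (\<theta> \<mu> \<epsilon>) y = pderiv_dir n (\<psi> \<mu> \<epsilon>) y"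
    proof cases
      case (1 s)
      have "v + s *\<^sub>R d1 \<in> \<Gamma>" if "0 \<le> s" "s < \<delta>0" for s using corner that by blast
      then have dn: "d1 \<bullet> n = 0" by (intro perp[OF d1 1])
      then have "n \<bullet> e = 0" "(y - v) \<bullet> n = 0" by (simp_all add: e_def 1(1) inner_commute)
      then have p: "pderiv_dir n (\<psi> \<mu> \<epsilon>) y = 0" using pderiv_\<psi>_tangential[OF \<epsilon>(1)] by simp
      have "cnj d * (y - v) \<notin> K \<epsilon>"
      proof
        assume k: "cnj d * (y - v) \<in> K \<epsilon>"
        from K_sector[OF \<epsilon>(1) k] sector_on[of "cnj d * (y - v)"] y(1)
        have "Im (cnj d * (y - v)) = 0" unfolding coord_cancel by blast
        then have "s * Im (d1 * cnj d) = 0" by (simp add: 1(1) mult.commute)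
        then have "s = 0" using angle by simp
        then show False using k 1(1) \<epsilon> by (simp add: K_def)
      qed
      then have "pderiv_dir n (\<theta> \<mu> \<epsilon>) y = 0" unfolding pderiv_\<theta> by (rule \<Theta>_support(2)[OF \<epsilon>])
      then show ?thesis using p by simp
    next
      case (2 s)
      have "v + s *\<^sub>R d \<in> \<Gamma>" if "0 \<le> s" "s < \<delta>0" for s using corner that by blast
      then have dn: "d \<bullet> n = 0" by (intro perp[OF d 2])
      obtain \<tau> :: real where \<tau>: "n = \<tau> *\<^sub>R (\<i> * d)"
        using unit_perp_cases[OF d n dn] by (metis scaleR_one scaleR_minus1_left)
      have z: "cnj d * (y - v) = of_real s" using d_cnj by (simp add: 2(1) scaleR_conv_of_real mult.left_commute)
      have cn: "cnj d * n = \<tau> *\<^sub>R \<i>" using d_cnj by (simp add: \<tau> mult.left_commute)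
      have yn: "(y - v) \<bullet> n = 0" using dn by (simp add: 2(1))
      have "n \<bullet> d1 = \<tau> * Im (d1 * cnj d)"
      proof -
        have "(\<i> * d) \<bullet> d1 = Im (d1 * cnj d)" by (simp add: inner_complex_def algebra_simps)
        then show ?thesis by (simp only: \<tau> inner_scaleR_left)
      qed
      then have ne: "n \<bullet> e = \<tau>" using angle by (simp add: e_def)
      have val: "annulus_cutoff \<delta> \<epsilon> (of_real s) * ray_cutoff (\<kappa> * \<epsilon> / 16) \<epsilon> (of_real s) = annulus_cutoff \<delta> \<epsilon> (of_real s)"
      proof (cases "\<epsilon> / 2 \<le> s")
        case True
        then show ?thesis using ray_cutoff_values(3)[of \<epsilon> "\<kappa> * \<epsilon> / 16" s] \<epsilon> \<kappa> by simp
      next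
        case False
        then show ?thesis using annulus_cutoff_values(3)[OF \<epsilon>, of "of_real s"] 2(2) by simp
      qed
      have rad: "annulus_cutoff \<delta> \<epsilon> (y - v) = annulus_cutoff \<delta> \<epsilon> (of_real s)"
        using d 2 by (simp add: annulus_cutoff_def)
      have "pderiv_dir n (\<theta> \<mu> \<epsilon>) y = \<tau> * pderiv_dir \<i> (\<Theta> \<mu> \<epsilon>) (of_real s)"
        unfolding pderiv_\<theta> z cn
        using pderiv_dir_decompose[OF smooth_expr_differentiable[OF smooth_\<Theta>], of "\<tau> *\<^sub>R \<i>"] by simp
      also have "\<dots> = \<mu> * (n \<bullet> e) * annulus_cutoff \<delta> \<epsilon> (y - v)"
        unfolding \<Theta>_normal_derivative val rad ne by simp
      also have "\<dots> = pderiv_dir n (\<psi> \<mu> \<epsilon>) y" using pderiv_\<psi>_tangential[OF \<epsilon>(1) yn] by simp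
      finally show ?thesis .
    qed
  qed
qed

text \<open>After the change of coordinates, Green's formula reduces the pairing to the integral of \<open>1 / (t
  ln (R / t))\<close> against the annular cutoff, which is one for \<open>\<epsilon> \<le> t \<le> \<delta> / 2\<close>.\<close>

lemma pairing:
  assumes \<epsilon>: "0 < \<epsilon>" "\<epsilon> \<le> \<delta> / 2" and \<mu>: "\<mu> > 0"
  shows "\<mu> * (ln (ln (R / \<epsilon>)) - ln (ln (R / (\<delta> / 2)))) \<le> \<bar>\<integral>x. u x * laplacian (\<theta> \<mu> \<epsilon>) x \<partial>lborel\<bar>"
proof -
  let ?V = "\<lambda>z. Re (corner_sing R z)"
  let ?B = "\<lambda>t. annulus_cutoff \<delta> \<epsilon> (of_real t) * ray_cutoff (\<kappa> * \<epsilon> / 16) \<epsilon> (of_real t)"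
  define a b c where "a = \<epsilon> / 16" and "b = 2 * \<delta>" and "c = \<kappa> * \<epsilon> / 8"
  have abc: "0 < a" "a < b" "0 < c" "c \<le> \<epsilon> / 8" "a < \<epsilon>" "\<delta> / 2 < b" "b < R"
    using \<epsilon> \<kappa> \<delta> by (auto simp: a_def b_def c_def mult_le_cancel_right1)
  have m: "u \<in> borel_measurable borel"
    unfolding u_def using inside_bounds by (intro singular_fun_measurable Jordan)
  have lm: "laplacian (\<theta> \<mu> \<epsilon>) \<in> borel_measurable borel"
    by (intro borel_measurable_continuous_onI smooth_expr_continuous smooth_expr_laplacian smooth_\<theta>)
  have "(\<integral>x. u x * laplacian (\<theta> \<mu> \<epsilon>) x \<partial>lborel) = (\<integral>z. u (v + d * z) * laplacian (\<theta> \<mu> \<epsilon>) (v + d * z) \<partial>lborel)"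
    by (rule lborel_integral_isometry[symmetric, OF _ d]) (intro borel_measurable_times m lm)
  also have "\<dots> = (\<integral>z. (if 0 < \<sigma> * Im z then ?V z else 0) * laplacian (\<Theta> \<mu> \<epsilon>) z \<partial>lborel)"
  proof (rule Bochner_Integration.integral_cong[OF refl])
    fix z
    have "laplacian (\<theta> \<mu> \<epsilon>) (v + d * z) = laplacian (\<Theta> \<mu> \<epsilon>) z"
      unfolding \<theta>_def[abs_def] using laplacian_isometry[OF smooth_\<Theta>, of "cnj d" \<mu> \<epsilon> v "v + d * z"] d
      unfolding coord_cancel by simp
    moreover have "u (v + d * z) = (if 0 < \<sigma> * Im z then ?V z else 0)" if z: "z \<in> K \<epsilon>"
    proof -
      note s = K_sector[OF \<epsilon>(1) z]
      consider "0 < \<sigma> * Im z" | "\<sigma> * Im z < 0" | "Im z = 0" using \<sigma> by fastforce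
      then show ?thesis
      proof cases
        case 1
        then show ?thesis using sector_in[OF s 1] by (simp add: u_def singular_fun_def coord_cancel)
      next
        case 2
        have "v + d * z \<notin> inside \<Gamma>" using sector_out[OF s 2] Jordan(5) by blast
        then show ?thesis using 2 by (simp add: u_def singular_fun_def)
      next
        case 3
        have "v + d * z \<notin> inside \<Gamma>" using sector_on[OF s] 3 Jordan(6) by blast
        then show ?thesis using 3 by (simp add: u_def singular_fun_def)
      qed
    qed
    ultimately show "u (v + d * z) * laplacian (\<theta> \<mu> \<epsilon>) (v + d * z)
        = (if 0 < \<sigma> * Im z then ?V z else 0) * laplacian (\<Theta> \<mu> \<epsilon>) z"
      using \<Theta>_support(3)[OF \<epsilon>, of z \<mu>] by (cases "z \<in> K \<epsilon>") auto
  qed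
  also have "\<dots> = - \<sigma> * (\<integral>t. indicator {a..b} t * (?V (of_real t) * pderiv_dir \<i> (\<Theta> \<mu> \<epsilon>) (of_real t)) \<partial>lborel)"
  proof (rule half_plane_green[where S = "slit_disc R" and K = "K \<epsilon>" and c = c])
    show "harmonic_on (slit_disc R) ?V"
      by (rule harmonic_on_Re_holomorphic[OF corner_sing_holomorphic open_slit_disc])
    show "a < Re z \<and> Re z < b \<and> - c < Im z \<and> Im z < c" if "z \<in> K \<epsilon>" for z
    proof -
      have "Re z \<le> \<delta>" using that abs_Re_le_cmod[of z] by (auto simp: K_def)
      moreover have "\<bar>Im z\<bar> \<le> c / 2" "\<epsilon> / 8 \<le> Re z" using that by (auto simp: K_def c_def)
      ultimately show ?thesis using abc \<epsilon> \<delta> unfolding a_def b_def by auto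
    qed
    show "z \<in> slit_disc R" if "a \<le> Re z" "Re z \<le> b" "- c \<le> Im z" "Im z \<le> c" for z
    proof -
      have "norm z \<le> b + c" using cmod_le[of z] that abc by auto
      also have "\<dots> < R" using abc \<epsilon> \<delta> unfolding b_def by linarith
      finally show ?thesis using that abc by (auto simp: slit_disc_def complex_nonpos_Reals_iff)
    qed
    show "\<Theta> \<mu> \<epsilon> z = 0" if "z \<notin> K \<epsilon>" for z by (rule \<Theta>_support(1)[OF \<epsilon> that])
  qed (use abc \<sigma> in \<open>auto simp: smooth_\<Theta> closed_K \<Theta>_axis\<close>)
  also have "(\<lambda>t. indicator {a..b} t * (?V (of_real t) * pderiv_dir \<i> (\<Theta> \<mu> \<epsilon>) (of_real t)))
      = (\<lambda>t. - \<mu> * (indicator {a..b} t * (1 / (t * ln (R / t)) * ?B t)))"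
  proof
    fix t
    show "indicator {a..b} t * (?V (of_real t) * pderiv_dir \<i> (\<Theta> \<mu> \<epsilon>) (of_real t))
        = - \<mu> * (indicator {a..b} t * (1 / (t * ln (R / t)) * ?B t))"
    proof (cases "t \<in> {a..b}")
      case True
      then have "0 < t" "t < R" using abc by auto
      then show ?thesis unfolding corner_sing_real[OF \<open>0 < t\<close> \<open>t < R\<close>] \<Theta>_normal_derivative by simp
    qed simp
  qed
  also have "(\<integral>t. - \<mu> * (indicator {a..b} t * (1 / (t * ln (R / t)) * ?B t)) \<partial>lborel)
      = - \<mu> * (\<integral>t. indicator {a..b} t * (1 / (t * ln (R / t)) * ?B t) \<partial>lborel)"
    by (rule integral_mult_right_zero)
  finally have "\<bar>\<integral>x. u x * laplacian (\<theta> \<mu> \<epsilon>) x \<partial>lborel\<bar>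
      = \<mu> * \<bar>\<integral>t. indicator {a..b} t * (1 / (t * ln (R / t)) * ?B t) \<partial>lborel\<bar>"
    using \<sigma> \<mu> by (auto simp: abs_mult)
  moreover have "ln (ln (R / \<epsilon>)) - ln (ln (R / (\<delta> / 2))) \<le> (\<integral>t. indicator {a..b} t * (1 / (t * ln (R / t)) * ?B t) \<partial>lborel)"
  proof -
    have pq: "0 < \<epsilon>" "\<epsilon> \<le> \<delta> / 2" "\<delta> / 2 < R" using \<epsilon> \<delta> by auto
    have k: "0 < 1 / (t * ln (R / t))" if "t \<in> {a..b}" for t
      using that abc by (intro divide_pos_pos mult_pos_pos ln_gt_zero) (auto simp: less_divide_eq)
    have B0: "0 \<le> ?B t" for t
      using annulus_cutoff_values(1)[OF \<epsilon>] ray_cutoff_values(1)[of \<epsilon> "\<kappa> * \<epsilon> / 16"] \<epsilon> \<kappa> by simp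
    have "continuous_on {a..b} (\<lambda>t. 1 / (t * ln (R / t)) * ?B t)"
    proof (intro continuous_intros ballI)
      show "t \<noteq> 0" "R / t \<noteq> 0" "t * ln (R / t) \<noteq> 0" if "t \<in> {a..b}" for t
        using k[OF that] that abc by auto
      show "continuous_on {a..b} (\<lambda>t. annulus_cutoff \<delta> \<epsilon> (of_real t))"
        by (rule continuous_on_compose2[OF smooth_expr_continuous[OF smooth_expr_annulus_cutoff, of UNIV]]) (auto intro!: continuous_intros)
      show "continuous_on {a..b} (\<lambda>t. ray_cutoff (\<kappa> * \<epsilon> / 16) \<epsilon> (of_real t))"
        by (rule continuous_on_compose2[OF smooth_expr_continuous[OF smooth_expr_ray_cutoff, of UNIV]]) (auto intro!: continuous_intros)
    qed
    from borel_integrable_compact[OF compact_Icc this]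
    have i: "integrable lborel (\<lambda>t. indicator {a..b} t * (1 / (t * ln (R / t)) * ?B t))" by simp
    have "(\<integral>t. indicator {\<epsilon>..\<delta> / 2} t * (1 / (t * ln (R / t))) \<partial>lborel) \<le> (\<integral>t. indicator {a..b} t * (1 / (t * ln (R / t)) * ?B t) \<partial>lborel)"
    proof (rule integral_mono[OF loglog_integral(1)[OF pq] i])
      fix t :: real
      show "indicator {\<epsilon>..\<delta> / 2} t * (1 / (t * ln (R / t))) \<le> indicator {a..b} t * (1 / (t * ln (R / t)) * ?B t)"
      proof (cases "t \<in> {\<epsilon>..\<delta> / 2}")
        case True
        then have "annulus_cutoff \<delta> \<epsilon> (of_real t) = 1" using \<epsilon> by (intro annulus_cutoff_values(4)[OF \<epsilon>]) auto
        moreover have "ray_cutoff (\<kappa> * \<epsilon> / 16) \<epsilon> (of_real t) = 1" using True \<epsilon> \<kappa> by (intro ray_cutoff_values(3)) auto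
        moreover have "t \<in> {a..b}" using True abc by auto
        ultimately show ?thesis using True by simp
      next
        case False
        then show ?thesis using k[of t] B0[of t] by (cases "t \<in> {a..b}") (auto intro!: mult_nonneg_nonneg simp del: mult_eq_0_iff)
      qed
    qed
    then show ?thesis unfolding loglog_integral(2)[OF pq] .
  qed
  ultimately show ?thesis using \<mu> by (simp add: order_trans[OF _ abs_ge_self])
qed

text \<open>The left-hand side of the estimate \<open>pairing\<close> tends to infinity as \<open>\<epsilon>\<close> tends to zero, whereas
  \<open>representable_pairing_bounded\<close> bounds the right-hand side.\<close>

lemma u_not_representable:
  "\<not> (\<exists>q. \<exists>p \<in> H_minus_1_2 g. \<exists>v w. single_layer_ext g q v \<and> double_layer_ext g p w \<and> (AE x in lborel. u x = v x + w x))"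
proof
  assume "\<exists>q. \<exists>p \<in> H_minus_1_2 g. \<exists>v w. single_layer_ext g q v \<and> double_layer_ext g p w \<and> (AE x in lborel. u x = v x + w x)"
  then obtain q p s w where rep: "p \<in> H_minus_1_2 g" "single_layer_ext g q s" "double_layer_ext g p w"
    "AE x in lborel. u x = s x + w x" by blast
  obtain \<rho> C where "layer_curve g \<rho> C" using layer_curve by blast
  from layer_curve.representable_pairing_bounded[OF this rep] obtain B where
    B: "\<And>\<theta> \<psi> r. smooth_expr \<theta> \<Longrightarrow> smooth_expr \<psi> \<Longrightarrow> (\<forall>x. r < norm x \<longrightarrow> \<theta> x = 0 \<and> \<psi> x = 0) \<Longrightarrow>
      W2_norm \<psi> (grad \<psi>) (hess \<psi>) \<le> 1 \<Longrightarrow>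
      (AE y in arclength g. \<theta> y = 0 \<and> pderiv_dir (outer_normal \<Gamma> y) \<theta> y = pderiv_dir (outer_normal \<Gamma> y) \<psi> y) \<Longrightarrow>
      \<bar>\<integral>x. u x * laplacian \<theta> x \<partial>lborel\<bar> \<le> B" by blast
  obtain \<mu> where \<mu>: "\<mu> > 0" "unit_bump (\<Phi> \<mu>) (1 / 16)"
    using unit_bump_exists[of e] by (auto simp: \<Phi>_def[abs_def])
  obtain E where E: "finite E" "finite {t \<in> {0..1}. g t \<in> E}" "\<And>y. y \<in> \<Gamma> - E \<Longrightarrow> \<exists>B t. y = g t \<and> locally_affine B t"
    using finite_exceptional_set by metis
  have bound: "\<mu> * (ln (ln (R / \<epsilon>)) - ln (ln (R / (\<delta> / 2)))) \<le> B" if \<epsilon>: "0 < \<epsilon>" "\<epsilon> \<le> \<delta> / 2" for \<epsilon>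
  proof -
    have \<epsilon>1: "\<epsilon> \<le> 1" using \<epsilon> \<delta> by linarith
    have "smooth_expr (\<psi> \<mu> \<epsilon>)" unfolding \<psi>_def[abs_def]
      by (intro smooth_expr_diff rescaled_props(1)[OF \<mu>(2)] \<delta> \<epsilon> \<epsilon>1)
    moreover have "\<forall>x::complex. norm v + \<delta> < norm x \<longrightarrow> \<theta> \<mu> \<epsilon> x = 0 \<and> \<psi> \<mu> \<epsilon> x = 0"
    proof (intro allI impI)
      fix x :: complex assume "norm v + \<delta> < norm x"
      then have far: "\<delta> < norm (x - v)" using norm_triangle_ineq2[of x v] by linarith
      then have "cnj d * (x - v) \<notin> K \<epsilon>" using norm_coord[of x] by (auto simp: K_def)
      then show "\<theta> \<mu> \<epsilon> x = 0 \<and> \<psi> \<mu> \<epsilon> x = 0"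
        using \<Theta>_support(1)[OF \<epsilon>] \<psi>_far(1)[OF \<epsilon> far] by (simp add: \<theta>_def)
    qed
    moreover have "W2_norm (\<psi> \<mu> \<epsilon>) (grad (\<psi> \<mu> \<epsilon>)) (hess (\<psi> \<mu> \<epsilon>)) \<le> 1"
      unfolding \<psi>_def[abs_def] by (rule W2_norm_rescaled_difference[OF \<mu>(2) \<delta>(1,2) \<epsilon>(1) \<epsilon>1]) simp
    moreover have "AE y in arclength g. \<theta> \<mu> \<epsilon> y = 0 \<and>
        pderiv_dir (outer_normal \<Gamma> y) (\<theta> \<mu> \<epsilon>) y = pderiv_dir (outer_normal \<Gamma> y) (\<psi> \<mu> \<epsilon>) y"
    proof (rule AE_arclength[of E])
      show "E \<in> sets borel" using E(1) by (intro borel_closed finite_imp_closed)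
      fix y assume y: "y \<in> \<Gamma>" "y \<notin> E"
      then obtain B t where "y = g t" "locally_affine B t" using E(3) by blast
      then show "\<theta> \<mu> \<epsilon> y = 0 \<and>
        pderiv_dir (outer_normal \<Gamma> y) (\<theta> \<mu> \<epsilon>) y = pderiv_dir (outer_normal \<Gamma> y) (\<psi> \<mu> \<epsilon>) y"
        using \<theta>_trace[OF \<epsilon> y(1)] normal_traces_agree[OF \<epsilon> y(1)] by blast
    qed (rule E(2))
    ultimately have "\<bar>\<integral>x. u x * laplacian (\<theta> \<mu> \<epsilon>) x \<partial>lborel\<bar> \<le> B"
      by (rule B[OF smooth_\<theta>])
    then show ?thesis using pairing[OF \<epsilon> \<mu>(1)] by linarith
  qed
  \<comment> \<open>the value that \<open>ln ln (R / \<epsilon>)\<close> has to take; the maximum with the second argument ensures that \<open>\<epsilon> \<le> \<delta> / 2\<close>\<close>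
  define X where "X = max (ln (ln (R / (\<delta> / 2))) + B / \<mu> + 1) (ln (ln (R / (\<delta> / 2))))"
  define \<epsilon> where "\<epsilon> = R / exp (exp X)"
  have l1: "ln (R / (\<delta> / 2)) > 0" using \<delta> by (intro ln_gt_zero) (simp add: less_divide_eq)
  have \<epsilon>: "0 < \<epsilon>" using R_pos by (simp add: \<epsilon>_def)
  have RE: "R / \<epsilon> = exp (exp X)" using R_pos by (simp add: \<epsilon>_def)
  have "ln (R / (\<delta> / 2)) \<le> exp X" using l1 by (simp add: X_def ln_le_cancel_iff flip: ln_le_cancel_iff[of "ln _" "exp _"])
  then have "R / (\<delta> / 2) \<le> exp (exp X)" using R_pos \<delta> by (metis divide_pos_pos exp_le_cancel_iff exp_ln half_gt_zero)
  then have \<epsilon>2: "\<epsilon> \<le> \<delta> / 2" using R_pos \<delta>(1) by (simp add: \<epsilon>_def field_simps)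
  have "\<mu> * (X - ln (ln (R / (\<delta> / 2)))) \<le> B" using bound[OF \<epsilon> \<epsilon>2] unfolding RE by simp
  then have "X - ln (ln (R / (\<delta> / 2))) \<le> B / \<mu>" using \<mu>(1) by (simp add: pos_le_divide_eq mult.commute)
  then show False by (simp add: X_def)
qed

end

theorem theorem1p7:
  fixes vs :: "complex list"
  assumes "simple_polygon vs"
    and "log_capacity (path_image (polygon_loop vs)) < 1"
  shows "\<exists>u. u \<in> L2 lborel \<and> harmonic_on (- path_image (polygon_loop vs)) u \<and>
           \<not> (\<exists>q \<in> H_minus_3_2 (polygon_loop vs). \<exists>p \<in> H_minus_1_2 (polygon_loop vs). \<exists>v w.
                single_layer_ext (polygon_loop vs) q v \<and>
                double_layer_ext (polygon_loop vs) p w \<and>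
                (AE x in lborel. u x = v x + w x))"
proof -
  let ?g = "polygon_loop vs"
  interpret polygon_curve ?g by (rule polygon_curve_polygon_loop[OF assms(1)])
  obtain v d1 d \<delta>0 where c: "v \<in> \<Gamma>" "\<Gamma> \<subseteq> cball 0 (norm v)" "norm d1 = 1" "norm d = 1" "\<delta>0 > 0"
    "v \<bullet> d1 < 0" "v \<bullet> d < 0" "d1 \<noteq> d"
    and corner: "\<Gamma> \<inter> ball v \<delta>0 = {v + s *\<^sub>R d1 | s. 0 \<le> s \<and> s < \<delta>0} \<union> {v + s *\<^sub>R d | s. 0 \<le> s \<and> s < \<delta>0}"
    by (rule convex_corner)
  have angle: "Im (d1 * cnj d) \<noteq> 0"
  proof
    assume "Im (d1 * cnj d) = 0"
    moreover have "norm (d1 * cnj d) = 1" using c by (simp add: norm_mult)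
    ultimately have "d1 * cnj d = 1 \<or> d1 * cnj d = -1" by (auto simp: complex_eq_iff cmod_def)
    then have "d1 = d * 1 \<or> d1 = d * (- 1)" using unit_decompose[OF c(4), of d1] by metis
    then show False using c(6-8) by auto
  qed
  obtain \<kappa> \<sigma> where "0 < \<kappa>" "\<kappa> \<le> 1" "\<sigma> = 1 \<or> \<sigma> = (-1::real)"
    "\<And>z. norm z < \<delta>0 \<Longrightarrow> \<bar>Im z\<bar> < \<kappa> * Re z \<Longrightarrow> v + d * z \<in> \<Gamma> \<longleftrightarrow> Im z = 0"
    "\<And>z. norm z < \<delta>0 \<Longrightarrow> \<bar>Im z\<bar> < \<kappa> * Re z \<Longrightarrow> 0 < \<sigma> * Im z \<Longrightarrow> v + d * z \<in> inside \<Gamma>"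
    "\<And>z. norm z < \<delta>0 \<Longrightarrow> \<bar>Im z\<bar> < \<kappa> * Re z \<Longrightarrow> \<sigma> * Im z < 0 \<Longrightarrow> v + d * z \<in> outside \<Gamma>"
    by (rule corner_sector[OF corner c(3,4) angle c(5)]) (rule that; assumption)
  then interpret polygon_corner ?g v d1 d \<delta>0 \<kappa> \<sigma>
    using c corner angle by unfold_locales auto
  show ?thesis using u_L2 u_harmonic u_not_representable by blast
qed

end
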